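(* Let $n\ge 2$, and let $f_0(x,\theta)=(x+1,\theta)$, $h_0(x,\theta)=(nx,\theta+\ln n)$ be the generators of the standard $BS(1,n)$-action on $\mathbb T^2=(\mathbb R\cup\{\infty\})\times S^1$. Let $\mathcal C_1=\{\infty\}\times S^1$ and $\mathcal C_2=\{0\}\times S^1$. For every $\varepsilon>0$ there exist $C^1$-neighborhoods of $f_0$ and of $h_0$ in $\mathrm{Diff}^1(\mathbb T^2)$ such that, whenever $f$ and $h$ belong respectively to these neighborhoods and generate a $BS(1,n)$-action (i.e. $h\circ f\circ h^{-1}=f^n$), the following hold. (1) There exist two $h$-invariant circles $\mathcal C_1'$ and $\mathcal C_2'$ that are $\varepsilon$-close to $\mathcal C_1$ and $\mathcal C_2$ respectively. Moreover, the $\omega_h$-limit set of any point of $\mathbb T^2\setminus \mathcal C_2'$ is included in $\mathcal C_1'$, and the $\alpha_h$-limit set of any point of $\mathbb T^2\setminus\mathcal C_1'$ is included in $\mathcal C_2'$. (2) The set $\mathrm{fix}(f)$ of fixed points of $f$ is non-empty and is contained in $\mathcal C_1'$. (3) Either (a) there exist finite orbits of the action $\langle f,h\rangle$ contained in $\mathcal C_1'$, or (b) the action $\langle f,h\rangle$ has a unique minimal set $M$, and $M$ is included in $\mathcal C_1'$ and in $\mathrm{fix}(f)$; moreover $M$ is either $\mathcal C_1'$ or a Cantor set.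
   Context: The circle $\mathbb R\cup\{\infty\}$ is the real projective line with its usual smooth structure and $S^1=\mathbb R/\mathbb Z$; $\infty+1=\infty$, $n\cdot\infty=\infty$. $BS(1,n)=\langle a,b\mid aba^{-1}=b^n\rangle$; in the action $\langle f,h\rangle$, $b$ acts by $f$ and $a$ by $h$. A circle $\mathcal C_i'$ is $\varepsilon$-close to $\mathcal C_i$ ($\mathcal C_1=\{\infty\}\times S^1$, $\mathcal C_2=\{0\}\times S^1$) if it is the image of an embedding $S^1\to\mathbb T^2$ uniformly $\varepsilon$-close to $\theta\mapsto(\infty,\theta)$, resp. $\theta\mapsto(0,\theta)$. $\omega_h(x)$ and $\alpha_h(x)$ are the sets of accumulation points of $h^j(x)$ as $j\to+\infty$ and $j\to-\infty$ respectively. A minimal set of an action of a group $G$ on a compact metric space $X$ is a non-empty closed $G$-invariant subset $M\subset X$ such that any closed $G$-invariant $K\subset M$ satisfies $K=M$ or $K=\emptyset$. *)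

theory Defs
  imports
    "HOL-Analysis.Analysis"
    "HOL-Algebra.Generated_Groups"
    "HOL-Algebra.Bij"
    "HOL-Algebra.Group_Action"
begin

section \<open>The torus\<close>

datatype rpline = Fin real | Infty

quotient_type circle = real / "\<lambda>x y :: real. x - y \<in> \<int>"
proof (rule equivpI)
  show "reflp (\<lambda>x y :: real. x - y \<in> \<int>)"
    by (simp add: reflp_def)
  show "symp (\<lambda>x y :: real. x - y \<in> \<int>)"
    by (metis (no_types, lifting) Ints_minus minus_diff_eq sympI)
  show "transp (\<lambda>x y :: real. x - y \<in> \<int>)"
    by (rule transpI) (metis Ints_add diff_add_cancel add_diff_eq)
qed

text \<open>
  Both factors are metrized as subsets of the unit circle of the complex plane. On the projective
  line we use the Cayley map, which is stereographic projection, so that the induced topology is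
  that of the one-point compactification of the real line. On the circle the induced topology is
  the quotient topology of \<open>\<real>/\<int>\<close>. All spaces are compact, so every statement below of the form
  ``for all \<open>\<epsilon>\<close>, uniformly \<open>\<epsilon>\<close>-close'' is independent of the choice of a compatible metric.
\<close>

primrec cayley :: "rpline \<Rightarrow> complex" where
  "cayley (Fin x) = (1 + \<i> * of_real x) / (1 - \<i> * of_real x)"
| "cayley Infty = -1"

lift_definition circle_embed :: "circle \<Rightarrow> complex" is "\<lambda>t. cis (2 * pi * t)"
proof -
  fix x y :: real assume "x - y \<in> \<int>"
  then have "cis (2 * pi * (x - y)) = 1" by (rule cis_multiple_2pi)
  then show "cis (2 * pi * x) = cis (2 * pi * y)"
    by (simp add: right_diff_distrib flip: cis_divide)
qed

lemma inj_cayley: "inj cayley"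
proof (rule injI)
  have nonzero: "1 - \<i> * complex_of_real x \<noteq> 0" for x
    by (simp add: complex_eq_iff)
  have Fin_eq: "cayley (Fin x) = w \<longleftrightarrow> 1 + \<i> * of_real x = w * (1 - \<i> * of_real x)" for x w
    using nonzero by (simp add: divide_eq_eq)
  have Fin_Fin: "x = y" if "cayley (Fin x) = cayley (Fin y)" for x y
  proof -
    have "(1 + \<i> * of_real x) * (1 - \<i> * of_real y) = (1 + \<i> * of_real y) * (1 - \<i> * of_real x)"
      using that nonzero by (simp add: frac_eq_eq)
    then show ?thesis by (simp add: complex_eq_iff)
  qed
  have Fin_Infty: "cayley (Fin x) \<noteq> cayley Infty" for x
    unfolding Fin_eq by (simp add: complex_eq_iff)
  fix p q assume "cayley p = cayley q"
  then show "p = q"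
    using Fin_Fin Fin_Infty by (cases p; cases q) metis+
qed

lemma inj_circle_embed: "inj circle_embed"
proof (rule injI, transfer)
  fix x y :: real assume "cis (2 * pi * x) = cis (2 * pi * y)"
  then have "cis (2 * pi * x) / cis (2 * pi * y) = 1" by simp
  then have "cis (2 * pi * (x - y)) = 1" by (simp add: cis_divide right_diff_distrib)
  then have "cos (2 * pi * (x - y)) = 1" by (simp add: complex_eq_iff)
  then obtain k :: int where "2 * pi * (x - y) = of_int k * 2 * pi"
    using cos_one_2pi_int by blast
  then have "x - y = of_int k" by simp
  then show "x - y \<in> \<int>" by simp
qed

instantiation rpline :: metric_space
begin

definition dist_rpline :: "rpline \<Rightarrow> rpline \<Rightarrow> real" where
  "dist_rpline p q = dist (cayley p) (cayley q)"

definition uniformity_rpline :: "(rpline \<times> rpline) filter" where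
  "uniformity_rpline = (INF e\<in>{0 <..}. principal {(p, q). dist p q < e})"

definition open_rpline :: "rpline set \<Rightarrow> bool" where
  "open_rpline U = (\<forall>p\<in>U. eventually (\<lambda>(p', q). p' = p \<longrightarrow> q \<in> U) uniformity)"

instance
  by standard
    (auto simp: dist_rpline_def uniformity_rpline_def open_rpline_def inj_eq[OF inj_cayley]
      dist_triangle2)

end

instantiation circle :: metric_space
begin

definition dist_circle :: "circle \<Rightarrow> circle \<Rightarrow> real" where
  "dist_circle p q = dist (circle_embed p) (circle_embed q)"

definition uniformity_circle :: "(circle \<times> circle) filter" where
  "uniformity_circle = (INF e\<in>{0 <..}. principal {(p, q). dist p q < e})"

definition open_circle :: "circle set \<Rightarrow> bool" where
  "open_circle U = (\<forall>p\<in>U. eventually (\<lambda>(p', q). p' = p \<longrightarrow> q \<in> U) uniformity)"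

instance
  by standard
    (auto simp: dist_circle_def uniformity_circle_def open_circle_def inj_eq[OF inj_circle_embed]
      dist_triangle2)

end

type_synonym torus = "rpline \<times> circle"


section \<open>The \<open>C\<^sup>1\<close> topology on the group of \<open>C\<^sup>1\<close> diffeomorphisms\<close>

text \<open>
  The angular coordinate \<open>x = tan (\<pi> u)\<close> presents the projective line, with its usual smooth
  structure given by the charts \<open>x\<close> and \<open>1/x\<close>, as the quotient of the real line by \<open>\<int>\<close>: both
  \<open>tan (\<pi> u)\<close> and \<open>cot (\<pi> u)\<close> are local diffeomorphisms where they are defined. Hence the
  following map is the smooth universal covering of the torus, with deck group \<open>\<int>\<^sup>2\<close>.
\<close>

definition rp_cover :: "real \<Rightarrow> rpline" where
  "rp_cover u = (if cos (pi * u) = 0 then Infty else Fin (tan (pi * u)))"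

definition torus_cover :: "real \<times> real \<Rightarrow> torus" where
  "torus_cover = map_prod rp_cover abs_circle"

lemma cayley_rp_cover: "cayley (rp_cover u) = cis (2 * pi * u)"
proof (cases "cos (pi * u) = 0")
  case True
  have "cos (2 * (pi * u)) = -1" using True by (simp add: cos_double_cos)
  moreover have "sin (2 * (pi * u)) = 0" using True by (simp add: sin_double)
  ultimately show ?thesis using True by (simp add: rp_cover_def complex_eq_iff mult.assoc)
next
  case False
  define a where "a = pi * u"
  have c: "cos a \<noteq> 0" using False by (simp add: a_def)
  have "(1 + \<i> * of_real (tan a)) * of_real (cos a) = cis a"
    and "(1 - \<i> * of_real (tan a)) * of_real (cos a) = cis (- a)"
    using c by (simp_all add: complex_eq_iff tan_def)
  then have "(1 + \<i> * of_real (tan a)) / (1 - \<i> * of_real (tan a)) = cis a / cis (- a)"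
    using c by (metis nonzero_mult_divide_mult_cancel_right of_real_eq_0_iff)
  also have "\<dots> = cis (2 * a)" by (simp add: cis_divide)
  finally show ?thesis using False by (simp add: rp_cover_def a_def mult.assoc)
qed

text \<open>
  \<open>F\<close> is a lift of \<open>f\<close> to the universal cover that is \<open>C\<^sup>1\<close> with derivative \<open>F'\<close>. In the
  trivialization of the tangent bundle of the torus given by the covering, \<open>F' z\<close> is the
  derivative of \<open>f\<close> at \<open>torus_cover z\<close>; it does not depend on the choice of the lift.
\<close>

definition C1_lift ::
    "(torus \<Rightarrow> torus) \<Rightarrow> (real \<times> real \<Rightarrow> real \<times> real) \<Rightarrow>
     (real \<times> real \<Rightarrow> (real \<times> real) \<Rightarrow>\<^sub>L (real \<times> real)) \<Rightarrow> bool" where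
  "C1_lift f F F' \<longleftrightarrow>
     (\<forall>z. f (torus_cover z) = torus_cover (F z)) \<and>
     (\<forall>z. (F has_derivative blinfun_apply (F' z)) (at z)) \<and>
     continuous_on UNIV F'"

definition C1_map :: "(torus \<Rightarrow> torus) \<Rightarrow> bool" where
  "C1_map f \<longleftrightarrow> (\<exists>F F'. C1_lift f F F')"

definition Diff1 :: "(torus \<Rightarrow> torus) set" where
  "Diff1 = {f. bij f \<and> C1_map f \<and> C1_map (inv_into UNIV f)}"

definition C1_close :: "real \<Rightarrow> (torus \<Rightarrow> torus) \<Rightarrow> (torus \<Rightarrow> torus) \<Rightarrow> bool" where
  "C1_close \<delta> f g \<longleftrightarrow>
     (\<exists>F F' G G'. C1_lift f F F' \<and> C1_lift g G G' \<and>
        (\<forall>z. dist (F z) (G z) < \<delta> \<and> dist (F' z) (G' z) < \<delta>))"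

definition C1_topology :: "(torus \<Rightarrow> torus) topology" where
  "C1_topology =
     topology (\<lambda>U. U \<subseteq> Diff1 \<and> (\<forall>f\<in>U. \<exists>\<delta>>0. \<forall>g\<in>Diff1. C1_close \<delta> f g \<longrightarrow> g \<in> U))"

lemma C1_close_mono: "C1_close \<delta> f g \<Longrightarrow> \<delta> \<le> \<delta>' \<Longrightarrow> C1_close \<delta>' f g"
  unfolding C1_close_def by (meson order_less_le_trans)

lemma openin_C1_topology:
  "openin C1_topology U \<longleftrightarrow>
     U \<subseteq> Diff1 \<and> (\<forall>f\<in>U. \<exists>\<delta>>0. \<forall>g\<in>Diff1. C1_close \<delta> f g \<longrightarrow> g \<in> U)"
proof -
  let ?P = "\<lambda>U. U \<subseteq> Diff1 \<and> (\<forall>f\<in>U. \<exists>\<delta>>0. \<forall>g\<in>Diff1. C1_close \<delta> f g \<longrightarrow> g \<in> U)"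
  have "istopology ?P"
    unfolding istopology_def
  proof (intro conjI allI impI)
    fix S T assume S: "?P S" and T: "?P T"
    show "S \<inter> T \<subseteq> Diff1" using S by blast
    show "\<forall>f\<in>S \<inter> T. \<exists>\<delta>>0. \<forall>g\<in>Diff1. C1_close \<delta> f g \<longrightarrow> g \<in> S \<inter> T"
    proof
      fix f assume "f \<in> S \<inter> T"
      then obtain d e where "d > 0" "\<forall>g\<in>Diff1. C1_close d f g \<longrightarrow> g \<in> S"
        and "e > 0" "\<forall>g\<in>Diff1. C1_close e f g \<longrightarrow> g \<in> T"
        using S T by blast
      then show "\<exists>\<delta>>0. \<forall>g\<in>Diff1. C1_close \<delta> f g \<longrightarrow> g \<in> S \<inter> T"
        by (intro exI[of _ "min d e"]) (auto dest: C1_close_mono[OF _ min.cobounded1] C1_close_mono[OF _ min.cobounded2])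
    qed
  next
    fix K assume K: "\<forall>S\<in>K. ?P S"
    show "\<Union> K \<subseteq> Diff1" using K by blast
    show "\<forall>f\<in>\<Union> K. \<exists>\<delta>>0. \<forall>g\<in>Diff1. C1_close \<delta> f g \<longrightarrow> g \<in> \<Union> K"
      using K by (meson UnionE UnionI)
  qed
  then show ?thesis unfolding C1_topology_def by (simp add: topology_inverse')
qed


section \<open>The standard action\<close>

primrec rp_affine :: "real \<Rightarrow> real \<Rightarrow> rpline \<Rightarrow> rpline" where
  "rp_affine a b (Fin x) = Fin (a * x + b)"
| "rp_affine a b Infty = Infty"

lift_definition circle_rotate :: "real \<Rightarrow> circle \<Rightarrow> circle" is "\<lambda>t x. x + t"
  by simp

definition f0 :: "torus \<Rightarrow> torus" where
  "f0 = map_prod (rp_affine 1 1) id"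

definition h0 :: "nat \<Rightarrow> torus \<Rightarrow> torus" where
  "h0 n = map_prod (rp_affine (real n) 0) (circle_rotate (ln (real n)))"


section \<open>Dynamics\<close>

definition close_circle :: "real \<Rightarrow> rpline \<Rightarrow> torus set \<Rightarrow> bool" where
  "close_circle \<epsilon> p C \<longleftrightarrow>
     (\<exists>\<gamma>. embedding_map euclidean euclidean \<gamma> \<and> range \<gamma> = C \<and>
        (\<forall>\<theta>::circle. dist (\<gamma> \<theta>) (p, \<theta>) < \<epsilon>))"

definition omega_limit :: "('a::topological_space \<Rightarrow> 'a) \<Rightarrow> 'a \<Rightarrow> 'a set" where
  "omega_limit h x =
     {y. \<exists>r::nat \<Rightarrow> nat. strict_mono r \<and> (\<lambda>k. (h ^^ r k) x) \<longlonglongrightarrow> y}"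

definition alpha_limit :: "('a::topological_space \<Rightarrow> 'a) \<Rightarrow> 'a \<Rightarrow> 'a set" where
  "alpha_limit h x = omega_limit (inv_into UNIV h) x"

definition fix_set :: "('a \<Rightarrow> 'a) \<Rightarrow> 'a set" where
  "fix_set f = {x. f x = x}"

definition action_group :: "('a \<Rightarrow> 'a) \<Rightarrow> ('a \<Rightarrow> 'a) \<Rightarrow> ('a \<Rightarrow> 'a) monoid" where
  "action_group f h = subgroup_generated (BijGroup UNIV) {f, h}"

definition invariant_set :: "('g, 'm) monoid_scheme \<Rightarrow> ('g \<Rightarrow> 'a \<Rightarrow> 'a) \<Rightarrow> 'a set \<Rightarrow> bool" where
  "invariant_set G \<phi> K \<longleftrightarrow> (\<forall>g\<in>carrier G. \<phi> g ` K = K)"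

definition minimal_set ::
    "('g, 'm) monoid_scheme \<Rightarrow> ('g \<Rightarrow> 'a \<Rightarrow> 'a::topological_space) \<Rightarrow> 'a set \<Rightarrow> bool" where
  "minimal_set G \<phi> M \<longleftrightarrow>
     M \<noteq> {} \<and> closed M \<and> invariant_set G \<phi> M \<and>
     (\<forall>K. K \<subseteq> M \<and> closed K \<and> invariant_set G \<phi> K \<longrightarrow> K = M \<or> K = {})"

definition cantor_set :: "'a::topological_space set \<Rightarrow> bool" where
  "cantor_set M \<longleftrightarrow>
     top_of_set M homeomorphic_space
       product_topology (\<lambda>_::nat. discrete_topology (UNIV :: bool set)) UNIV"

end

theory Submission
  imports Defs
begin

text \<open>
  In the angular coordinates \<open>(u, t)\<close> of the universal covering, with \<open>x = tan (\<pi> u)\<close>, the map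
  \<open>h0\<close> is \<open>(u, t) \<mapsto> (\<eta> u, t + ln n)\<close>, where \<open>\<eta>\<close> fixes \<open>1/2\<close> with derivative \<open>1/n\<close> and \<open>0\<close> with
  derivative \<open>n\<close>. A \<open>C\<^sup>1\<close>-small perturbation has a lift that differs from this model by a map which
  is uniformly small and has a small Lipschitz constant (\<open>C1_close_model\<close>); the rest of the proof works
  with these two bounds.

  \<^emph>\<open>The circles.\<close> In a thin band around \<open>u = 1/2\<close> the perturbation \<open>h\<close> contracts horizontal
  differences, and differences that are more horizontal than vertical were so one step earlier.
  Hence two points on one level \<open>t\<close> whose whole backward orbits stay in the band are equal, and the
  points with such orbits form the graph \<open>u = profile t\<close> of a continuous function, which is the
  attracting circle. The repelling circle is the attracting circle of the inverse. Off the two bands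
  the function \<open>cos (2 \<pi> u)\<close> drops by a fixed amount along orbits, so that every other orbit travels
  from one band to the other. All this takes place in the locale \<open>north_south\<close>, whose hypotheses are
  verified in \<open>perturbed_north_south\<close>.

  \<^emph>\<open>Fixed points.\<close> Near the attracting circle \<open>f\<close> is \<open>C\<^sup>1\<close>-close to the identity, so its displacement
  \<open>X z = F z - z\<close> hardly varies along \<open>n\<close> steps and the displacement of \<open>F\<^sup>n\<close> is nearly \<open>n X\<close>
  (\<open>displacement_funpow\<close>). The relation \<open>h f = f\<^sup>n h\<close> then says that \<open>h\<close> carries \<open>X z\<close> to about
  \<open>n X (h z)\<close>. Since \<open>h\<close> hardly expands distances in the band, \<open>X\<close> decays geometrically along forward
  orbits (\<open>displacement_contracts\<close>), and all their limit points are fixed by \<open>f\<close>; so there are fixed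
  points. Conversely the fixed point set is invariant under the inverse of \<open>h\<close>, so a fixed point off
  the attracting circle would yield, in its \<open>\<alpha>\<close>-limit set, a fixed point on the repelling circle. But
  \<open>f\<close> pushes that circle off itself.

  \<^emph>\<open>Minimal sets.\<close> By the same argument each minimal set of the action meets, hence lies in, the fixed
  point set of \<open>f\<close>; it is a minimal set of \<open>h\<close> on the attracting circle. A periodic point of \<open>h\<close> there
  lies in its own \<open>\<omega>\<close>-limit set, so it is fixed by \<open>f\<close> and has a finite orbit. If there is none, \<open>h\<close>
  acts on the circle without periodic points. Then the arc between two points of one orbit meets
  every non-empty invariant set, so that the \<open>\<omega>\<close>-limit set of any point lies in every non-empty closed
  invariant set (\<open>circle_lift.omega_least\<close>); it is the only minimal set. It is perfect, and its interior is
  invariant, so it is the circle or has empty interior; in the latter case it is a Cantor set by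
  \<open>nowhere_dense_perfect.homeomorphic_Cantor_space\<close>.
\<close>

section \<open>Circle homeomorphisms without periodic points\<close>

lemma continuous_on_funpow:
  fixes f :: "'a::topological_space \<Rightarrow> 'a"
  assumes "continuous_on UNIV f" shows "continuous_on UNIV (f ^^ j)"
proof (induction j)
  case 0 show ?case by (simp add: id_def)
next
  case (Suc j)
  show ?case
    using continuous_on_compose[OF Suc continuous_on_subset[OF assms subset_UNIV]] by simp
qed

text \<open>
  The forward orbit of \<open>x\<close> increases to infinity, since a finite limit would be a fixed point. A point
  of \<open>E\<close> to the right of \<open>x\<close> therefore lies between two consecutive iterates, and is pulled back.
\<close>
lemma orbit_reaches_fundamental_interval:
  fixes T S :: "real \<Rightarrow> real"
  assumes cont: "continuous_on UNIV T" and mono: "strict_mono T"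
    and inv: "\<And>x. S (T x) = x" "\<And>x. T (S x) = x"
    and nofix: "\<And>x. T x \<noteq> x" and up: "T x > x"
    and E: "E \<noteq> {}" "\<And>y. y \<in> E \<Longrightarrow> S y \<in> E" "\<And>y. y \<in> E \<Longrightarrow> y + 1 \<in> E"
  shows "\<exists>y\<in>E. x \<le> y \<and> y \<le> T x"
proof -
  obtain y0 where y0: "y0 \<in> E" using E(1) by blast
  have "y0 + real k \<in> E" for k
  proof (induction k)
    case (Suc k) then show ?case using E(3)[of "y0 + real k"] by (simp add: ac_simps)
  qed (use y0 in simp)
  moreover obtain k :: nat where "real k \<ge> x - y0" using real_arch_simple by blast
  ultimately obtain y where y: "y \<in> E" "y \<ge> x" by (metis diff_le_eq add.commute)
  have incr: "incseq (\<lambda>j. (T ^^ j) x)"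
  proof (rule incseq_SucI)
    fix j show "(T ^^ j) x \<le> (T ^^ Suc j) x"
      by (induction j) (use up mono in \<open>auto simp: strict_mono_less_eq\<close>)
  qed
  have "\<exists>j. y < (T ^^ j) x"
  proof (rule ccontr)
    assume "\<not> ?thesis"
    then have "\<And>j. (T ^^ j) x \<le> y" by (simp add: not_less)
    then obtain L where L: "(\<lambda>j. (T ^^ j) x) \<longlonglongrightarrow> L"
      using incseq_convergent[OF incr] by blast
    have "(\<lambda>j. T ((T ^^ j) x)) \<longlonglongrightarrow> T L"
      by (rule continuous_on_tendsto_compose[OF cont L]) auto
    moreover have "(\<lambda>j. (T ^^ Suc j) x) \<longlonglongrightarrow> L" using L by (rule LIMSEQ_Suc)
    ultimately show False using nofix LIMSEQ_unique by fastforce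
  qed
  define j where "j = (LEAST j. y < (T ^^ j) x)"
  have j: "y < (T ^^ j) x" unfolding j_def by (rule LeastI_ex) fact
  have "j \<noteq> 0" using j y by (cases j) auto
  then obtain i where i: "j = Suc i" by (cases j) auto
  have "\<not> y < (T ^^ i) x" using i not_less_Least[of i "\<lambda>j. y < (T ^^ j) x"] j_def by simp
  have S_E: "(S ^^ m) y \<in> E" for m by (induction m) (use y E in auto)
  have T_S: "(T ^^ m) ((S ^^ m) w) = w" for m w
    by (induction m arbitrary: w) (simp_all add: funpow_swap1[of S] inv)
  have monoi: "strict_mono (T ^^ i)" 
    by (induction i) (use mono in \<open>auto simp: strict_mono_def\<close>)
  let ?w = "(S ^^ i) y"
  have "(T ^^ i) x \<le> (T ^^ i) ?w" using \<open>\<not> y < _\<close> T_S by simp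
  then have "x \<le> ?w" using monoi by (simp add: strict_mono_less_eq)
  moreover have "(T ^^ i) ?w < (T ^^ i) (T x)" using j T_S i by (simp add: funpow_swap1)
  then have "?w < T x" using monoi by (simp add: strict_mono_less)
  ultimately show ?thesis using S_E by force
qed

text \<open>
  A circle homeomorphism is represented by a lift \<open>g\<close> to the line and the inverse \<open>k\<close> of the lift;
  subsets of the circle become subsets of the line that are invariant under integer translations.
\<close>
locale circle_lift =
  fixes g k :: "real \<Rightarrow> real"
  assumes cont_g: "continuous_on UNIV g" and cont_k: "continuous_on UNIV k"
    and gk [simp]: "g (k t) = t" and kg [simp]: "k (g t) = t"
    and g_1: "g (t + 1) = g t + 1"
    and no_periodic: "0 < q \<Longrightarrow> (g ^^ q) t \<noteq> t + of_int p"
begin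

definition invariant :: "real set \<Rightarrow> bool" where
  "invariant E \<longleftrightarrow> (\<forall>t. g t \<in> E \<longleftrightarrow> t \<in> E) \<and> (\<forall>t. t + 1 \<in> E \<longleftrightarrow> t \<in> E)"

definition omega :: "real \<Rightarrow> real set" where
  "omega t = {s. \<forall>e>0. \<forall>N. \<exists>j\<ge>N. \<exists>p::int. dist ((g ^^ j) t + of_int p) s < e}"

lemma g_nat: "g (t + of_nat p) = g t + of_nat p"
  by (induction p) (simp_all add: g_1 add.assoc[symmetric] add.commute[of 1])

lemma g_int: "g (t + of_int p) = g t + of_int p"
proof (cases p)
  case (nonneg n) then show ?thesis by (simp add: g_nat)
next
  case (neg n)
  then have "t + of_int p + of_nat (Suc n) = t" by simp
  from g_nat[of "t + of_int p" "Suc n", unfolded this] show ?thesis using neg by simp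
qed

lemma k_int: "k (t + of_int p) = k t + of_int p"
  by (metis gk kg g_int)

text \<open>An injective continuous function is monotone; since \<open>g\<close> commutes with integer translations it
  cannot be decreasing.\<close>
lemma strict_mono_g: "strict_mono g"
proof (rule strict_monoI)
  fix x y :: real assume xy: "x < y"
  obtain N :: nat where N: "real N > y - x" using reals_Archimedean2 by blast
  have "inj_on g {x..x + N}" by (metis inj_onI kg)
  then have "(g x < g y \<and> g y < g (x + N)) \<or> (g (x + N) < g y \<and> g y < g x)"
    using continuous_inj_imp_mono[of x y "x + N" g] xy N cont_g continuous_on_subset by force
  then show "g x < g y" using g_nat[of x N] by auto
qed

lemma funpow_g_int: "(g ^^ j) (t + of_int p) = (g ^^ j) t + of_int p"
  by (induction j arbitrary: t) (simp_all add: g_int funpow_swap1)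

lemma funpow_gk: "(g ^^ j) ((k ^^ j) t) = t"
  by (induction j arbitrary: t) (simp_all add: funpow_swap1[of k])

lemma funpow_kg: "(k ^^ j) ((g ^^ j) t) = t"
  by (induction j arbitrary: t) (simp_all add: funpow_swap1[of g])

lemma invariant_int:
  assumes "invariant E" shows "t + of_int p \<in> E \<longleftrightarrow> t \<in> E"
proof -
  have nat: "t + of_nat m \<in> E \<longleftrightarrow> t \<in> E" for t m
    using assms by (induction m) (simp_all add: invariant_def add.assoc[symmetric] add.commute[of 1])
  show ?thesis
  proof (cases p)
    case (nonneg m) then show ?thesis using nat by simp
  next
    case (neg m)
    then have "t + of_int p + of_nat (Suc m) = t" by simp
    from nat[of "t + of_int p" "Suc m", unfolded this] show ?thesis by blast
  qed
qed

text \<open>The map \<open>t \<mapsto> g\<^sup>q t + p\<close> or its inverse moves every point to the right, and the interval between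
  a point and its image is a fundamental domain for it.\<close>
lemma invariant_meets_interval:
  assumes E: "invariant E" "E \<noteq> {}" and q: "0 < q"
  shows "\<exists>y\<in>E. y \<in> closed_segment x ((g ^^ q) x + of_int p)"
proof -
  let ?T = "\<lambda>t. (g ^^ q) t + of_int p" and ?S = "\<lambda>t. (k ^^ q) (t - of_int p)"
  have contT: "continuous_on UNIV ?T"
    by (intro continuous_intros continuous_on_funpow cont_g)
  have contS: "continuous_on UNIV ?S"
    by (intro continuous_on_compose2[OF continuous_on_funpow[OF cont_k]] continuous_intros) auto
  have monoq: "strict_mono (g ^^ q)"
    by (induction q) (use strict_mono_g in \<open>auto simp: strict_mono_def\<close>)
  then have monoT: "strict_mono ?T" by (simp add: strict_mono_def)
  have ST: "?S (?T t) = t" and TS: "?T (?S t) = t" for t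
    by (simp_all add: funpow_kg funpow_gk)
  have monoS: "strict_mono ?S"
  proof (rule strict_monoI)
    fix x y :: real assume "x < y"
    then have "?T (?S x) < ?T (?S y)" by (simp only: TS)
    then show "?S x < ?S y" using strict_mono_less[OF monoT] by blast
  qed
  have nofix: "?T t \<noteq> t" for t
    using no_periodic[OF q, of t "- p"] by auto
  then have nofixS: "?S t \<noteq> t" for t using TS[of t] by metis
  have g_E: "(g ^^ j) t \<in> E \<longleftrightarrow> t \<in> E" for j t
    using E(1) by (induction j) (simp_all add: invariant_def)
  have T_E: "?T t \<in> E" and S_E: "?S t \<in> E" if "t \<in> E" for t
    using that g_E[of q t] g_E[of q "?S t"] invariant_int[OF E(1)] TS[of t] by metis+
  have E1: "t + 1 \<in> E" if "t \<in> E" for t using that E(1) by (simp add: invariant_def)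
  consider "?T x > x" | "?T x < x" using nofix[of x] by linarith
  then show ?thesis
  proof cases
    case 1
    then have "\<exists>y\<in>E. x \<le> y \<and> y \<le> ?T x"
      by (intro orbit_reaches_fundamental_interval[of ?T ?S] contT monoT ST TS nofix E(2) S_E E1)
    then show ?thesis using 1 by (auto simp: closed_segment_eq_real_ivl)
  next
    case 2
    then have "?S (?T x) > ?T x" by (simp only: ST)
    then have "\<exists>y\<in>E. ?T x \<le> y \<and> y \<le> ?S (?T x)"
      by (intro orbit_reaches_fundamental_interval[of ?S ?T] contS monoS ST TS nofixS E(2) T_E E1)
    then have "\<exists>y\<in>E. ?T x \<le> y \<and> y \<le> x" by (simp only: ST)
    then show ?thesis using 2 by (auto simp: closed_segment_eq_real_ivl)
  qed
qed

text \<open>Near a limit point \<open>s\<close> of one orbit there are two points of that orbit. The interval between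
  them meets \<open>E\<close>, so \<open>E\<close> comes arbitrarily close to \<open>s\<close>.\<close>
lemma omega_least:
  assumes E: "closed E" "invariant E" "E \<noteq> {}"
  shows "omega t \<subseteq> E"
proof
  fix s assume s: "s \<in> omega t"
  have "\<exists>y\<in>E. dist y s < e" if "e > 0" for e
  proof -
    obtain j p where j: "dist ((g ^^ j) t + of_int p) s < e"
      using s \<open>e > 0\<close> unfolding omega_def by blast
    obtain j' p' where j': "j' \<ge> Suc j" "dist ((g ^^ j') t + of_int p') s < e"
      using s \<open>e > 0\<close> unfolding omega_def by blast
    define x where "x = (g ^^ j) t + of_int p"
    have "(g ^^ j') t = (g ^^ (j' - j)) ((g ^^ j) t)"
      using j'(1) by (metis Suc_leD comp_apply funpow_add le_add_diff_inverse2)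
    then have x': "(g ^^ j') t + of_int p' = (g ^^ (j' - j)) x + of_int (p' - p)"
      by (simp add: x_def funpow_g_int)
    obtain y where y: "y \<in> E" "y \<in> closed_segment x ((g ^^ (j' - j)) x + of_int (p' - p))"
      using invariant_meets_interval[OF E(2,3), of "j' - j" x "p' - p"] j'(1) by auto
    moreover have "closed_segment x ((g ^^ (j' - j)) x + of_int (p' - p)) \<subseteq> ball s e"
      by (rule closed_segment_subset) (use j j' x' in \<open>auto simp: x_def dist_commute\<close>)
    ultimately have "y \<in> ball s e" by blast
    then show ?thesis using y(1) by (auto simp: dist_commute)
  qed
  then show "s \<in> E" using E(1) closed_approachable by blast
qed

lemma closed_omega: "closed (omega t)"
proof -
  have "s \<in> omega t" if *: "\<And>e. e > 0 \<Longrightarrow> \<exists>y\<in>omega t. dist y s < e" for s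
    unfolding omega_def
  proof (intro CollectI allI impI)
    fix e :: real and N :: nat assume "e > 0"
    then obtain y where y: "y \<in> omega t" "dist y s < e/2" using *[of "e/2"] by auto
    have "e/2 > 0" using \<open>e > 0\<close> by simp
    then obtain j p where "j \<ge> N" "dist ((g ^^ j) t + of_int p) y < e/2"
      using y(1)[unfolded omega_def mem_Collect_eq, rule_format, of "e/2" N] by blast
    then have "dist ((g ^^ j) t + of_int p) s < e"
      using y(2) dist_triangle_half_l[of "(g ^^ j) t + of_int p" y e s] by (metis dist_commute)
    then show "\<exists>j\<ge>N. \<exists>p::int. dist ((g ^^ j) t + of_int p) s < e"
      using \<open>j \<ge> N\<close> by blast
  qed
  then have "closure (omega t) \<subseteq> omega t" by (simp add: subset_iff closure_approachable)
  then show ?thesis by (simp add: closure_subset_eq)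
qed

text \<open>One form for the invariance under \<open>g\<close>, under its inverse and under translations: each of these
  maps shifts the time along the orbit by a bounded amount. The time \<open>Suc j\<close> leaves room for the
  step of the inverse.\<close>
lemma omega_image:
  assumes F: "continuous_on UNIV F"
    and shift: "\<And>j p. \<exists>p'::int. F ((g ^^ (Suc j)) t + of_int p) = (g ^^ (j + i)) t + of_int p'"
    and s: "s \<in> omega t"
  shows "F s \<in> omega t"
  unfolding omega_def
proof (intro CollectI allI impI)
  fix e :: real and N :: nat assume "e > 0"
  then obtain d where d: "d > 0" "\<And>x. dist x s < d \<Longrightarrow> dist (F x) (F s) < e"
    using F unfolding continuous_on_iff by (metis UNIV_I)
  obtain j p where j: "j \<ge> Suc N" "dist ((g ^^ j) t + of_int p) s < d"
    using s d(1) unfolding omega_def by blast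
  then obtain j0 where j0: "j = Suc j0" by (cases j) auto
  obtain p' where "F ((g ^^ j) t + of_int p) = (g ^^ (j0 + i)) t + of_int p'"
    using shift j0 by blast
  then have "dist ((g ^^ (j0 + i)) t + of_int p') (F s) < e" using d(2)[OF j(2)] by simp
  moreover have "j0 + i \<ge> N" using j(1) j0 by simp
  ultimately show "\<exists>j\<ge>N. \<exists>p::int. dist ((g ^^ j) t + of_int p) (F s) < e" by blast
qed

lemma invariant_omega: "invariant (omega t)"
proof -
  have 1: "g s \<in> omega t" if "s \<in> omega t" for s
    by (rule omega_image[OF cont_g _ that, where i=2]) (auto simp: g_int)
  have 2: "k s \<in> omega t" if "s \<in> omega t" for s
    by (rule omega_image[OF cont_k _ that, where i=0]) (auto simp: k_int)
  have 3: "s + of_int q \<in> omega t" if "s \<in> omega t" for s q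
  proof (rule omega_image[OF _ _ that, where i=1])
    show "\<exists>p'. (g ^^ Suc j) t + of_int p + of_int q = (g ^^ (j + 1)) t + of_int p'" for j p
      by (intro exI[of _ "p + q"]) simp
  qed (intro continuous_intros)
  have 4: "s \<in> omega t" if "g s \<in> omega t" for s using 2[OF that] by simp
  have 5: "s \<in> omega t" if "s + 1 \<in> omega t" for s using 3[OF that, of "-1"] by simp
  have 6: "s + 1 \<in> omega t" if "s \<in> omega t" for s using 3[OF that, of 1] by simp
  show ?thesis unfolding invariant_def by (intro conjI allI iffI) (fact 1 4 5 6)+
qed

lemma omega_nonempty: "omega t \<noteq> {}"
proof -
  let ?x = "\<lambda>j. frac ((g ^^ j) t)"
  have "\<forall>j. ?x j \<in> {0..1}" by (simp add: frac_lt_1 less_imp_le)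
  then obtain s r where r: "strict_mono r" "(?x \<circ> r) \<longlonglongrightarrow> s"
    using compact_Icc[of 0 "1::real"] unfolding compact_def by metis
  have "s \<in> omega t" unfolding omega_def
  proof (intro CollectI allI impI)
    fix e :: real and N :: nat assume "e > 0"
    then obtain M where "\<And>m. m \<ge> M \<Longrightarrow> dist (?x (r m)) s < e"
      using r(2) unfolding lim_sequentially o_def by blast
    then have "dist (?x (r (max M N))) s < e" by simp
    moreover have "r (max M N) \<ge> N" using seq_suble[OF r(1)] by (meson max.cobounded2 le_trans)
    ultimately show "\<exists>j\<ge>N. \<exists>p::int. dist ((g ^^ j) t + of_int p) s < e"
      by (metis frac_def diff_conv_add_uminus of_int_minus)
  qed
  then show ?thesis by blast
qed

text \<open>By minimality \<open>s\<close> is a limit point of its own orbit, which lies in the limit set and never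
  returns to \<open>s\<close>.\<close>
lemma omega_perfect:
  assumes s: "s \<in> omega t" and "e > 0"
  shows "\<exists>y\<in>omega t. y \<noteq> s \<and> dist y s < e"
proof -
  have "omega t \<subseteq> omega s"
    by (intro omega_least closed_omega invariant_omega omega_nonempty)
  then have "s \<in> omega s" using s by blast
  then have "\<exists>j\<ge>1. \<exists>p::int. dist ((g ^^ j) s + of_int p) s < e"
    using \<open>e > 0\<close> by (simp add: omega_def)
  then obtain j p where j: "j \<ge> 1" "dist ((g ^^ j) s + of_int p) s < e" by blast
  have "(g ^^ j) s \<in> omega t"
    using invariant_omega[of t] s by (induction j) (auto simp: invariant_def)
  then have "(g ^^ j) s + of_int p \<in> omega t" using invariant_int[OF invariant_omega] by blast
  moreover have "(g ^^ j) s + of_int p \<noteq> s" using no_periodic[of j s "-p"] j(1) by auto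
  ultimately show ?thesis using j(2) by blast
qed

text \<open>The complement of the interior is closed and invariant, so it is empty or contains the whole
  limit set.\<close>
lemma omega_dichotomy: "omega t = UNIV \<or> interior (omega t) = {}"
proof (rule disjCI)
  let ?M = "omega t"
  assume int: "interior ?M \<noteq> {}"
  have closed: "closed (- interior ?M)" unfolding closed_def by simp
  have im: "F ` interior ?M \<subseteq> interior ?M"
    if F: "continuous_on UNIV F'" "\<And>x. F (F' x) = x" "\<And>x. F' (F x) = x" "F ` ?M \<subseteq> ?M" for F F'
  proof (rule interior_maximal)
    show "F ` interior ?M \<subseteq> ?M" using F(4) interior_subset by blast
    have "F ` interior ?M = F' -` interior ?M"

      by (auto simp: F(3)) (metis F(2) image_eqI)
    then show "open (F ` interior ?M)" using F(1) by (simp add: open_vimage)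
  qed
  have inv: "g x \<in> ?M \<longleftrightarrow> x \<in> ?M" "x + 1 \<in> ?M \<longleftrightarrow> x \<in> ?M" for x
    using invariant_omega by (simp_all add: invariant_def)
  have inv': "k x \<in> ?M" "x - 1 \<in> ?M" if "x \<in> ?M" for x
    using that inv(1)[of "k x"] inv(2)[of "x - 1"] by simp_all
  have "g ` interior ?M \<subseteq> interior ?M"
    by (rule im[OF cont_k]) (use inv in auto)
  moreover have "k ` interior ?M \<subseteq> interior ?M"
    by (rule im[OF cont_g]) (use inv' in auto)
  ultimately have g_int: "g x \<in> interior ?M \<longleftrightarrow> x \<in> interior ?M" for x
    using kg[of x] by (metis image_subset_iff)
  have "(\<lambda>x. x + 1) ` interior ?M \<subseteq> interior ?M"
    by (rule im[of "\<lambda>x. x - 1"]) (use inv in \<open>auto intro!: continuous_intros\<close>)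
  moreover have "(\<lambda>x. x - 1) ` interior ?M \<subseteq> interior ?M"
    by (rule im[of "\<lambda>x. x + 1"]) (use inv' in \<open>auto intro!: continuous_intros\<close>)
  ultimately have "x + 1 \<in> interior ?M \<longleftrightarrow> x \<in> interior ?M" for x
    by (metis add_diff_cancel_right' image_subset_iff)
  with g_int have "invariant (- interior ?M)" by (simp add: invariant_def)
  then have "- interior ?M = {} \<or> ?M \<subseteq> - interior ?M"
    using omega_least[OF closed] by blast
  then show "?M = UNIV" using int interior_subset by blast
qed

end


section \<open>Nowhere dense perfect compact subsets of the line\<close>

text \<open>
  Such a set is homeomorphic to the Cantor space: it is cut repeatedly into two parts at points of
  its complement, and a point is determined by the sequence of sides on which it lies. If each cut
  is placed in the middle third of the convex hull, the diameters shrink geometrically.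
\<close>
locale nowhere_dense_perfect =
  fixes P :: "real set"
  assumes compact_P: "compact P" and nonempty_P: "P \<noteq> {}"
    and no_interior: "interior P = {}"
    and perfect: "\<And>x e. x \<in> P \<Longrightarrow> e > 0 \<Longrightarrow> \<exists>y\<in>P. y \<noteq> x \<and> dist y x < e"
begin

definition cut :: "real \<Rightarrow> real \<Rightarrow> real" where
  "cut a b = (SOME c. c \<notin> P \<and> a + (b - a) / 3 < c \<and> c < b - (b - a) / 3)"

lemma cut:
  assumes "a < b"
  shows "cut a b \<notin> P" "a + (b - a) / 3 < cut a b" "cut a b < b - (b - a) / 3"
proof -
  have "\<exists>c. c \<notin> P \<and> a + (b - a) / 3 < c \<and> c < b - (b - a) / 3"
  proof (rule ccontr)
    assume "\<not> ?thesis"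
    then have "{a + (b - a) / 3 <..< b - (b - a) / 3} \<subseteq> P" by auto
    then have "{a + (b - a) / 3 <..< b - (b - a) / 3} \<subseteq> interior P"
      by (simp add: interior_maximal)
    then show False using no_interior assms by (auto simp: field_simps)
  qed
  then show "cut a b \<notin> P" "a + (b - a) / 3 < cut a b" "cut a b < b - (b - a) / 3"
    unfolding cut_def by (metis (mono_tags, lifting) someI_ex)+
qed

text \<open>The part of \<open>P\<close> in \<open>{a..b}\<close> is cut in the middle third of its own convex hull, not of
  \<open>{a..b}\<close>; otherwise one of the two sides could be empty.\<close>

definition hull_cut :: "real \<Rightarrow> real \<Rightarrow> real" where
  "hull_cut a b = cut (Inf (P \<inter> {a..b})) (Sup (P \<inter> {a..b}))"

primrec cell :: "(nat \<Rightarrow> bool) \<Rightarrow> nat \<Rightarrow> real \<times> real" where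
  "cell s 0 = (Inf P - 1, Sup P + 1)"
| "cell s (Suc n) = (let (a, b) = cell s n; c = hull_cut a b in if s n then (c, b) else (a, c))"

definition piece :: "(nat \<Rightarrow> bool) \<Rightarrow> nat \<Rightarrow> real set" where
  "piece s n = P \<inter> {fst (cell s n)..snd (cell s n)}"

definition separates :: "real \<Rightarrow> real \<Rightarrow> bool" where
  "separates a b \<longleftrightarrow> a \<notin> P \<and> b \<notin> P \<and> P \<inter> {a..b} \<noteq> {}"

lemma P_bounds: "x \<in> P \<Longrightarrow> Inf P \<le> x" "x \<in> P \<Longrightarrow> x \<le> Sup P"
  using compact_P
  by (simp_all add: cInf_lower cSup_upper compact_imp_bounded bounded_imp_bdd_above bounded_imp_bdd_below)

lemma hull_cut:
  assumes "separates a b"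
  defines "l \<equiv> Inf (P \<inter> {a..b})" and "m \<equiv> Sup (P \<inter> {a..b})" and "c \<equiv> hull_cut a b"
  shows "l \<in> P" "m \<in> P" "a < l" "l < c" "c < m" "m < b" "c \<notin> P"
    "c - l \<le> 2/3 * (m - l)" "m - c \<le> 2/3 * (m - l)" "P \<inter> {a..b} \<subseteq> {l..m}"
proof -
  let ?Q = "P \<inter> {a..b}"
  have Q: "compact ?Q" "?Q \<noteq> {}" using compact_P assms(1) by (auto simp: compact_Int separates_def)
  have bdd: "bdd_above ?Q" "bdd_below ?Q"
    using Q(1) by (simp_all add: compact_imp_bounded bounded_imp_bdd_above bounded_imp_bdd_below)
  have l: "l \<in> ?Q" unfolding l_def
    using Q bdd by (intro closed_contains_Inf) (auto simp: compact_imp_closed)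
  have m: "m \<in> ?Q" unfolding m_def
    using Q bdd by (intro closed_contains_Sup) (auto simp: compact_imp_closed)
  show sub: "?Q \<subseteq> {l..m}" by (auto simp: l_def m_def intro!: cInf_lower cSup_upper bdd)
  have "a \<noteq> l" "b \<noteq> m" using l m assms(1) by (auto simp: separates_def)
  then show "l \<in> P" "m \<in> P" "a < l" "m < b" using l m by auto
  have ab: "a < l" "l < b" using \<open>a \<noteq> l\<close> l assms(1) by (auto simp: separates_def order_less_le)
  obtain y where "y \<in> P" "y \<noteq> l" "dist y l < min (l - a) (b - l)"
    using perfect[of l "min (l - a) (b - l)"] ab l by auto
  then have "y \<in> ?Q" by (auto simp: dist_real_def)
  then have "l < m" using sub \<open>y \<noteq> l\<close> by fastforce
  then have "c \<notin> P" "l + (m - l) / 3 < c" "c < m - (m - l) / 3"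
    using cut[of l m] by (simp_all add: c_def hull_cut_def l_def m_def)
  then show "l < c" "c < m" "c \<notin> P" "c - l \<le> 2/3 * (m - l)" "m - c \<le> 2/3 * (m - l)"
    using \<open>l < m\<close> by (auto simp: field_simps)
qed

lemma cell_separates: "separates (fst (cell s n)) (snd (cell s n))"
proof (induction n)
  case 0
  show ?case using nonempty_P P_bounds by (force simp: separates_def)
next
  case (Suc n)
  let ?a = "fst (cell s n)" and ?b = "snd (cell s n)"
  note h = hull_cut[OF Suc]
  have "Inf (P \<inter> {?a..?b}) \<in> P \<inter> {?a..hull_cut ?a ?b}" "Sup (P \<inter> {?a..?b}) \<in> P \<inter> {hull_cut ?a ?b..?b}"
    using h(1-7) by auto
  then have "P \<inter> {?a..hull_cut ?a ?b} \<noteq> {}" "P \<inter> {hull_cut ?a ?b..?b} \<noteq> {}" by blast+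
  then show ?case using h(7) Suc by (simp add: separates_def Let_def split_beta)
qed

text \<open>The cut lies outside \<open>P\<close>, so both parts are open and closed in the piece; the strict
  inequalities make this visible.\<close>
lemma piece_Suc:
  "piece s (Suc n) = piece s n \<inter>
     (if s n then {hull_cut (fst (cell s n)) (snd (cell s n))<..}
             else {..<hull_cut (fst (cell s n)) (snd (cell s n))})"
proof -
  obtain a b where ab: "cell s n = (a, b)" by fastforce
  let ?c = "hull_cut a b"
  have "a < ?c" "?c < b" "?c \<notin> P" using hull_cut(3-7)[of a b] cell_separates[of s n] ab by auto
  then show ?thesis
    using ab by (auto simp: piece_def Let_def less_le)
qed

lemma compact_piece: "compact (piece s n)"
  unfolding piece_def by (intro compact_Int_closed compact_P) simp

lemma piece_nonempty: "piece s n \<noteq> {}"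
  using cell_separates[of s n] by (simp add: piece_def separates_def)

lemma piece_small: "x \<in> piece s n \<Longrightarrow> y \<in> piece s n \<Longrightarrow> \<bar>x - y\<bar> \<le> (2/3) ^ n * (Sup P - Inf P)"
proof -
  let ?l = "\<lambda>n. Inf (piece s n)" and ?m = "\<lambda>n. Sup (piece s n)"
  have bdd: "bdd_above (piece s n)" "bdd_below (piece s n)" for n
    using compact_piece[of s n]
    by (simp_all add: compact_imp_bounded bounded_imp_bdd_above bounded_imp_bdd_below)
  have len: "?m n - ?l n \<le> (2/3) ^ n * (Sup P - Inf P)" for n
  proof (induction n)
    case 0
    have "piece s 0 = P" using P_bounds by (force simp: piece_def)
    then show ?case by simp
  next
    case (Suc n)
    let ?c = "hull_cut (fst (cell s n)) (snd (cell s n))"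
    note h = hull_cut[OF cell_separates[of s n], folded piece_def]
    have sub: "piece s (Suc n) \<subseteq> (if s n then {?c..?m n} else {?l n..?c})"
      using h(10) by (auto simp: piece_Suc)
    have "?m (Suc n) - ?l (Suc n) \<le> (if s n then ?m n - ?c else ?c - ?l n)"
    proof (cases "s n")
      case True
      have "?m (Suc n) \<le> ?m n" "?c \<le> ?l (Suc n)"
        using sub True piece_nonempty[of s "Suc n"]
        by (auto intro!: cSup_least cInf_greatest simp del: cell.simps)
      then show ?thesis using True by simp
    next
      case False
      have "?m (Suc n) \<le> ?c" "?l n \<le> ?l (Suc n)"
        using sub False piece_nonempty[of s "Suc n"]
        by (auto intro!: cSup_least cInf_greatest simp del: cell.simps)
      then show ?thesis using False by simp
    qed
    also have "\<dots> \<le> 2/3 * (?m n - ?l n)" using h(8,9) by simp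
    also have "\<dots> \<le> 2/3 * ((2/3) ^ n * (Sup P - Inf P))" using Suc by simp
    finally show ?case by simp
  qed
  assume "x \<in> piece s n" "y \<in> piece s n"
  then have "?l n \<le> x" "x \<le> ?m n" "?l n \<le> y" "y \<le> ?m n"
    by (auto intro!: cInf_lower cSup_upper bdd)
  then show ?thesis using len[of n] by linarith
qed

lemma cell_cong: "(\<And>i. i < n \<Longrightarrow> s i = t i) \<Longrightarrow> cell s n = cell t n"
  by (induction n) simp_all

lemma piece_cong: "(\<And>i. i < n \<Longrightarrow> s i = t i) \<Longrightarrow> piece s n = piece t n"
  using cell_cong[of n s t] by (simp add: piece_def)

lemma piece_mono: "m \<le> n \<Longrightarrow> piece s n \<subseteq> piece s m"
  by (rule lift_Suc_antimono_le[of "piece s"]) (auto simp: piece_Suc)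

lemma ex1_point_with_itinerary: "\<exists>!x. \<forall>n. x \<in> piece s n"
proof -
  have "(\<Inter>n. piece s n) \<noteq> {}"
    by (rule compact_nest) (auto simp: compact_piece piece_nonempty dest: piece_mono)
  moreover have "x = y" if "\<forall>n. x \<in> piece s n" "\<forall>n. y \<in> piece s n" for x y
  proof -
    have "(\<lambda>n. (2/3) ^ n * (Sup P - Inf P)) \<longlonglongrightarrow> 0 * (Sup P - Inf P)"
      by (intro tendsto_intros LIMSEQ_power_zero) simp
    moreover have "\<bar>x - y\<bar> \<le> (2/3) ^ n * (Sup P - Inf P)" for n
      by (rule piece_small) (use that in auto)
    ultimately have "\<bar>x - y\<bar> \<le> 0 * (Sup P - Inf P)"
      by (intro LIMSEQ_le_const) auto
    then show ?thesis by simp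
  qed
  ultimately show ?thesis by blast
qed

definition point :: "(nat \<Rightarrow> bool) \<Rightarrow> real" where
  "point s = (THE x. \<forall>n. x \<in> piece s n)"

lemma point: "point s \<in> piece s n"
  using theI'[OF ex1_point_with_itinerary[of s]] unfolding point_def by blast

lemma point_eqI: "(\<And>n. x \<in> piece s n) \<Longrightarrow> point s = x"
  using ex1_point_with_itinerary[of s] point[of s] by blast

text \<open>The itinerary of \<open>x\<close> has to be found together with the cells, as the cuts depend on the choices
  made before; so the cells of \<open>x\<close> are iterated first and the itinerary is read off from them.\<close>
lemma itinerary:
  assumes x: "x \<in> P" shows "\<exists>s. \<forall>n. x \<in> piece s n"
proof -
  define step where "step = (\<lambda>(a, b). if x > hull_cut a b then (hull_cut a b, b) else (a, hull_cut a b))"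
  define iv where "iv n = (step ^^ n) (Inf P - 1, Sup P + 1)" for n
  define s where "s n \<longleftrightarrow> x > hull_cut (fst (iv n)) (snd (iv n))" for n
  have cell: "cell s n = iv n" for n
    by (induction n) (simp_all add: iv_def s_def step_def Let_def split_beta)
  have "x \<in> piece s n" for n
  proof (induction n)
    case 0
    show ?case using P_bounds[OF x] x by (simp add: piece_def)
  next
    case (Suc n)
    have "x \<noteq> hull_cut (fst (cell s n)) (snd (cell s n))"
      using hull_cut(7)[OF cell_separates[of s n]] x by auto
    then show ?case using Suc s_def[of n] cell[of n] by (auto simp: piece_Suc simp del: cell.simps)
  qed
  then show ?thesis by blast
qed

lemma inj_point: "inj point"
proof (rule injI)
  fix s t assume eq: "point s = point t"
  have "s i = t i" for i
  proof (induction i rule: less_induct)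
    case (less i)
    then have "cell s i = cell t i" by (rule cell_cong)
    then show ?case
      using point[of s "Suc i"] point[of t "Suc i"] eq by (auto simp: piece_Suc split: if_splits)
  qed
  then show "s = t" by blast
qed

lemma range_point: "range point = P"
proof
  show "range point \<subseteq> P" using point by (auto simp: piece_def)
  show "P \<subseteq> range point" using itinerary point_eqI by (metis rangeI subsetI)
qed

text \<open>The sequences with a given beginning form an open set, which \<open>point\<close> maps into one small piece;
  this is continuity. A continuous injection of a compact space is an embedding.\<close>
lemma homeomorphic_Cantor_space:
  "top_of_set P homeomorphic_space
     product_topology (\<lambda>_::nat. discrete_topology (UNIV :: bool set)) UNIV"
proof -
  let ?X = "product_topology (\<lambda>_::nat. discrete_topology (UNIV :: bool set)) UNIV"
  have compX: "compact_space ?X" by (simp add: compact_space_product_topology compact_space_discrete_topology)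
  have topX: "topspace ?X = UNIV" by simp
  have cyl: "openin ?X {t. \<forall>i<n. t i = s i}" for s n
  proof -
    have "openin ?X (\<Pi>\<^sub>E i\<in>UNIV. if i < n then {s i} else UNIV)"
      by (subst openin_PiE_gen) (auto intro: finite_subset[of _ "{..<n}"])
    moreover have "(\<Pi>\<^sub>E i\<in>UNIV. if i < n then {s i} else UNIV) = {t. \<forall>i<n. t i = s i}"
      by (auto simp: PiE_def Pi_def split: if_splits)
    ultimately show ?thesis by simp
  qed
  have lim: "\<exists>n. (2/3) ^ n * (Sup P - Inf P) < e" if "e > 0" for e :: real
  proof -
    have "(\<lambda>n. (2/3) ^ n * (Sup P - Inf P)) \<longlonglongrightarrow> 0 * (Sup P - Inf P)"
      by (intro tendsto_intros LIMSEQ_power_zero) simp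
    then have "\<forall>\<^sub>F n in sequentially. (2/3) ^ n * (Sup P - Inf P) < e"
      using that by (intro order_tendstoD(2)) simp_all
    then show ?thesis by (auto simp: eventually_sequentially)
  qed
  have cont: "continuous_map ?X euclidean point"
    unfolding continuous_map_def
  proof (intro conjI allI impI)
    fix U :: "real set" assume U: "openin euclidean U"
    show "openin ?X {s \<in> topspace ?X. point s \<in> U}"
    proof (subst openin_subopen, intro ballI)
      fix s assume "s \<in> {s \<in> topspace ?X. point s \<in> U}"
      then obtain e where e: "e > 0" "ball (point s) e \<subseteq> U"
        using U by (auto simp: open_contains_ball)
      obtain n where n: "(2/3) ^ n * (Sup P - Inf P) < e" using lim e(1) by blast
      have "point t \<in> U" if "\<forall>i<n. t i = s i" for t
      proof -
        have "point t \<in> piece s n" using point[of t n] piece_cong[of n t s] that by auto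
        then have "\<bar>point s - point t\<bar> < e" using piece_small[OF point[of s n]] n by fastforce
        then show ?thesis using e(2) by (auto simp: dist_real_def)
      qed
      then show "\<exists>T. openin ?X T \<and> s \<in> T \<and> T \<subseteq> {s \<in> topspace ?X. point s \<in> U}"
        using cyl[of n s] by (intro exI[of _ "{t. \<forall>i<n. t i = s i}"]) auto
    qed
  qed simp
  have "embedding_map ?X euclidean point"
    using compX cont inj_point by (intro continuous_imp_embedding_map) (auto simp: inj_on_def)
  then have "?X homeomorphic_space subtopology euclidean (point ` topspace ?X)"
    by (rule embedding_map_imp_homeomorphic_space)
  then have "?X homeomorphic_space top_of_set P"
    by (simp only: topX range_point)
  then show ?thesis by (subst homeomorphic_space_sym)
qed

end


section \<open>The universal covering of the torus\<close>

lemma circle_embed_abs: "circle_embed (abs_circle t) = cis (2 * pi * t)"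
  by (rule circle_embed.abs_eq)

lemma abs_circle_eq_iff: "abs_circle s = abs_circle t \<longleftrightarrow> s - t \<in> \<int>"
  by (rule circle.abs_eq_iff)

lemma rp_cover_eq_iff: "rp_cover u = rp_cover v \<longleftrightarrow> u - v \<in> \<int>"
  by (metis abs_circle_eq_iff cayley_rp_cover circle_embed_abs inj_cayley inj_circle_embed inj_eq)

lemma torus_cover_eq_iff:
  "torus_cover z = torus_cover w \<longleftrightarrow> (\<exists>k l. z = w + (of_int k, of_int l))"
proof -
  have *: "x - y \<in> \<int> \<longleftrightarrow> (\<exists>k. x = y + of_int k)" for x y :: real
    by (metis Ints_cases Ints_of_int add_diff_cancel_left' add_diff_eq diff_add_cancel add.commute)
  show ?thesis
    by (cases z; cases w) (auto simp: torus_cover_def rp_cover_eq_iff abs_circle_eq_iff *)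
qed

lemma torus_cover_shift [simp]: "torus_cover (z + (of_int k, of_int l)) = torus_cover z"
  using torus_cover_eq_iff by blast

lemma abs_fst_le_norm: "\<bar>fst z\<bar> \<le> norm z" and abs_snd_le_norm: "\<bar>snd z\<bar> \<le> norm z"
  for z :: "real \<times> real"
  using norm_fst_le[of "fst z" "snd z"] norm_snd_le[of "snd z" "fst z"] by simp_all

lemma norm_le_abs_sum: "norm z \<le> \<bar>fst z\<bar> + \<bar>snd z\<bar>" for z :: "real \<times> real"
  using norm_Pair_le[of "fst z" "snd z"] by simp

text \<open>The nonzero elements of the deck group \<open>\<int>\<^sup>2\<close> have norm at least \<open>1\<close>.\<close>
lemma torus_cover_eq_near:
  assumes "torus_cover z = torus_cover w" "norm (z - w) < 1" shows "z = w"
proof -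
  obtain m l where ml: "z = w + (of_int m, of_int l)" using assms(1) torus_cover_eq_iff by blast
  then have "\<bar>of_int m :: real\<bar> < 1" "\<bar>of_int l :: real\<bar> < 1"
    using abs_fst_le_norm[of "z - w"] abs_snd_le_norm[of "z - w"] assms(2) by simp_all
  then have "m = 0" "l = 0" by linarith+
  then show ?thesis using ml by (simp add: zero_prod_def[symmetric])
qed

lemma dist_rp_cover: "dist (rp_cover u) (rp_cover v) = dist (cis (2 * pi * u)) (cis (2 * pi * v))"
  by (simp add: dist_rpline_def cayley_rp_cover)

lemma dist_abs_circle: "dist (abs_circle s) (abs_circle t) = dist (cis (2 * pi * s)) (cis (2 * pi * t))"
  by (simp add: dist_circle_def circle_embed_abs)

lemma dist_cis_le: "dist (cis x) (cis y) \<le> \<bar>x - y\<bar>"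
proof -
  have "cis x - cis y = cis y * (exp (\<i> * of_real (x - y)) - 1)"
  proof -
    have "exp (\<i> * of_real (x - y)) = cis (x - y)" by (simp only: cis_conv_exp)
    then show ?thesis by (simp only:) (simp add: right_diff_distrib cis_mult)
  qed
  then have "dist (cis x) (cis y) = 2 * \<bar>sin ((x - y) / 2)\<bar>"
    by (simp only: dist_norm norm_mult norm_cis dist_exp_i_1 mult_1)
  also have "\<dots> \<le> 2 * \<bar>(x - y) / 2\<bar>" by (intro mult_left_mono abs_sin_x_le_abs_x) simp
  finally show ?thesis by simp
qed

lemma continuous_on_rp_cover: "continuous_on UNIV rp_cover"
proof -
  have "continuous_on UNIV (\<lambda>u. cis (2 * pi * u))" by (intro continuous_intros)
  then show ?thesis unfolding continuous_on_iff by (simp add: dist_rp_cover)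
qed

lemma continuous_on_abs_circle: "continuous_on UNIV abs_circle"
proof -
  have "continuous_on UNIV (\<lambda>u. cis (2 * pi * u))" by (intro continuous_intros)
  then show ?thesis unfolding continuous_on_iff by (simp add: dist_abs_circle)
qed

lemma continuous_on_torus_cover: "continuous_on UNIV torus_cover"
proof -
  have eq: "torus_cover = (\<lambda>z. (rp_cover (fst z), abs_circle (snd z)))"
    by (auto simp: torus_cover_def)
  show ?thesis unfolding eq
    by (intro continuous_on_Pair continuous_on_compose2[OF continuous_on_rp_cover]
          continuous_on_compose2[OF continuous_on_abs_circle] continuous_intros) auto
qed

lemma rp_cover_surj: "\<exists>u. p = rp_cover u"
proof (cases p)
  case Infty
  then have "p = rp_cover (1/2)" by (simp add: rp_cover_def cos_pi_half)
  then show ?thesis ..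
next
  case (Fin x)
  have "cos (pi * (arctan x / pi)) \<noteq> 0" using cos_arctan_not_zero by simp
  then have "p = rp_cover (arctan x / pi)" using Fin by (simp add: rp_cover_def tan_arctan)
  then show ?thesis ..
qed

lemma torus_cover_surj: "\<exists>z. p = torus_cover z"
proof -
  obtain q \<theta> where p: "p = (q, \<theta>)" by fastforce
  obtain u where "q = rp_cover u" using rp_cover_surj by blast
  moreover have "\<exists>t. \<theta> = abs_circle t" by (induct \<theta> rule: circle.abs_induct) blast
  then obtain t where "\<theta> = abs_circle t" ..
  ultimately show ?thesis using p by (auto simp: torus_cover_def)
qed

lemma torus_cover_surj_unit:
  obtains u t where "p = torus_cover (u, t)" "0 \<le> u" "u < 1" "0 \<le> t" "t < 1"
proof -
  obtain v s where "p = torus_cover (v, s)" using torus_cover_surj[of p] by fastforce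
  moreover have "(frac v, frac s) = (v, s) + (of_int (- \<lfloor>v\<rfloor>), of_int (- \<lfloor>s\<rfloor>))"
    by (simp add: frac_def)
  ultimately have "p = torus_cover (frac v, frac s)" by (metis torus_cover_shift)
  then show thesis using that frac_lt_1 frac_ge_0 by blast
qed

lemma compact_torus: "compact (UNIV :: torus set)"
proof -
  have "UNIV = torus_cover ` ({0..1} \<times> {0..1})"
  proof -
    have "p \<in> torus_cover ` ({0..1} \<times> {0..1})" for p
      by (rule torus_cover_surj_unit[of p]) (auto intro!: image_eqI)
    then show ?thesis by blast
  qed
  moreover have "compact (torus_cover ` ({0..1} \<times> {0..1}))"
    by (intro compact_continuous_image continuous_on_subset[OF continuous_on_torus_cover] compact_Times) auto
  ultimately show ?thesis by simp
qed

lemma continuous_Ints_constant: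
  fixes f :: "real \<times> real \<Rightarrow> real"
  assumes "continuous_on UNIV f" "\<And>z. f z \<in> \<int>"
  obtains k where "\<And>z. f z = of_int k"
proof -
  have "f constant_on UNIV"
  proof (rule continuous_discrete_range_constant[OF connected_UNIV assms(1)])
    fix x
    show "\<exists>e>0. \<forall>y. y \<in> UNIV \<and> f y \<noteq> f x \<longrightarrow> e \<le> norm (f y - f x)"
    proof (intro exI[of _ 1] conjI allI impI)
      fix y assume "y \<in> UNIV \<and> f y \<noteq> f x"
      moreover have "f y - f x \<in> \<int>" using assms(2) by simp
      ultimately show "1 \<le> norm (f y - f x)" by (simp add: Ints_nonzero_abs_ge1)
    qed simp
  qed
  then show thesis using that assms(2) unfolding constant_on_def by (metis Ints_cases UNIV_I)
qed

text \<open>Two lifts of one map differ by a continuous function with values in the discrete deck group.\<close>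
lemma lift_unique:
  fixes F G :: "real \<times> real \<Rightarrow> real \<times> real"
  assumes "continuous_on UNIV F" "continuous_on UNIV G"
    and "\<And>z. torus_cover (F z) = torus_cover (G z)"
  obtains k l where "\<And>z. F z = G z + (of_int k, of_int l)"
proof -
  have "fst (F z) - fst (G z) \<in> \<int>" "snd (F z) - snd (G z) \<in> \<int>" for z
    using assms(3)[of z] unfolding torus_cover_eq_iff by auto
  note int = this
  have cont: "continuous_on UNIV (\<lambda>z. fst (F z) - fst (G z))"
    "continuous_on UNIV (\<lambda>z. snd (F z) - snd (G z))"
    by (intro continuous_intros assms)+
  obtain k where "\<And>z. fst (F z) - fst (G z) = of_int k"
    using continuous_Ints_constant[OF cont(1) int(1)] by blast
  moreover obtain l where "\<And>z. snd (F z) - snd (G z) = of_int l"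
    using continuous_Ints_constant[OF cont(2) int(2)] by blast
  ultimately have "F z = G z + (of_int k, of_int l)" for z
    by (simp add: prod_eq_iff algebra_simps)
  then show thesis by (rule that)
qed

lemma dist_torus_cover: "dist (torus_cover z) (torus_cover w) \<le> 4 * pi * norm (z - w)"
proof -
  have a: "\<bar>2 * pi * x - 2 * pi * y\<bar> = 2 * pi * \<bar>x - y\<bar>" for x y :: real
    by (simp add: abs_mult flip: right_diff_distrib)
  have "dist (torus_cover z) (torus_cover w)
      \<le> dist (rp_cover (fst z)) (rp_cover (fst w)) + dist (abs_circle (snd z)) (abs_circle (snd w))"
    by (simp add: torus_cover_def dist_prod_def sqrt_sum_squares_le_sum)
  also have "\<dots> \<le> 2 * pi * \<bar>fst (z - w)\<bar> + 2 * pi * \<bar>snd (z - w)\<bar>"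
    unfolding dist_rp_cover dist_abs_circle
    using dist_cis_le[of "2 * pi * fst z" "2 * pi * fst w"] dist_cis_le[of "2 * pi * snd z" "2 * pi * snd w"]
    by (simp add: a)
  also have "\<dots> \<le> 2 * pi * norm (z - w) + 2 * pi * norm (z - w)"
    using norm_fst_le[of "fst (z - w)" "snd (z - w)"] norm_snd_le[of "snd (z - w)" "fst (z - w)"]
    by (intro add_mono mult_left_mono) (simp_all only: real_norm_def prod.collapse, simp_all)
  finally show ?thesis by simp
qed

section \<open>Projective affine maps in the angular coordinate\<close>

text \<open>
  For \<open>x = tan (\<pi> u)\<close> the subtraction formula of the tangent gives
  \<open>tan (\<pi> (v - u)) = (a x + b - x) / (1 + (a x + b) x)\<close> when \<open>tan (\<pi> v) = a x + b\<close>. Multiplication by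
  \<open>cos\<^sup>2 (\<pi> u)\<close> turns numerator and denominator into \<open>aff_num\<close> and \<open>aff_den\<close>. For \<open>b\<^sup>2 < 4 a\<close> the
  denominator is a positive definite quadratic form in cosine and sine, so that one formula with the
  principal branch of the arc tangent is a smooth lift on the whole line. This covers the maps
  \<open>x \<mapsto> x \<plusminus> 1\<close> and \<open>x \<mapsto> n x\<close>, \<open>x \<mapsto> x / n\<close>.
\<close>

definition aff_num :: "real \<Rightarrow> real \<Rightarrow> real \<Rightarrow> real" where
  "aff_num a b u = (a - 1) * sin (pi * u) * cos (pi * u) + b * (cos (pi * u))\<^sup>2"

definition aff_den :: "real \<Rightarrow> real \<Rightarrow> real \<Rightarrow> real" where
  "aff_den a b u = (cos (pi * u))\<^sup>2 + a * (sin (pi * u))\<^sup>2 + b * sin (pi * u) * cos (pi * u)"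

text \<open>The squared length of the vector \<open>(cos, a sin + b cos)\<close>, the image of \<open>(cos, sin)\<close> under the
  linear map that induces \<open>x \<mapsto> a x + b\<close> on the projective line.\<close>
definition aff_norm :: "real \<Rightarrow> real \<Rightarrow> real \<Rightarrow> real" where
  "aff_norm a b u = (cos (pi * u))\<^sup>2 + (a * sin (pi * u) + b * cos (pi * u))\<^sup>2"

definition aff_lift :: "real \<Rightarrow> real \<Rightarrow> real \<Rightarrow> real" where
  "aff_lift a b u = u + arctan (aff_num a b u / aff_den a b u) / pi"

lemma aff_norm_eq: "(aff_num a b u)\<^sup>2 + (aff_den a b u)\<^sup>2 = aff_norm a b u"
proof -
  have "(sin (pi * u))\<^sup>2 = 1 - (cos (pi * u))\<^sup>2" by (rule sin_squared_eq)
  then show ?thesis unfolding aff_num_def aff_den_def aff_norm_def by algebra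
qed

lemma aff_den_pos:
  assumes "b\<^sup>2 < 4 * a" shows "aff_den a b u > 0"
proof -
  define c s where "c = cos (pi * u)" and "s = sin (pi * u)"
  have cs: "c\<^sup>2 + s\<^sup>2 = 1" by (simp add: c_def s_def)
  have "aff_den a b u = (c + b/2 * s)\<^sup>2 + (a - b\<^sup>2/4) * s\<^sup>2"
    by (simp add: aff_den_def c_def s_def power2_eq_square algebra_simps)
  moreover have "(c + b/2 * s)\<^sup>2 + (a - b\<^sup>2/4) * s\<^sup>2 > 0"
  proof (cases "s = 0")
    case True then show ?thesis using cs by simp
  next
    case False
    then have "(a - b\<^sup>2/4) * s\<^sup>2 > 0" using assms by simp
    then show ?thesis by (simp add: add_nonneg_pos)
  qed
  ultimately show ?thesis by simp
qed

context
  fixes a b :: real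
  assumes ab: "b\<^sup>2 < 4 * a"
begin

lemma aff_norm_pos: "aff_norm a b u > 0"
  using aff_den_pos[OF ab, of u] by (simp flip: aff_norm_eq add: add_nonneg_pos)

lemma cos_sin_aff_lift:
  "cos (pi * aff_lift a b u) = cos (pi * u) / sqrt (aff_norm a b u)"
  "sin (pi * aff_lift a b u) = (a * sin (pi * u) + b * cos (pi * u)) / sqrt (aff_norm a b u)"
proof -
  define N D c s where "N = aff_num a b u" and "D = aff_den a b u"
    and "c = cos (pi * u)" and "s = sin (pi * u)"
  note D = aff_den_pos[OF ab, of u, folded D_def]
  have cs: "s\<^sup>2 = 1 - c\<^sup>2" by (simp add: c_def s_def sin_squared_eq)
  have "1 + (N / D)\<^sup>2 = aff_norm a b u / D\<^sup>2"
    using D by (simp add: N_def D_def flip: aff_norm_eq add: field_simps)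
  then have sq: "sqrt (1 + (N / D)\<^sup>2) = sqrt (aff_norm a b u) / D"
    using D by (simp add: real_sqrt_divide)
  have r: "sqrt (aff_norm a b u) > 0" using aff_norm_pos by simp
  have co: "cos (arctan (N / D)) = D / sqrt (aff_norm a b u)"
    and si: "sin (arctan (N / D)) = N / sqrt (aff_norm a b u)"
    using D by (simp_all add: cos_arctan sin_arctan sq)
  have ang: "pi * aff_lift a b u = pi * u + arctan (N / D)"
    by (simp add: aff_lift_def N_def D_def field_simps)
  have "c * D - s * N = c" "s * D + c * N = a * s + b * c"
    using cs unfolding N_def D_def aff_num_def aff_den_def c_def[symmetric] s_def[symmetric] by algebra+
  then show "cos (pi * aff_lift a b u) = cos (pi * u) / sqrt (aff_norm a b u)"
    "sin (pi * aff_lift a b u) = (a * sin (pi * u) + b * cos (pi * u)) / sqrt (aff_norm a b u)"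
    using r unfolding ang cos_add sin_add co si c_def[symmetric] s_def[symmetric]
    by (simp_all add: field_simps)
qed

lemma rp_cover_aff_lift: "rp_cover (aff_lift a b u) = rp_affine a b (rp_cover u)"
proof -
  have "tan (pi * aff_lift a b u) = a * tan (pi * u) + b" if "cos (pi * u) \<noteq> 0"
    using that aff_norm_pos[of u] unfolding tan_def cos_sin_aff_lift by (simp add: field_simps)
  then show ?thesis
    using aff_norm_pos[of u] by (simp add: rp_cover_def cos_sin_aff_lift(1) less_imp_neq[symmetric])
qed

lemma aff_lift_deriv: "(aff_lift a b has_real_derivative a / aff_norm a b u) (at u)"
proof -
  define N D c s where "N = aff_num a b u" and "D = aff_den a b u"
    and "c = cos (pi * u)" and "s = sin (pi * u)"
  define N' where "N' = (a - 1) * (c\<^sup>2 - s\<^sup>2) - 2 * b * s * c"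
  define D' where "D' = - 2 * s * c + 2 * a * s * c + b * (c\<^sup>2 - s\<^sup>2)"
  note D = aff_den_pos[OF ab, of u, folded D_def]
  have cs: "s\<^sup>2 = 1 - c\<^sup>2" by (simp add: c_def s_def sin_squared_eq)
  have dN: "(aff_num a b has_real_derivative pi * N') (at u)"
    unfolding aff_num_def N'_def c_def s_def
    by (auto intro!: derivative_eq_intros simp: power2_eq_square algebra_simps)
  have dD: "(aff_den a b has_real_derivative pi * D') (at u)"
    unfolding aff_den_def D'_def c_def s_def
    by (auto intro!: derivative_eq_intros simp: power2_eq_square algebra_simps)
  have "((\<lambda>u. arctan (aff_num a b u / aff_den a b u)) has_real_derivative
      inverse (1 + (N / D)\<^sup>2) * ((pi * N' * D - N * (pi * D')) / (D * D))) (at u)"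
    using DERIV_chain2[OF DERIV_arctan DERIV_divide[OF dN dD]] D by (simp add: N_def D_def)
  from DERIV_add[OF DERIV_ident DERIV_cdivide[OF this, of pi]]
  have 1: "(aff_lift a b has_real_derivative
      1 + inverse (1 + (N / D)\<^sup>2) * ((pi * N' * D - N * (pi * D')) / (D * D)) / pi) (at u)"
    by (simp only: aff_lift_def[abs_def])
  have q: "D\<^sup>2 + N\<^sup>2 > 0" using D by (simp add: add_pos_nonneg)
  have "N' * D - N * D' + (N\<^sup>2 + D\<^sup>2) = a"
    using cs unfolding N_def D_def N'_def D'_def aff_num_def aff_den_def c_def[symmetric] s_def[symmetric]
    by algebra
  then have e: "N' * D - N * D' = a - (D\<^sup>2 + N\<^sup>2)" by simp
  have "1 + inverse (1 + (N / D)\<^sup>2) * ((pi * N' * D - N * (pi * D')) / (D * D)) / pi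
      = 1 + (N' * D - N * D') / (D\<^sup>2 + N\<^sup>2)"
  proof -
    have i: "inverse (1 + (N / D)\<^sup>2) = (D * D) / (D\<^sup>2 + N\<^sup>2)"
      using D q by (simp add: field_simps power2_eq_square)
    have p: "pi * N' * D - N * (pi * D') = pi * (N' * D - N * D')" by (simp add: algebra_simps)
    show ?thesis unfolding i p using D by simp
  qed
  also have "\<dots> = a / aff_norm a b u"
  proof -
    have "aff_norm a b u = D\<^sup>2 + N\<^sup>2" by (simp add: N_def D_def flip: aff_norm_eq)
    then show ?thesis unfolding e diff_divide_distrib using q D by simp
  qed
  finally show ?thesis using 1 by simp
qed

end


section \<open>Lifts of the model maps and \<open>C\<^sup>1\<close> neighbourhoods\<close>

lemma C1_lift_eq: "C1_lift f F F' \<Longrightarrow> f (torus_cover z) = torus_cover (F z)"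
  unfolding C1_lift_def by blast

lemma C1_lift_deriv: "C1_lift f F F' \<Longrightarrow> (F has_derivative blinfun_apply (F' z)) (at z)"
  unfolding C1_lift_def by blast

lemma aff_lift_shift: "aff_lift a b (u + of_int k) = aff_lift a b u + of_int k"
proof -
  have c: "cos (pi * (u + of_int k)) = (-1) powi k * cos (pi * u)"
    and s: "sin (pi * (u + of_int k)) = (-1) powi k * sin (pi * u)"
    by (simp_all add: distrib_left cos_add sin_add cos_npi_int sin_npi_int power_int_minus_left)
  have e: "((-1) powi k :: real) * ((-1) powi k) = 1" 
    by (simp add: power_int_minus_left)
  have "aff_num a b (u + of_int k) = ((-1) powi k * (-1) powi k) * aff_num a b u"
    "aff_den a b (u + of_int k) = ((-1) powi k * (-1) powi k) * aff_den a b u"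
    unfolding aff_num_def aff_den_def c s by (simp_all add: power2_eq_square algebra_simps)
  then show ?thesis by (simp add: aff_lift_def e)
qed

text \<open>The maps \<open>f0\<close>, \<open>h0\<close> and their inverses are products of a projective affine map and a rotation;
  they are treated together.\<close>
definition model_lift :: "real \<Rightarrow> real \<Rightarrow> real \<Rightarrow> real \<times> real \<Rightarrow> real \<times> real" where
  "model_lift a b \<tau> z = (aff_lift a b (fst z), snd z + \<tau>)"

definition model_deriv :: "real \<Rightarrow> real \<Rightarrow> real \<times> real \<Rightarrow> (real \<times> real) \<Rightarrow>\<^sub>L (real \<times> real)" where
  "model_deriv a b z = (a / aff_norm a b (fst z)) *\<^sub>R Blinfun (\<lambda>d. (fst d, 0)) + Blinfun (\<lambda>d. (0, snd d))"

definition model_map :: "real \<Rightarrow> real \<Rightarrow> real \<Rightarrow> torus \<Rightarrow> torus" where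
  "model_map a b \<tau> = map_prod (rp_affine a b) (circle_rotate \<tau>)"

lemma blinfun_apply_model_deriv:
  "blinfun_apply (model_deriv a b z) d = (a / aff_norm a b (fst z) * fst d, snd d)"
proof -
  have "bounded_linear (\<lambda>d::real \<times> real. (fst d, 0::real))" "bounded_linear (\<lambda>d::real \<times> real. (0::real, snd d))"
    by (intro bounded_linear_Pair bounded_linear_fst bounded_linear_snd bounded_linear_zero)+
  then show ?thesis
    by (simp add: model_deriv_def blinfun.bilinear_simps bounded_linear_Blinfun_apply)
qed

lemma model_C1_lift:
  assumes ab: "b\<^sup>2 < 4 * a"
  shows "C1_lift (model_map a b \<tau>) (model_lift a b \<tau>) (model_deriv a b)"
  unfolding C1_lift_def
proof (intro conjI allI)
  fix z
  show "model_map a b \<tau> (torus_cover z) = torus_cover (model_lift a b \<tau> z)"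
    by (cases z) (simp add: model_map_def torus_cover_def model_lift_def rp_cover_aff_lift[OF ab]
        circle_rotate.abs_eq)
  have "((\<lambda>z. aff_lift a b (fst z)) has_derivative (\<lambda>d. a / aff_norm a b (fst z) * fst d)) (at z)"
    using has_derivative_compose[OF has_derivative_fst[OF has_derivative_ident]
        aff_lift_deriv[OF ab, unfolded has_field_derivative_def]]
    by simp
  moreover have "((\<lambda>z. snd z + \<tau>) has_derivative (\<lambda>d. snd d)) (at z)"
    by (auto intro!: derivative_eq_intros)
  ultimately have "(model_lift a b \<tau> has_derivative (\<lambda>d. (a / aff_norm a b (fst z) * fst d, snd d))) (at z)"
    unfolding model_lift_def[abs_def] by (rule has_derivative_Pair)
  then show "(model_lift a b \<tau> has_derivative blinfun_apply (model_deriv a b z)) (at z)"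
    by (simp add: blinfun_apply_model_deriv[abs_def] fun_eq_iff)
next
  have "aff_norm a b (fst z) \<noteq> 0" for z using aff_norm_pos[OF ab, of "fst z"] by simp
  then show "continuous_on UNIV (model_deriv a b)"
    unfolding model_deriv_def[abs_def] by (auto simp: aff_norm_def intro!: continuous_intros)
qed

lemma rp_affine_inverse: "a \<noteq> 0 \<Longrightarrow> rp_affine (1/a) (- (b / a)) (rp_affine a b p) = p"
  by (cases p) (simp_all add: field_simps)

lemma circle_rotate_inverse: "circle_rotate (- t) (circle_rotate t x) = x"
  by transfer simp

lemma model_map_inverse:
  assumes "a \<noteq> 0" shows "model_map (1/a) (- (b / a)) (- \<tau>) (model_map a b \<tau> p) = p"
  by (cases p) (simp add: model_map_def rp_affine_inverse[OF assms] circle_rotate_inverse)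

lemma model_Diff1:
  assumes ab: "b\<^sup>2 < 4 * a" shows "model_map a b \<tau> \<in> Diff1"
proof -
  have "a > 0" using ab zero_le_power2[of b] by linarith
  let ?g = "model_map (1/a) (- (b / a)) (- \<tau>)"
  have gf: "?g (model_map a b \<tau> p) = p" for p using \<open>a > 0\<close> by (simp add: model_map_inverse)
  moreover have fg: "model_map a b \<tau> (?g p) = p" for p
    using model_map_inverse[of "1/a" "- b / a" "- \<tau>" p] \<open>a > 0\<close> by simp
  ultimately have bij: "bij (model_map a b \<tau>)" by (intro o_bij[of ?g]) (auto simp: fun_eq_iff)
  have inv: "inv_into UNIV (model_map a b \<tau>) = ?g"
    using gf fg by (intro inv_equality) auto
  have "(- (b / a))\<^sup>2 < 4 * (1 / a)" using ab \<open>a > 0\<close> by (simp add: field_simps power2_eq_square)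
  then have "C1_map ?g" using model_C1_lift unfolding C1_map_def by blast
  moreover have "C1_map (model_map a b \<tau>)" using model_C1_lift[OF ab] unfolding C1_map_def by blast
  ultimately show ?thesis using bij by (simp add: Diff1_def inv)
qed

lemma f0_model: "f0 = model_map 1 1 0"
proof -
  have "circle_rotate 0 x = x" for x by transfer simp
  then show ?thesis by (auto simp: f0_def model_map_def)
qed

lemma h0_model: "h0 n = model_map (real n) 0 (ln (real n))"
  by (simp add: h0_def model_map_def)

lemma C1_lift_continuous: "C1_lift f F F' \<Longrightarrow> continuous_on UNIV F"
  unfolding C1_lift_def
  by (meson continuous_at_imp_continuous_on has_derivative_continuous)

lemma C1_lift_unique:
  assumes F: "C1_lift f F F'" and G: "C1_lift f G G'"
  obtains k l where "\<And>z. F z = G z + (of_int k, of_int l)" "F' = G'"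
proof -
  obtain k l where kl: "\<And>z. F z = G z + (of_int k, of_int l)"
    using lift_unique[OF C1_lift_continuous[OF F] C1_lift_continuous[OF G]] F G
    unfolding C1_lift_def by metis
  have "blinfun_apply (F' z) = blinfun_apply (G' z)" for z
  proof (rule has_derivative_unique)
    show "(F has_derivative blinfun_apply (F' z)) (at z)" using F by (rule C1_lift_deriv)
    have "((\<lambda>z. G z + (of_int k, of_int l)) has_derivative blinfun_apply (G' z)) (at z)"
      using C1_lift_deriv[OF G, of z] by (auto intro!: derivative_eq_intros)
    then show "(F has_derivative blinfun_apply (G' z)) (at z)"
    proof -
      have "F = (\<lambda>z. G z + (of_int k, of_int l))" using kl by blast
      then show ?thesis using \<open>((\<lambda>z. G z + _) has_derivative _) _\<close> by (simp only:)
    qed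
  qed
  then have "F' z = G' z" for z by (metis blinfun_apply_inject)
  then have "F' = G'" by (rule ext)
  then show thesis using that kl by blast
qed

lemma C1_lift_translate:
  assumes "C1_lift f F F'" shows "C1_lift f (\<lambda>z. F z + (of_int k, of_int l)) F'"
  unfolding C1_lift_def
proof (intro conjI allI)
  show "((\<lambda>z. F z + (of_int k, of_int l)) has_derivative blinfun_apply (F' z)) (at z)" for z
    using C1_lift_deriv[OF assms, of z] by (auto intro!: derivative_eq_intros)
  show "f (torus_cover z) = torus_cover (F z + (of_int k, of_int l))" for z
    using C1_lift_eq[OF assms] by simp
  show "continuous_on UNIV F'" using assms by (simp add: C1_lift_def)
qed

text \<open>Closeness speaks of some pair of lifts; translating both by the same deck transformation makes
  any given lift of \<open>f\<close> available.\<close>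
lemma C1_close_lift:
  assumes "C1_close \<delta> f g" "C1_lift f F F'"
  obtains G G' where "C1_lift g G G'" "\<And>z. dist (F z) (G z) < \<delta>" "\<And>z. dist (F' z) (G' z) < \<delta>"
proof -
  obtain F1 F1' G G' where *: "C1_lift f F1 F1'" "C1_lift g G G'"
    "\<And>z. dist (F1 z) (G z) < \<delta>" "\<And>z. dist (F1' z) (G' z) < \<delta>"
    using assms(1) unfolding C1_close_def by blast
  obtain k l where kl: "\<And>z. F z = F1 z + (of_int k, of_int l)" "F' = F1'"
    using C1_lift_unique[OF assms(2) *(1)] by blast
  show thesis
    by (rule that[OF C1_lift_translate[OF *(2), of k l]]) (use * kl in auto)
qed

lemma C1_close_triangle:
  assumes "C1_close \<delta> f g" "C1_close \<delta>' g k" shows "C1_close (\<delta> + \<delta>') f k"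
proof -
  obtain F F' G G' where *: "C1_lift f F F'" "C1_lift g G G'"
    "\<And>z. dist (F z) (G z) < \<delta>" "\<And>z. dist (F' z) (G' z) < \<delta>"
    using assms(1) unfolding C1_close_def by blast
  obtain K K' where K: "C1_lift k K K'" "\<And>z. dist (G z) (K z) < \<delta>'" "\<And>z. dist (G' z) (K' z) < \<delta>'"
    using C1_close_lift[OF assms(2) *(2)] by blast
  have "dist (F z) (K z) < \<delta> + \<delta>'" "dist (F' z) (K' z) < \<delta> + \<delta>'" for z
    using *(3,4)[of z] K(2,3)[of z] dist_triangle[of "F z" "K z" "G z"] dist_triangle[of "F' z" "K' z" "G' z"]
    by linarith+
  then show ?thesis using *(1) K(1) unfolding C1_close_def by blast
qed

text \<open>Closeness with some \<open>d < \<delta>\<close> leaves room for the triangle inequality and is therefore an open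
  condition.\<close>
lemma C1_neighbourhood:
  assumes "f \<in> Diff1" "\<delta> > 0"
  obtains U where "openin C1_topology U" "f \<in> U" "\<And>g. g \<in> U \<Longrightarrow> g \<in> Diff1 \<and> C1_close \<delta> f g"
proof -
  define U where "U = {g \<in> Diff1. \<exists>d<\<delta>. C1_close d f g}"
  have "openin C1_topology U"
    unfolding openin_C1_topology
  proof (intro conjI ballI)
    fix g assume "g \<in> U"
    then obtain d where d: "d < \<delta>" "C1_close d f g" by (auto simp: U_def)
    have "k \<in> U" if "k \<in> Diff1" "C1_close ((\<delta> - d) / 2) g k" for k
    proof -
      have "d + (\<delta> - d) / 2 < \<delta>" using d(1) by (simp add: field_simps)
      then show ?thesis using C1_close_triangle[OF d(2) that(2)] that(1) unfolding U_def by blast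
    qed
    then show "\<exists>\<delta>>0. \<forall>k\<in>Diff1. C1_close \<delta> g k \<longrightarrow> k \<in> U"
      using d(1) by (intro exI[of _ "(\<delta> - d) / 2"]) auto
  qed (auto simp: U_def)
  moreover have "f \<in> U"
  proof -
    obtain F F' where "C1_lift f F F'" using assms(1) by (auto simp: Diff1_def C1_map_def)
    then have "C1_close (\<delta>/2) f f" using assms(2) unfolding C1_close_def
      by (intro exI[of _ F] exI[of _ F']) auto
    then show ?thesis using assms unfolding U_def by (auto intro!: exI[of _ "\<delta>/2"])
  qed
  moreover have "g \<in> Diff1 \<and> C1_close \<delta> f g" if "g \<in> U" for g
    using that C1_close_mono unfolding U_def by fastforce
  ultimately show thesis using that by blast
qed

text \<open>By the mean value inequality on the plane, a small derivative of the error makes its Lipschitz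
  constant small.\<close>
lemma C1_close_model:
  assumes ab: "b\<^sup>2 < 4 * a" and close: "C1_close \<delta> (model_map a b \<tau>) g"
  obtains G where "continuous_on UNIV G" "\<And>z. g (torus_cover z) = torus_cover (G z)"
    "\<And>z. norm (G z - model_lift a b \<tau> z) < \<delta>"
    "\<And>z w. norm ((G z - model_lift a b \<tau> z) - (G w - model_lift a b \<tau> w)) \<le> \<delta> * norm (z - w)"
proof -
  let ?F = "model_lift a b \<tau>" and ?F' = "model_deriv a b"
  obtain G G' where G: "C1_lift g G G'" "\<And>z. dist (?F z) (G z) < \<delta>" "\<And>z. dist (?F' z) (G' z) < \<delta>"
    using C1_close_lift[OF close model_C1_lift[OF ab]] by blast
  have "norm ((G z - ?F z) - (G w - ?F w)) \<le> \<delta> * norm (z - w)" for z w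
  proof (rule differentiable_bound[of UNIV])
    show "((\<lambda>z. G z - ?F z) has_derivative blinfun_apply (G' x - ?F' x)) (at x within UNIV)" for x
      using has_derivative_diff[OF C1_lift_deriv[OF G(1), of x] C1_lift_deriv[OF model_C1_lift[OF ab, of \<tau>], of x]]
      by (simp add: blinfun.diff_left[abs_def])
    show "onorm (blinfun_apply (G' x - ?F' x)) \<le> \<delta>" for x
      using G(3)[of x] by (simp add: norm_blinfun.rep_eq[symmetric] dist_norm norm_minus_commute less_imp_le)
  qed auto
  moreover have "norm (G z - ?F z) < \<delta>" for z using G(2)[of z] by (simp add: dist_norm norm_minus_commute)
  ultimately show thesis using that C1_lift_continuous[OF G(1)] G(1) unfolding C1_lift_def by blast
qed

lemma model_lift_shift:
  "model_lift a b \<tau> (z + (of_int k, of_int l)) = model_lift a b \<tau> z + (of_int k, of_int l)"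
  by (simp add: model_lift_def aff_lift_shift prod_eq_iff)

text \<open>The model commutes with deck transformations, and a perturbation is too close to it to
  act differently on the deck group.\<close>
lemma close_lift_shift:
  assumes G: "continuous_on UNIV G" "\<And>z. g (torus_cover z) = torus_cover (G z)"
    and close: "\<And>z. norm (G z - model_lift a b \<tau> z) < \<delta>" and "\<delta> \<le> 1/2"
  shows "G (z + (of_int k, of_int l)) = G z + (of_int k, of_int l)"
proof (rule torus_cover_eq_near)
  let ?M = "model_lift a b \<tau>" and ?e = "(of_int k, of_int l) :: real \<times> real"
  show "torus_cover (G (z + ?e)) = torus_cover (G z + ?e)"
    by (simp flip: G(2))
  have eq: "G (z + ?e) - (G z + ?e) = (G (z + ?e) - ?M (z + ?e)) - (G z - ?M z)"
    by (simp add: model_lift_shift)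
  show "norm (G (z + ?e) - (G z + ?e)) < 1"
    unfolding eq using norm_triangle_ineq4[of "G (z + ?e) - ?M (z + ?e)" "G z - ?M z"] close[of z] close[of "z + ?e"] \<open>\<delta> \<le> 1/2\<close>
    by linarith
qed

section \<open>Attracting and repelling invariant circles\<close>

definition band :: "real \<Rightarrow> real \<Rightarrow> (real \<times> real) set" where
  "band c r = {z. \<bar>fst z - c\<bar> \<le> r}"

lemma closed_band: "closed (band c r)"
  unfolding band_def by (intro closed_Collect_le continuous_intros)

lemma band_shift: "z + (of_int m, of_int l) \<in> band (c + of_int m) r \<longleftrightarrow> z \<in> band c r"
  by (simp add: band_def)

lemma funpow_semiconj:
  fixes G :: "'a \<Rightarrow> 'a" and h :: "'b \<Rightarrow> 'b"
  assumes "\<And>z. h (p z) = p (G z)" shows "(h ^^ j) (p z) = p ((G ^^ j) z)"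
  by (induction j) (simp_all add: assms)

lemma funpow_left_inverse:
  fixes G K :: "'a \<Rightarrow> 'a"
  assumes "\<And>z. K (G z) = z" shows "(K ^^ j) ((G ^^ j) z) = z"
  by (induction j arbitrary: z) (simp_all add: funpow_swap1[of G] assms)

text \<open>
  The plane maps \<open>G\<close> and \<open>K\<close> are inverse to each other and lift the torus maps \<open>h\<close> and \<open>k\<close>. The band
  around \<open>a\<close> is positively invariant and attracting, the band around \<open>b\<close> is so for the inverse. The
  cone conditions say that a difference of two points whose image is at least as horizontal as
  vertical was already such before, and that its horizontal part has been contracted. The hypotheses are
  symmetric under exchanging \<open>(G, h, a)\<close> with \<open>(K, k, b)\<close>, so every result holds also for the inverse.
\<close>
locale north_south =
  fixes G K :: "real \<times> real \<Rightarrow> real \<times> real" and h k :: "torus \<Rightarrow> torus" and a b r \<kappa> :: real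
  assumes GK [simp]: "G (K z) = z" and KG [simp]: "K (G z) = z"
    and cont_G: "continuous_on UNIV G" and cont_K: "continuous_on UNIV K"
    and G_shift: "G (z + (of_int m, of_int l)) = G z + (of_int m, of_int l)"
    and h_cover: "h (torus_cover z) = torus_cover (G z)"
    and k_cover: "k (torus_cover z) = torus_cover (K z)"
    and r_pos: "0 < r" and r_less: "r < 1/4" and \<kappa>: "0 \<le> \<kappa>" "\<kappa> < 1"
    and G_band: "z \<in> band a r \<Longrightarrow> G z \<in> band a r"
    and K_band: "z \<in> band b r \<Longrightarrow> K z \<in> band b r"
    and cone_G: "\<lbrakk>z \<in> band a r; w \<in> band a r; \<bar>snd (G z) - snd (G w)\<bar> \<le> \<bar>fst (G z) - fst (G w)\<bar>\<rbrakk>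
      \<Longrightarrow> \<bar>snd z - snd w\<bar> \<le> \<bar>fst z - fst w\<bar> \<and> \<bar>fst (G z) - fst (G w)\<bar> \<le> \<kappa> * \<bar>fst z - fst w\<bar>"
    and cone_K: "\<lbrakk>z \<in> band b r; w \<in> band b r; \<bar>snd (K z) - snd (K w)\<bar> \<le> \<bar>fst (K z) - fst (K w)\<bar>\<rbrakk>
      \<Longrightarrow> \<bar>snd z - snd w\<bar> \<le> \<bar>fst z - fst w\<bar> \<and> \<bar>fst (K z) - fst (K w)\<bar> \<le> \<kappa> * \<bar>fst z - fst w\<bar>"
    and transit_G: "\<exists>j m. (G ^^ j) z \<in> band (a + of_int m) r \<union> band (b + of_int m) r"
    and transit_K: "\<exists>j m. (K ^^ j) z \<in> band (a + of_int m) r \<union> band (b + of_int m) r"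
begin

lemma K_shift: "K (z + (of_int m, of_int l)) = K z + (of_int m, of_int l)"
  by (metis G_shift GK KG)

lemma reversed: "north_south K G k h b a r \<kappa>"
proof -
  have 1: "\<exists>j m. (K ^^ j) z \<in> band (b + of_int m) r \<union> band (a + of_int m) r" for z
    using transit_K[of z] by (simp only: Un_commute)
  have 2: "\<exists>j m. (G ^^ j) z \<in> band (b + of_int m) r \<union> band (a + of_int m) r" for z
    using transit_G[of z] by (simp only: Un_commute)
  show ?thesis
    by unfold_locales (fact GK KG cont_G cont_K K_shift h_cover k_cover r_pos r_less \<kappa>
        G_band K_band cone_G cone_K 1 2)+
qed

text \<open>This is the intersection of the images of the band under the iterates of \<open>G\<close>, written with
  backward orbits.\<close>
definition attractor :: "(real \<times> real) set" where
  "attractor = {z. \<forall>j. (K ^^ j) z \<in> band a r}"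

lemma funpow_G_shift: "(G ^^ j) (z + (of_int m, of_int l)) = (G ^^ j) z + (of_int m, of_int l)"
  by (induction j) (simp_all add: G_shift)

lemma funpow_K_shift: "(K ^^ j) (z + (of_int m, of_int l)) = (K ^^ j) z + (of_int m, of_int l)"
  by (induction j) (simp_all add: K_shift)

lemma attractor_band: "z \<in> attractor \<Longrightarrow> z \<in> band a r"
  unfolding attractor_def by (drule CollectD, drule spec[of _ 0]) simp

lemma attractor_K:
  assumes "z \<in> attractor" shows "K z \<in> attractor"
proof -
  have "(K ^^ Suc j) z \<in> band a r" for j
    using assms unfolding attractor_def by blast
  then show ?thesis by (simp add: attractor_def funpow_swap1)
qed

lemma attractor_G:
  assumes "z \<in> attractor" shows "G z \<in> attractor"
proof -
  have "(K ^^ j) (G z) \<in> band a r" for j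
  proof (cases j)
    case 0 then show ?thesis using G_band attractor_band[OF assms] by simp
  next
    case (Suc i) then show ?thesis using assms by (simp add: attractor_def funpow_swap1)
  qed
  then show ?thesis by (simp add: attractor_def)
qed

lemma attractor_shift: "z + (0, of_int l) \<in> attractor \<longleftrightarrow> z \<in> attractor"
  using funpow_K_shift[of _ z 0 l] band_shift[of _ 0 l a r] by (simp add: attractor_def)

lemma closed_attractor: "closed attractor"
proof -
  have "attractor = (\<Inter>j. (K ^^ j) -` band a r)" by (auto simp: attractor_def)
  moreover have "closed ((K ^^ j) -` band a r)" for j
    by (intro closed_vimage closed_band continuous_on_funpow cont_K)
  ultimately show ?thesis by auto
qed

lemma band_pullback:
  assumes "(K ^^ j) z \<in> band a r" "i \<le> j" shows "(K ^^ i) z \<in> band a r"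
  using assms(2,1)
proof (induction rule: inc_induct)
  case (step n)
  then have "G ((K ^^ Suc n) z) \<in> band a r" using G_band by blast
  then show ?case by simp
qed

text \<open>The cone condition makes the difference of two attractor points with the same second coordinate
  grow geometrically in backward time.\<close>
lemma attractor_unique:
  assumes z: "z \<in> attractor" and w: "w \<in> attractor" and eq: "snd z = snd w"
  shows "z = w"
proof -
  define \<Delta> where "\<Delta> j = (K ^^ j) z - (K ^^ j) w" for j
  have band: "(K ^^ j) z \<in> band a r" "(K ^^ j) w \<in> band a r" for j
    using z w by (simp_all add: attractor_def)
  have step: "\<bar>snd (\<Delta> (Suc j))\<bar> \<le> \<bar>fst (\<Delta> (Suc j))\<bar> \<and> \<bar>fst (\<Delta> j)\<bar> \<le> \<kappa> * \<bar>fst (\<Delta> (Suc j))\<bar>"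
    if "\<bar>snd (\<Delta> j)\<bar> \<le> \<bar>fst (\<Delta> j)\<bar>" for j
    using cone_G[OF band(1)[of "Suc j"] band(2)[of "Suc j"]] that by (simp add: \<Delta>_def)
  have cone: "\<bar>snd (\<Delta> j)\<bar> \<le> \<bar>fst (\<Delta> j)\<bar>" for j
    by (induction j) (use eq step in \<open>auto simp: \<Delta>_def\<close>)
  have "\<bar>fst (\<Delta> 0)\<bar> \<le> \<kappa> ^ j * \<bar>fst (\<Delta> j)\<bar>" for j
  proof (induction j)
    case (Suc j)
    have "\<kappa> ^ j * \<bar>fst (\<Delta> j)\<bar> \<le> \<kappa> ^ j * (\<kappa> * \<bar>fst (\<Delta> (Suc j))\<bar>)"
      using step[OF cone[of j]] \<kappa>(1) by (intro mult_left_mono) auto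
    with Suc show ?case by (simp add: mult_ac)
  qed simp
  moreover have "\<bar>fst (\<Delta> j)\<bar> \<le> 2 * r" for j
    using band[of j] by (auto simp: \<Delta>_def band_def)
  ultimately have "\<bar>fst (\<Delta> 0)\<bar> \<le> \<kappa> ^ j * (2 * r)" for j
    using \<kappa>(1) by (meson mult_left_mono order_trans zero_le_power)
  moreover have "(\<lambda>j. \<kappa> ^ j * (2 * r)) \<longlonglongrightarrow> 0 * (2 * r)"
    using \<kappa> by (intro tendsto_intros LIMSEQ_power_zero) simp
  ultimately have "\<bar>fst (\<Delta> 0)\<bar> \<le> 0 * (2 * r)" by (intro LIMSEQ_le_const) auto
  then show ?thesis using eq by (simp add: \<Delta>_def prod_eq_iff)
qed

text \<open>The image of the vertical line \<open>u = a\<close> under an iterate of \<open>G\<close> is a curve in the band; since \<open>G\<close>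
  commutes with vertical integer translations, its second coordinate is unbounded in both directions.\<close>
lemma band_image_level: "\<exists>z. (K ^^ j) z \<in> band a r \<and> z \<in> band a r \<and> snd z = t"
proof -
  define c where "c s = snd ((G ^^ j) (a, s))" for s
  have shift: "c (s + of_int l) = c s + of_int l" for s l
    using funpow_G_shift[of j "(a, s)" 0 l] by (simp add: c_def)
  have "continuous_on UNIV (\<lambda>s. (G ^^ j) (a, s))"
    by (intro continuous_on_compose2[OF continuous_on_funpow[OF cont_G]] continuous_intros) auto
  then have cont: "continuous_on UNIV c" unfolding c_def by (intro continuous_intros)
  have ivt: "c (of_int \<lfloor>t - c 0\<rfloor>) \<le> t" "t \<le> c (of_int \<lceil>t - c 0\<rceil>)"
    using shift[of 0 "\<lfloor>t - c 0\<rfloor>"] shift[of 0 "\<lceil>t - c 0\<rceil>"] by (simp_all, linarith+)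
  have ivt': "(of_int \<lfloor>t - c 0\<rfloor> :: real) \<le> of_int \<lceil>t - c 0\<rceil>" by simp
  have "continuous_on {of_int \<lfloor>t - c 0\<rfloor>..of_int \<lceil>t - c 0\<rceil>} c"
    by (rule continuous_on_subset[OF cont]) simp
  then obtain s where s: "c s = t" using IVT'[OF ivt ivt'] by blast
  let ?z = "(G ^^ j) (a, s)"
  have "(a, s) \<in> band a r" using r_pos by (simp add: band_def)
  then have K: "(K ^^ j) ?z \<in> band a r" by (simp add: funpow_left_inverse)
  moreover have "?z \<in> band a r" using band_pullback[OF K, of 0] by simp
  moreover have "snd ?z = t" using s by (simp add: c_def)
  ultimately show ?thesis by blast
qed

text \<open>On a fixed level the conditions on longer and longer backward orbits define nested
  non-empty compact sets.\<close>
lemma attractor_level: "\<exists>u. (u, t) \<in> attractor"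
proof -
  define S where "S j = {u \<in> {a - r..a + r}. (K ^^ j) (u, t) \<in> band a r}" for j
  have "closed ((\<lambda>u. (K ^^ j) (u, t)) -` band a r)" for j
  proof -
    have "continuous_on UNIV (\<lambda>u. (K ^^ j) (u, t))"
      by (intro continuous_on_compose2[OF continuous_on_funpow[OF cont_K]] continuous_intros) auto
    then show ?thesis by (rule closed_vimage[OF closed_band])
  qed
  then have "compact ({a - r..a + r} \<inter> (\<lambda>u. (K ^^ j) (u, t)) -` band a r)" for j
    by (intro compact_Int_closed) auto
  moreover have "S j = {a - r..a + r} \<inter> (\<lambda>u. (K ^^ j) (u, t)) -` band a r" for j
    by (auto simp: S_def)
  ultimately have "compact (S j)" for j by simp
  moreover have "S j \<noteq> {}" for j
  proof -
    obtain z where "(K ^^ j) z \<in> band a r" "z \<in> band a r" "snd z = t"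
      using band_image_level by blast
    then have "fst z \<in> S j" by (cases z) (auto simp: S_def band_def)
    then show ?thesis by blast
  qed
  moreover have "S j \<subseteq> S i" if "i \<le> j" for i j
    using band_pullback that by (auto simp: S_def)
  ultimately have "\<Inter> (range S) \<noteq> {}" by (rule compact_nest)
  then show ?thesis by (auto simp: S_def attractor_def)
qed

definition profile :: "real \<Rightarrow> real" where
  "profile t = (THE u. (u, t) \<in> attractor)"

lemma mem_attractor_iff: "z \<in> attractor \<longleftrightarrow> fst z = profile (snd z)"
proof -
  have ex1: "\<exists>!u. (u, t) \<in> attractor" for t
  proof -
    obtain u where "(u, t) \<in> attractor" using attractor_level by blast
    moreover have "v = u" if "(v, t) \<in> attractor" for v
      using attractor_unique[OF that \<open>(u, t) \<in> attractor\<close>] by simp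
    ultimately show ?thesis by blast
  qed
  obtain u t where z: "z = (u, t)" by fastforce
  show ?thesis
    unfolding z fst_conv snd_conv profile_def
    using ex1[of t] theI'[OF ex1[of t]] by blast
qed

lemma profile_attractor: "(profile t, t) \<in> attractor"
  by (simp add: mem_attractor_iff)

text \<open>A bounded function with closed graph is continuous.\<close>
lemma continuous_on_profile: "continuous_on UNIV profile"
proof -
  show ?thesis
  proof (rule continuous_from_closed_graph)
    show "compact {a - r..a + r}" by simp
    have "a - r \<le> profile t \<and> profile t \<le> a + r" for t
      using attractor_band[OF profile_attractor[of t]] unfolding band_def mem_Collect_eq fst_conv
      by linarith
    then show "profile \<in> UNIV \<rightarrow> {a - r..a + r}" by auto
    have "(\<lambda>t. (t, profile t)) ` UNIV = (\<lambda>z. (snd z, fst z)) -` attractor"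
      by (auto simp: mem_attractor_iff)
    moreover have "closed ((\<lambda>z. (snd z, fst z)) -` attractor)"
      by (intro closed_vimage closed_attractor continuous_intros)
    ultimately show "closed ((\<lambda>t. (t, profile t)) ` UNIV)" by simp
  qed
qed

lemma profile_shift: "profile (t + of_int l) = profile t"
  using attractor_shift[of "(profile t, t)" l] profile_attractor by (simp add: mem_attractor_iff)

definition attracting_circle :: "torus set" where
  "attracting_circle = torus_cover ` attractor"

lemma compact_attracting_circle: "compact attracting_circle"
proof -
  have "attracting_circle = torus_cover ` (\<lambda>t. (profile t, t)) ` {0..1}"
  proof -
    have "torus_cover z \<in> torus_cover ` (\<lambda>t. (profile t, t)) ` {0..1}" if "z \<in> attractor" for z
    proof -
      let ?t = "snd z - of_int \<lfloor>snd z\<rfloor>"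
      have "z = (profile ?t, ?t) + (of_int 0, of_int \<lfloor>snd z\<rfloor>)"
        using that profile_shift[of ?t "\<lfloor>snd z\<rfloor>"] by (simp add: mem_attractor_iff prod_eq_iff)
      from arg_cong[OF this, of torus_cover] have "torus_cover z = torus_cover (profile ?t, ?t)"
        by (simp only: torus_cover_shift)
      moreover have "?t \<in> {0..1}" by (simp, linarith)
      ultimately show ?thesis by blast
    qed
    then show ?thesis using profile_attractor by (auto simp: attracting_circle_def)
  qed
  moreover have "continuous_on {0..1} (\<lambda>t. (profile t, t))"
    by (intro continuous_intros continuous_on_subset[OF continuous_on_profile]) auto
  then have "compact (torus_cover ` (\<lambda>t. (profile t, t)) ` {0..1})"
    by (intro compact_continuous_image continuous_on_subset[OF continuous_on_torus_cover]) auto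
  ultimately show ?thesis by simp
qed

text \<open>The attracting circle is parametrized by the inverse of this projection, whose continuity is a matter of
  compactness.\<close>
lemma bij_snd_attracting_circle: "bij_betw snd attracting_circle UNIV"
  unfolding bij_betw_def
proof (intro conjI inj_onI)
  fix p q assume "p \<in> attracting_circle" "q \<in> attracting_circle" and eq: "snd p = snd q"
  then obtain z w where zw: "p = torus_cover z" "q = torus_cover w" "z \<in> attractor" "w \<in> attractor"
    by (auto simp: attracting_circle_def)
  then have "snd z - snd w \<in> \<int>" using eq by (simp add: torus_cover_def abs_circle_eq_iff)
  then obtain l where l: "snd z = snd w + of_int l" by (metis Ints_cases add.commute diff_add_cancel)
  then have "z = w + (of_int 0, of_int l)"
    using zw(3,4) by (simp add: mem_attractor_iff profile_shift prod_eq_iff)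
  then show "p = q" using zw torus_cover_shift by metis
next
  have "\<theta> \<in> snd ` attracting_circle" for \<theta>
  proof -
    have "\<exists>t. \<theta> = abs_circle t" by (induct \<theta> rule: circle.abs_induct) blast
    then obtain t where "\<theta> = abs_circle t" ..
    then have "\<theta> = snd (torus_cover (profile t, t))" by (simp add: torus_cover_def)
    then show ?thesis using profile_attractor by (auto simp: attracting_circle_def)
  qed
  then show "snd ` attracting_circle = UNIV" by blast
qed

lemma close_circle_attracting_circle:
  assumes "2 * pi * r < \<epsilon>" shows "close_circle \<epsilon> (rp_cover a) attracting_circle"
  unfolding close_circle_def
proof (intro exI conjI allI)
  define \<gamma> where "\<gamma> = inv_into attracting_circle snd"
  have bij: "bij_betw \<gamma> UNIV attracting_circle" unfolding \<gamma>_def by (rule bij_betw_inv_into[OF bij_snd_attracting_circle])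
  then show range: "range \<gamma> = attracting_circle" by (simp add: bij_betw_def)
  have "continuous_on attracting_circle (snd :: torus \<Rightarrow> circle)" by (intro continuous_intros)
  then have cont: "continuous_on (snd ` attracting_circle) \<gamma>"
    using bij_snd_attracting_circle
    by (intro continuous_on_inv compact_attracting_circle) (auto simp: \<gamma>_def bij_betw_def)
  have snd_circle: "snd ` attracting_circle = UNIV" using bij_snd_attracting_circle by (simp add: bij_betw_def)
  have "compact (UNIV :: circle set)"
    using compact_continuous_image[OF \<open>continuous_on attracting_circle snd\<close> compact_attracting_circle] snd_circle by simp
  then show "embedding_map euclidean euclidean \<gamma>"
    using cont bij unfolding snd_circle
    by (intro continuous_imp_embedding_map) (auto simp: bij_betw_def compact_space_def)
  fix \<theta>
  have "\<gamma> \<theta> \<in> attracting_circle" using range by blast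
  then obtain z where z: "\<gamma> \<theta> = torus_cover z" "z \<in> attractor" by (auto simp: attracting_circle_def)
  have "snd (\<gamma> \<theta>) = \<theta>" unfolding \<gamma>_def by (rule f_inv_into_f) (simp add: snd_circle)
  then have "\<gamma> \<theta> = (rp_cover (fst z), \<theta>)" using z(1) by (simp add: torus_cover_def prod_eq_iff)
  then have "dist (\<gamma> \<theta>) (rp_cover a, \<theta>) = dist (cis (2 * pi * fst z)) (cis (2 * pi * a))"
    by (simp add: dist_prod_def dist_rp_cover)
  also have "\<dots> \<le> \<bar>2 * pi * (fst z - a)\<bar>" using dist_cis_le[of "2 * pi * fst z" "2 * pi * a"]
    by (simp add: right_diff_distrib)
  also have "\<dots> \<le> 2 * pi * r" using attractor_band[OF z(2)] by (simp add: band_def abs_mult)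
  finally show "dist (\<gamma> \<theta>) (rp_cover a, \<theta>) < \<epsilon>" using assms by simp
qed

lemma image_attracting_circle: "h ` attracting_circle = attracting_circle"
proof
  show "h ` attracting_circle \<subseteq> attracting_circle" using attractor_G by (auto simp: attracting_circle_def h_cover)
  show "attracting_circle \<subseteq> h ` attracting_circle"
  proof
    fix p assume "p \<in> attracting_circle"
    then obtain z where z: "p = torus_cover z" "z \<in> attractor" by (auto simp: attracting_circle_def)
    then have "p = h (torus_cover (K z))" by (simp add: h_cover)
    then show "p \<in> h ` attracting_circle" using attractor_K[OF z(2)] by (auto simp: attracting_circle_def)
  qed
qed

text \<open>The attracting circle of the reversed situation, written out.\<close>
definition repelling_circle :: "torus set" where
  "repelling_circle = torus_cover ` {z. \<forall>j. (G ^^ j) z \<in> band b r}"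

text \<open>Bands around different integer translates of \<open>b\<close> are disjoint and negatively invariant, so an
  orbit that visits them again and again has always been in one and the same of them.\<close>
lemma enters_band:
  assumes p: "p \<notin> repelling_circle"
  shows "\<exists>j z. (h ^^ j) p = torus_cover z \<and> z \<in> band a r"
proof (rule ccontr)
  assume *: "\<not> ?thesis"
  obtain z where z: "p = torus_cover z" using torus_cover_surj by blast
  have orb: "(h ^^ j) p = torus_cover ((G ^^ j) z)" for j
    unfolding z by (rule funpow_semiconj) (rule h_cover)
  have not_a: "(G ^^ j) z \<notin> band (a + of_int m) r" for j m
  proof
    assume "(G ^^ j) z \<in> band (a + of_int m) r"
    then have "(G ^^ j) z + (of_int (-m), of_int 0) \<in> band a r" by (simp add: band_def)
    moreover have "(h ^^ j) p = torus_cover ((G ^^ j) z + (of_int (-m), of_int 0))"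
      by (simp only: orb torus_cover_shift)
    ultimately show False using * by blast
  qed
  have K_band_m: "K w \<in> band (b + of_int m) r" if "w \<in> band (b + of_int m) r" for w m
  proof -
    have "w + (of_int (-m), of_int 0) \<in> band b r" using that by (simp add: band_def)
    from K_band[OF this] have "K w + (of_int (-m), of_int 0) \<in> band b r" by (simp only: K_shift)
    then show ?thesis by (simp add: band_def)
  qed
  have pull: "(G ^^ i) z \<in> band (b + of_int m) r" if "(G ^^ j) z \<in> band (b + of_int m) r" "i \<le> j" for i j m
    using that(2,1)
  proof (induction rule: inc_induct)
    case (step n)
    then have "K ((G ^^ Suc n) z) \<in> band (b + of_int m) r" using K_band_m by blast
    then show ?case by simp
  qed
  have "\<exists>m. (G ^^ j) z \<in> band (b + of_int m) r" for j
  proof -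
    obtain i m where "(G ^^ i) ((G ^^ j) z) \<in> band (b + of_int m) r"
    proof -
      obtain i m where "(G ^^ i) ((G ^^ j) z) \<in> band (a + of_int m) r \<union> band (b + of_int m) r"
        using transit_G by blast
      moreover have "(G ^^ i) ((G ^^ j) z) \<notin> band (a + of_int m) r"
        using not_a[of "i + j" m] by (simp add: funpow_add)
      ultimately show thesis using that by blast
    qed
    then have "(G ^^ (i + j)) z \<in> band (b + of_int m) r" by (simp add: funpow_add)
    then have "(G ^^ j) z \<in> band (b + of_int m) r" by (rule pull) simp
    then show ?thesis ..
  qed
  then obtain m where m: "\<And>j. (G ^^ j) z \<in> band (b + of_int (m j)) r" by metis
  have m0: "m j = m 0" for j
  proof -
    have "(G ^^ 0) z \<in> band (b + of_int (m j)) r" "(G ^^ 0) z \<in> band (b + of_int (m 0)) r"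
      using pull[OF m[of j], of 0] m[of 0] by auto
    then have "\<bar>of_int (m j - m 0) :: real\<bar> < 1" using r_less by (auto simp: band_def)
    then show ?thesis by linarith
  qed
  have "(G ^^ j) (z + (of_int (- m 0), of_int 0)) \<in> band b r" for j
    unfolding funpow_G_shift using m[of j, unfolded m0[of j]] by (simp add: band_def algebra_simps)
  then have "torus_cover (z + (of_int (- m 0), of_int 0)) \<in> repelling_circle"
    unfolding repelling_circle_def by blast
  then have "torus_cover z \<in> repelling_circle" by (simp only: torus_cover_shift)
  then show False using p z by simp
qed

text \<open>After entering the band at time \<open>j0\<close>, the orbit lies at all times from \<open>j0 + j\<close> on in the image of the
  band under the iterate \<open>G\<^sup>j\<close>, whose projection to the torus is compact. A limit point \<open>y\<close> lies in all
  of these projections. The band is narrower than a period, so the preimages of \<open>y\<close> in it differ by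
  vertical translations only, and one of them serves for all \<open>j\<close>.\<close>
lemma omega_limit_subset:
  assumes p: "p \<notin> repelling_circle" shows "omega_limit h p \<subseteq> attracting_circle"
proof
  fix y assume "y \<in> omega_limit h p"
  then obtain s :: "nat \<Rightarrow> nat" where s: "strict_mono s" "(\<lambda>i. (h ^^ s i) p) \<longlonglongrightarrow> y"
    by (auto simp: omega_limit_def)
  obtain j0 z where z: "(h ^^ j0) p = torus_cover z" "z \<in> band a r" using enters_band[OF p] by blast
  define S where "S j = {w \<in> band a r. (K ^^ j) w \<in> band a r}" for j
  have S_shift: "w + (0, of_int l) \<in> S j \<longleftrightarrow> w \<in> S j" for w l j
    using funpow_K_shift[of j w 0 l] band_shift[of _ 0 l a r] by (simp add: S_def)
  have closed: "closed (torus_cover ` S j)" for j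
  proof -
    let ?B = "{a - r..a + r} \<times> {0..1::real}"
    have "torus_cover ` S j = torus_cover ` (?B \<inter> (K ^^ j) -` band a r)"
    proof -
      have "torus_cover w \<in> torus_cover ` (?B \<inter> (K ^^ j) -` band a r)" if "w \<in> S j" for w
      proof -
        let ?w = "w + (0, of_int (- \<lfloor>snd w\<rfloor>))"
        have "?w \<in> S j" using that S_shift by blast
        moreover have "snd ?w \<in> {0..1}" by (simp, linarith)
        moreover have "fst ?w \<in> {a - r..a + r}"
          using \<open>?w \<in> S j\<close> by (simp add: S_def band_def) linarith
        ultimately have "?w \<in> ?B \<inter> (K ^^ j) -` band a r"
          by (simp add: S_def mem_Times_iff)
        moreover have "torus_cover ?w = torus_cover w" using torus_cover_shift[of w 0 "- \<lfloor>snd w\<rfloor>"] by simp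
        ultimately show ?thesis by (intro image_eqI[of _ _ ?w]) simp_all
      qed
      moreover have "?B \<inter> (K ^^ j) -` band a r \<subseteq> S j" by (auto simp: S_def band_def abs_le_iff)
      ultimately show ?thesis by blast
    qed
    moreover have "compact (?B \<inter> (K ^^ j) -` band a r)"
      by (intro compact_Int_closed compact_Times compact_Icc closed_vimage closed_band
          continuous_on_funpow cont_K)
    ultimately show ?thesis
      by (simp add: compact_continuous_image compact_imp_closed continuous_on_subset[OF continuous_on_torus_cover])
  qed
  have "y \<in> torus_cover ` S j" for j
  proof (rule Lim_in_closed_set[OF closed _ _ s(2)])
    show "\<forall>\<^sub>F i in sequentially. (h ^^ s i) p \<in> torus_cover ` S j"
      unfolding eventually_sequentially
    proof (intro exI allI impI)
      fix i assume "j0 + j \<le> i"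
      then have "j0 + j \<le> s i" using seq_suble[OF s(1), of i] by linarith
      then obtain d where d: "s i = d + j + j0" by (metis add.assoc add.commute le_iff_add)
      have G_in: "(G ^^ i) w \<in> band a r" if "w \<in> band a r" for w i
        using that G_band by (induction i) auto
      let ?w = "(G ^^ j) ((G ^^ d) z)"
      have "(h ^^ s i) p = (h ^^ (j + d)) ((h ^^ j0) p)" 
        by (simp only: d add.commute[of d j] funpow_add comp_apply)
      also have "\<dots> = torus_cover ?w"
        unfolding z(1) using funpow_semiconj[of h torus_cover G "j + d", OF h_cover] by (simp add: funpow_add)
      finally have "(h ^^ s i) p = torus_cover ?w" .
      moreover have "?w \<in> S j"
        using G_in z(2) by (simp add: S_def funpow_left_inverse)
      ultimately show "(h ^^ s i) p \<in> torus_cover ` S j" by blast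
    qed
  qed simp
  then have "\<forall>j. \<exists>w. w \<in> S j \<and> y = torus_cover w" by blast
  then obtain w where w: "\<And>j. w j \<in> S j" "\<And>j. y = torus_cover (w j)" by metis
  have "w 0 \<in> S j" for j
  proof -
    obtain m l where ml: "w 0 = w j + (of_int m, of_int l)" 
      using w(2)[of 0] w(2)[of j] torus_cover_eq_iff[of "w 0" "w j"] by auto
    moreover have "w 0 \<in> band a r" "w j \<in> band a r" using w(1) by (auto simp: S_def)
    ultimately have "\<bar>of_int m :: real\<bar> < 1" using r_less by (auto simp: band_def)
    then have "m = 0" by linarith
    then show ?thesis using ml w(1)[of j] S_shift by simp
  qed
  then have "w 0 \<in> attractor" by (simp add: S_def attractor_def)
  then show "y \<in> attracting_circle" using w(2)[of 0] by (auto simp: attracting_circle_def)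
qed

end


section \<open>Displacement of a map that is close to the identity\<close>

text \<open>
  As long as the orbit of \<open>z\<close> stays within distance \<open>2 n |X z|\<close>, the displacement varies by at most
  \<open>2 n \<sigma> |X z| \<le> |X z|\<close>. So each step is at most \<open>2 |X z|\<close> long, which keeps the orbit within that
  distance, and the errors add up linearly.
\<close>
lemma displacement_funpow:
  fixes F :: "'a::real_normed_vector \<Rightarrow> 'a"
  defines "X \<equiv> \<lambda>z. F z - z"
  assumes \<sigma>: "0 \<le> \<sigma>" "2 * real n * \<sigma> \<le> 1"
    and lip: "\<And>w. norm (w - z) \<le> 2 * real n * norm (X z) \<Longrightarrow> norm (X w - X z) \<le> \<sigma> * norm (w - z)"
    and "i \<le> n"
  shows "norm ((F ^^ i) z - z) \<le> 2 * real i * norm (X z)"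
    "norm ((F ^^ i) z - z - real i *\<^sub>R X z) \<le> real i * (2 * real n * \<sigma>) * norm (X z)"
proof -
  have "norm ((F ^^ i) z - z) \<le> 2 * real i * norm (X z) \<and>
    norm ((F ^^ i) z - z - real i *\<^sub>R X z) \<le> real i * (2 * real n * \<sigma>) * norm (X z)"
    using \<open>i \<le> n\<close>
  proof (induction i)
    case (Suc i)
    let ?w = "(F ^^ i) z" and ?N = "norm (X z)"
    have IH: "norm (?w - z) \<le> 2 * real i * ?N"
      "norm (?w - z - real i *\<^sub>R X z) \<le> real i * (2 * real n * \<sigma>) * ?N"
      using Suc by auto
    have "2 * real i * ?N \<le> 2 * real n * ?N" using Suc.prems by (intro mult_right_mono) auto
    then have w: "norm (?w - z) \<le> 2 * real n * ?N" using IH(1) by simp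
    have "norm (X ?w - X z) \<le> \<sigma> * norm (?w - z)" by (rule lip[OF w])
    also have "\<dots> \<le> \<sigma> * (2 * real n * ?N)" using w \<sigma>(1) by (rule mult_left_mono)
    also have "\<dots> = (2 * real n * \<sigma>) * ?N" by simp
    finally have d: "norm (X ?w - X z) \<le> (2 * real n * \<sigma>) * ?N" .
    have "(2 * real n * \<sigma>) * ?N \<le> 1 * ?N" using \<sigma>(2) by (intro mult_right_mono) auto
    then have d1: "norm (X ?w - X z) \<le> ?N" using d by simp
    have e1: "(F ^^ Suc i) z - z = (?w - z) + X z + (X ?w - X z)" by (simp add: X_def)
    have e2: "(F ^^ Suc i) z - z - real (Suc i) *\<^sub>R X z = (?w - z - real i *\<^sub>R X z) + (X ?w - X z)"
      by (simp add: X_def algebra_simps)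
    have "norm ((F ^^ Suc i) z - z) \<le> 2 * real i * ?N + ?N + ?N"
      unfolding e1 by (intro norm_triangle_le add_mono IH(1) d1 order_refl)
    moreover have "norm ((F ^^ Suc i) z - z - real (Suc i) *\<^sub>R X z)
        \<le> real i * (2 * real n * \<sigma>) * ?N + (2 * real n * \<sigma>) * ?N"
      unfolding e2 by (intro norm_triangle_le add_mono IH(2) d)
    ultimately show ?case by (simp add: algebra_simps)
  qed simp
  then show "norm ((F ^^ i) z - z) \<le> 2 * real i * norm (X z)"
    "norm ((F ^^ i) z - z - real i *\<^sub>R X z) \<le> real i * (2 * real n * \<sigma>) * norm (X z)" by auto
qed

text \<open>
  The displacement of \<open>F\<^sup>n\<close> at \<open>G z\<close> equals \<open>G (F z) - G z\<close>, of length at most \<open>5/4 |X z|\<close>; it is also at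
  least \<open>(n - 1/4) |X (G z)|\<close>. For \<open>n \<ge> 2\<close> the quotient \<open>(5/4) / (7/4)\<close> is less than \<open>3/4\<close>.
\<close>
lemma displacement_contracts:
  fixes F G :: "'a::real_normed_vector \<Rightarrow> 'a"
  assumes n: "n \<ge> 2" and \<sigma>: "0 \<le> \<sigma>" "8 * (real n)\<^sup>2 * \<sigma> \<le> 1"
    and lip: "\<And>w. norm (w - G z) \<le> 2 * real n * norm (F (G z) - G z) \<Longrightarrow>
       norm ((F w - w) - (F (G z) - G z)) \<le> \<sigma> * norm (w - G z)"
    and rel: "G (F z) = (F ^^ n) (G z)"
    and lipG: "norm (G (F z) - G z) \<le> 5/4 * norm (F z - z)"
  shows "norm (F (G z) - G z) \<le> 3/4 * norm (F z - z)"
proof -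
  let ?X = "F (G z) - G z"
  have n\<sigma>: "8 * (real n * real n * \<sigma>) \<le> 1" using \<sigma>(2) by (simp add: power2_eq_square)
  have "1 * (real n * \<sigma>) \<le> real n * (real n * \<sigma>)"
    using n \<sigma>(1) by (intro mult_right_mono) auto
  then have "2 * real n * \<sigma> \<le> 1" using n\<sigma> by simp
  then have "norm ((F ^^ n) (G z) - G z - real n *\<^sub>R ?X) \<le> real n * (2 * real n * \<sigma>) * norm ?X"
    using displacement_funpow(2)[of \<sigma> n "G z" F n] \<sigma>(1) lip by blast
  also have "\<dots> \<le> 1/4 * norm ?X" using n\<sigma> by (intro mult_right_mono) auto
  finally have "norm (real n *\<^sub>R ?X) \<le> norm ((F ^^ n) (G z) - G z) + 1/4 * norm ?X"
    using norm_triangle_ineq2[of "real n *\<^sub>R ?X" "(F ^^ n) (G z) - G z"]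
    by (simp add: norm_minus_commute)
  also have "\<dots> \<le> 5/4 * norm (F z - z) + 1/4 * norm ?X" using lipG rel by simp
  finally have "real n * norm ?X \<le> 5/4 * norm (F z - z) + 1/4 * norm ?X" by simp
  moreover have "2 * norm ?X \<le> real n * norm ?X" using n by (intro mult_right_mono) auto
  ultimately show ?thesis using norm_ge_zero[of ?X] norm_ge_zero[of "F z - z"] by linarith
qed

section \<open>The group generated by two bijections\<close>

lemma carrier_BijGroup_UNIV: "carrier (BijGroup UNIV) = {f. bij f}"
  by (auto simp: BijGroup_def Bij_def extensional_def)

lemma mult_BijGroup_UNIV: "bij f \<Longrightarrow> bij g \<Longrightarrow> f \<otimes>\<^bsub>BijGroup UNIV\<^esub> g = f \<circ> g"
  by (auto simp: BijGroup_def Bij_def extensional_def compose_def restrict_def fun_eq_iff)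

lemma inv_BijGroup_UNIV:
  assumes "bij f" shows "inv\<^bsub>BijGroup UNIV\<^esub> f = inv_into UNIV f"
proof -
  interpret group "BijGroup UNIV" by (rule group_BijGroup)
  have bi: "bij (inv_into UNIV f)" using assms by (rule bij_imp_bij_inv)
  show ?thesis
  proof (rule inv_equality)
    show "inv_into UNIV f \<otimes>\<^bsub>BijGroup UNIV\<^esub> f = \<one>\<^bsub>BijGroup UNIV\<^esub>"
      using assms by (simp add: mult_BijGroup_UNIV[OF bi assms] bij_is_inj)
        (simp add: BijGroup_def restrict_def fun_eq_iff)
  qed (use assms bi in \<open>simp_all add: carrier_BijGroup_UNIV\<close>)
qed

lemma invariant_action_group:
  assumes "bij f" "bij h"
  shows "invariant_set (action_group f h) (\<lambda>g. g) S \<longleftrightarrow> f ` S = S \<and> h ` S = S"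
proof
  have fh: "carrier (BijGroup UNIV) \<inter> {f, h} = {f, h}"
    using assms by (auto simp: carrier_BijGroup_UNIV)
  then have car: "carrier (action_group f h) = generate (BijGroup UNIV) {f, h}"
    by (simp add: action_group_def carrier_subgroup_generated)
  {
    assume "invariant_set (action_group f h) (\<lambda>g. g) S"
    then show "f ` S = S \<and> h ` S = S"
      unfolding invariant_set_def car using generate.incl[of _ "{f, h}" "BijGroup UNIV"] by blast
  next
    assume inv: "f ` S = S \<and> h ` S = S"
    have "bij g \<and> g ` S = S" if "g \<in> generate (BijGroup UNIV) {f, h}" for g
      using that
    proof (induction rule: generate.induct)
      case one show ?case by (simp add: BijGroup_def bij_id[unfolded id_def])
    next
      case (incl g) then show ?case using assms inv by auto
    next
      case (inv g)
      then have g: "bij g" "g ` S = S" using assms \<open>f ` S = S \<and> h ` S = S\<close> by auto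
      have "inv_into UNIV g ` g ` S = S"
        using bij_is_inj[OF g(1)] by (simp add: image_comp)
      then show ?case using g by (simp add: inv_BijGroup_UNIV bij_imp_bij_inv)
    next
      case (eng g1 g2)
      then have "bij (g1 \<circ> g2)" "(g1 \<circ> g2) ` S = S"
        by (simp add: bij_comp, simp only: image_comp[symmetric])
      then show ?case using eng by (simp only: mult_BijGroup_UNIV)
    qed
    then show "invariant_set (action_group f h) (\<lambda>g. g) S"
      unfolding invariant_set_def car by blast
  }
qed

lemma orbit_subset_invariant:
  assumes "invariant_set G (\<lambda>g. g) S" "p \<in> S" shows "orbit G (\<lambda>g. g) p \<subseteq> S"
  using assms unfolding orbit_def invariant_set_def by blast


section \<open>Limit sets on the torus\<close>

text \<open>Preimages of closed sets are projections of closed subsets of a fundamental square, hence compact.\<close>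
lemma continuous_from_lift:
  assumes F: "continuous_on UNIV F" and f: "\<And>z. f (torus_cover z) = torus_cover (F z)"
  shows "continuous_on UNIV f"
proof -
  have "closed (f -` C)" if C: "closed C" for C :: "torus set"
  proof -
    let ?Q = "{0..1::real} \<times> {0..1::real}"
    have "f -` C = torus_cover ` (?Q \<inter> (\<lambda>z. torus_cover (F z)) -` C)"
    proof
      show "f -` C \<subseteq> torus_cover ` (?Q \<inter> (\<lambda>z. torus_cover (F z)) -` C)"
      proof
        fix p assume "p \<in> f -` C"
        moreover obtain u t where "p = torus_cover (u, t)" "0 \<le> u" "u < 1" "0 \<le> t" "t < 1"
          by (rule torus_cover_surj_unit)
        ultimately show "p \<in> torus_cover ` (?Q \<inter> (\<lambda>z. torus_cover (F z)) -` C)"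
          using f by (intro image_eqI[of _ _ "(u, t)"]) auto
      qed
    qed (use f in auto)
    moreover have "continuous_on UNIV (\<lambda>z. torus_cover (F z))"
      by (intro continuous_on_compose2[OF continuous_on_torus_cover F]) simp
    then have "compact (?Q \<inter> (\<lambda>z. torus_cover (F z)) -` C)"
      by (intro compact_Int_closed compact_Times compact_Icc closed_vimage C)
    then have "closed (torus_cover ` (?Q \<inter> (\<lambda>z. torus_cover (F z)) -` C))"
      by (intro compact_imp_closed compact_continuous_image continuous_on_subset[OF continuous_on_torus_cover]) auto
    ultimately show ?thesis by simp
  qed
  then show ?thesis by (simp add: continuous_on_closed_vimage[OF closed_UNIV])
qed

lemma omega_limit_nonempty:
  fixes h :: "torus \<Rightarrow> torus" shows "omega_limit h p \<noteq> {}"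
proof -
  have "\<forall>j. (h ^^ j) p \<in> (UNIV :: torus set)" by simp
  then obtain y and s :: "nat \<Rightarrow> nat" where "strict_mono s" "((\<lambda>j. (h ^^ j) p) \<circ> s) \<longlonglongrightarrow> y"
    using compact_torus unfolding compact_def by metis
  then have "y \<in> omega_limit h p" unfolding omega_limit_def by (auto simp: o_def)
  then show ?thesis by blast
qed

lemma omega_limit_closed_subset:
  assumes S: "closed S" "\<And>q. q \<in> S \<Longrightarrow> h q \<in> S" and p: "p \<in> S"
  shows "omega_limit h p \<subseteq> S"
proof
  fix y assume "y \<in> omega_limit h p"
  then obtain s :: "nat \<Rightarrow> nat" where s: "(\<lambda>i. (h ^^ s i) p) \<longlonglongrightarrow> y"
    by (auto simp: omega_limit_def)
  have "(h ^^ i) p \<in> S" for i by (induction i) (use S(2) p in auto)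
  then show "y \<in> S" by (intro Lim_in_closed_set[OF S(1) _ _ s]) auto
qed

section \<open>Fixed points of the translation\<close>

text \<open>
  Closeness of \<open>f\<close> to the translation enters through three properties: the displacement of its lift
  \<open>F\<close> is contracted along \<open>G\<close>-orbits in the attracting band; it is so small there that \<open>F\<close> fixes the
  points over a fixed point of \<open>f\<close>, instead of moving them by a deck transformation; and \<open>f\<close> moves
  the repelling band off itself.
\<close>
locale perturbed_action = north_south +
  fixes F :: "real \<times> real \<Rightarrow> real \<times> real" and f :: "torus \<Rightarrow> torus" and n :: nat
  assumes bij_f: "bij f" and cont_F: "continuous_on UNIV F"
    and f_cover: "f (torus_cover z) = torus_cover (F z)"
    and relation: "h (f p) = (f ^^ n) (h p)"
    and contraction: "z \<in> band a r \<Longrightarrow> norm (F (G z) - G z) \<le> 3/4 * norm (F z - z)"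
    and small: "z \<in> band a r \<Longrightarrow> norm (F z - z) < 1/2"
    and moves: "z \<in> band b r \<Longrightarrow> f (torus_cover z) \<notin> torus_cover ` band b r"
begin

sublocale rev: north_south K G k h b a r \<kappa> by (rule reversed)

lemma repelling_circle_eq: "repelling_circle = rev.attracting_circle"
  by (simp add: repelling_circle_def rev.attracting_circle_def rev.attractor_def)

lemma rev_repelling_circle_eq: "rev.repelling_circle = attracting_circle"
  by (simp add: attracting_circle_def rev.repelling_circle_def attractor_def)

lemma cont_f: "continuous_on UNIV f" by (rule continuous_from_lift[OF cont_F f_cover])

lemma hk [simp]: "h (k p) = p" and kh [simp]: "k (h p) = p"
  using torus_cover_surj[of p] by (auto simp: h_cover k_cover)

lemma bij_h: "bij h" by (rule o_bij[of k]) auto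

lemma invariant_fixed: assumes "S \<subseteq> fix_set f" shows "f ` S = S"
proof -
  have "f ` S = id ` S" by (rule image_cong) (use assms in \<open>auto simp: fix_set_def\<close>)
  then show ?thesis by simp
qed

lemma closed_fix: "closed (fix_set f)"
  unfolding fix_set_def by (intro closed_Collect_eq cont_f continuous_on_id)

text \<open>If \<open>f p = p\<close>, then \<open>h (f (k p)) = f\<^sup>n (h (k p)) = f\<^sup>n p = p\<close>.\<close>
lemma fix_k: assumes "p \<in> fix_set f" shows "k p \<in> fix_set f"
proof -
  have "(f ^^ i) p = p" for i
    using assms by (induction i) (simp_all add: fix_set_def)
  then have "h (f (k p)) = p" by (simp add: relation)
  then have "k (h (f (k p))) = k p" by simp
  then show ?thesis by (simp add: fix_set_def)
qed

lemma moves_repelling_circle: assumes "p \<in> repelling_circle" shows "f p \<notin> repelling_circle"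
proof -
  obtain z where "p = torus_cover z" "z \<in> rev.attractor"
    using assms unfolding repelling_circle_eq rev.attracting_circle_def by blast
  then have "f p \<notin> torus_cover ` band b r" using moves rev.attractor_band by blast
  then show ?thesis unfolding repelling_circle_eq rev.attracting_circle_def using rev.attractor_band by blast
qed

text \<open>Otherwise the \<open>\<alpha>\<close>-limit set would contain a fixed point on the repelling circle.\<close>
lemma fix_subset_circle: "fix_set f \<subseteq> attracting_circle"
proof (rule subsetI, rule ccontr)
  fix p assume p: "p \<in> fix_set f" "p \<notin> attracting_circle"
  obtain y where y: "y \<in> omega_limit k p" using omega_limit_nonempty by blast
  have "y \<in> repelling_circle"
    using rev.omega_limit_subset[of p] p(2) y unfolding repelling_circle_eq rev_repelling_circle_eq by blast
  moreover have "y \<in> fix_set f"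
    using omega_limit_closed_subset[of "fix_set f" k p, OF closed_fix fix_k p(1)] y by blast
  ultimately show False using moves_repelling_circle[of y] by (simp add: fix_set_def)
qed

text \<open>The displacement decays geometrically along the orbit, so it vanishes at the limit points.\<close>
lemma omega_limit_fix_band:
  assumes z: "(h ^^ j0) p = torus_cover z" "z \<in> band a r"
  shows "omega_limit h p \<subseteq> fix_set f"
proof
  fix y assume "y \<in> omega_limit h p"
  then obtain s :: "nat \<Rightarrow> nat" where s: "strict_mono s" "(\<lambda>i. (h ^^ s i) p) \<longlonglongrightarrow> y"
    by (auto simp: omega_limit_def)
  define w where "w i = (G ^^ i) z" for i
  have band: "w i \<in> band a r" for i by (induction i) (use z(2) G_band in \<open>auto simp: w_def\<close>)
  have X: "norm (F (w i) - w i) \<le> (3/4) ^ i * norm (F z - z)" for i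
  proof (induction i)
    case (Suc i)
    have "norm (F (w (Suc i)) - w (Suc i)) \<le> 3/4 * norm (F (w i) - w i)"
      using contraction[OF band[of i]] by (simp add: w_def)
    then show ?case using Suc by simp
  qed (simp add: w_def)
  have orb: "(h ^^ (i + j0)) p = torus_cover (w i)" for i
    unfolding w_def funpow_add comp_apply z(1) by (rule funpow_semiconj) (rule h_cover)
  have d: "dist (f ((h ^^ (i + j0)) p)) ((h ^^ (i + j0)) p) \<le> 4 * pi * ((3/4) ^ i * norm (F z - z))" for i
    unfolding orb f_cover
    by (rule order_trans[OF dist_torus_cover]) (use X[of i] in simp)
  have "(\<lambda>i. 4 * pi * ((3/4) ^ i * norm (F z - z))) \<longlonglongrightarrow> 4 * pi * (0 * norm (F z - z))"
    by (intro tendsto_intros LIMSEQ_power_zero) simp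
  then have lim0: "(\<lambda>i. 4 * pi * ((3/4) ^ i * norm (F z - z))) \<longlonglongrightarrow> 0" by simp
  have "\<forall>\<^sub>F i in sequentially. norm (dist (f ((h ^^ (i + j0)) p)) ((h ^^ (i + j0)) p))
      \<le> 4 * pi * ((3/4) ^ i * norm (F z - z))"
    using d by (intro always_eventually allI) (simp only: real_norm_def abs_of_nonneg[OF zero_le_dist])
  then have "(\<lambda>i. dist (f ((h ^^ (i + j0)) p)) ((h ^^ (i + j0)) p)) \<longlonglongrightarrow> 0"
    using lim0 by (rule Lim_null_comparison)
  then have "(\<lambda>i. dist (f ((h ^^ i) p)) ((h ^^ i) p)) \<longlonglongrightarrow> 0"
    by (rule LIMSEQ_offset)
  then have "(\<lambda>i. dist (f ((h ^^ s i) p)) ((h ^^ s i) p)) \<longlonglongrightarrow> 0"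
    using LIMSEQ_subseq_LIMSEQ[OF _ s(1)] by (fastforce simp: o_def)
  moreover have "(\<lambda>i. dist (f ((h ^^ s i) p)) ((h ^^ s i) p)) \<longlonglongrightarrow> dist (f y) y"
    by (intro tendsto_dist s(2) continuous_on_tendsto_compose[OF cont_f s(2)]) auto
  ultimately have "dist (f y) y = 0" by (rule LIMSEQ_unique[symmetric])
  then show "y \<in> fix_set f" by (simp add: fix_set_def)
qed

lemma omega_limit_fix: "p \<notin> repelling_circle \<Longrightarrow> omega_limit h p \<subseteq> fix_set f"
  using enters_band omega_limit_fix_band by blast

lemma fix_nonempty: "fix_set f \<noteq> {}"
  using omega_limit_fix_band[of 0 "torus_cover (profile 0, 0)" "(profile 0, 0)"]
    attractor_band[OF profile_attractor[of 0]] omega_limit_nonempty by fastforce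

text \<open>The relation yields invariance under the inverse of \<open>h\<close> only; here the contraction shows that a
  vanishing displacement remains zero.\<close>
lemma fix_h: assumes "p \<in> fix_set f" shows "h p \<in> fix_set f"
proof -
  obtain z where z: "p = torus_cover z" "z \<in> attractor"
    using fix_subset_circle assms by (auto simp: attracting_circle_def)
  then have band: "z \<in> band a r" by (simp add: attractor_band)
  have "torus_cover (F z) = torus_cover z" using assms z by (simp add: fix_set_def f_cover)
  moreover have "norm (F z - z) < 1" using small[OF band] by simp
  ultimately have "F z = z" by (rule torus_cover_eq_near)
  then have "F (G z) = G z" using contraction[OF band] by simp
  then show ?thesis using z by (simp add: fix_set_def h_cover f_cover)
qed

section \<open>Minimal sets of the action\<close>

definition param :: "real \<Rightarrow> torus" where
  "param t = torus_cover (profile t, t)"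

definition circ_map :: "real \<Rightarrow> real" where
  "circ_map t = snd (G (profile t, t))"

definition circ_inv :: "real \<Rightarrow> real" where
  "circ_inv t = snd (K (profile t, t))"

lemma G_profile: "G (profile t, t) = (profile (circ_map t), circ_map t)"
  using attractor_G[OF profile_attractor[of t]] by (simp add: mem_attractor_iff circ_map_def prod_eq_iff)

lemma K_profile: "K (profile t, t) = (profile (circ_inv t), circ_inv t)"
  using attractor_K[OF profile_attractor[of t]] by (simp add: mem_attractor_iff circ_inv_def prod_eq_iff)

lemma circ_map_inv [simp]: "circ_map (circ_inv t) = t" "circ_inv (circ_map t) = t"
  using GK[of "(profile t, t)"] KG[of "(profile t, t)"] by (simp_all add: G_profile K_profile)

lemma cont_profile_pair: "continuous_on UNIV (\<lambda>t. (profile t, t))"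
  by (intro continuous_intros continuous_on_profile)

lemma cont_circ_map: "continuous_on UNIV circ_map" and cont_circ_inv: "continuous_on UNIV circ_inv"
  unfolding circ_map_def circ_inv_def
  by (intro continuous_intros continuous_on_compose2[OF cont_G cont_profile_pair]
      continuous_on_compose2[OF cont_K cont_profile_pair]; simp)+

lemma cont_param: "continuous_on UNIV param"
  unfolding param_def by (intro continuous_on_compose2[OF continuous_on_torus_cover cont_profile_pair]) simp

lemma circ_map_1: "circ_map (t + 1) = circ_map t + 1"
  using G_shift[of "(profile t, t)" 0 1] profile_shift[of t 1] by (simp add: circ_map_def)

lemma h_param: "h (param t) = param (circ_map t)"
  by (simp add: param_def h_cover G_profile)

lemma range_param: "range param = attracting_circle"
  using profile_attractor by (auto simp: param_def attracting_circle_def mem_attractor_iff intro!: image_eqI)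

lemma param_eq_iff: "param s = param t \<longleftrightarrow> (\<exists>l. s = t + of_int l)"
proof
  assume "param s = param t"
  then show "\<exists>l. s = t + of_int l" unfolding param_def torus_cover_eq_iff by auto
next
  assume "\<exists>l. s = t + of_int l"
  then obtain l where "s = t + of_int l" ..
  then have "(profile s, s) = (profile t, t) + (of_int 0, of_int l)" by (simp add: profile_shift)
  then show "param s = param t" unfolding param_def torus_cover_eq_iff by blast
qed

lemma funpow_h_param: "(h ^^ j) (param t) = param ((circ_map ^^ j) t)"
  by (rule funpow_semiconj) (rule h_param)

text \<open>A periodic point of \<open>h\<close> belongs to its own \<open>\<omega>\<close>-limit set, so its \<open>h\<close>-orbit is fixed pointwise
  by \<open>f\<close>.\<close>
lemma finite_orbit:
  assumes q: "0 < q" and t: "(circ_map ^^ q) t = t + of_int p"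
  shows "\<exists>P. finite (orbit (action_group f h) (\<lambda>g. g) P) \<and> orbit (action_group f h) (\<lambda>g. g) P \<subseteq> attracting_circle"
proof -
  let ?P = "param t"
  define S where "S = range (\<lambda>i. (h ^^ i) ?P)"
  have per: "(h ^^ q) ?P = ?P" using t by (auto simp: funpow_h_param param_eq_iff)
  have "S \<subseteq> (\<lambda>i. (h ^^ i) ?P) ` {..<q}"
  proof
    fix x assume "x \<in> S"
    then obtain i where "x = (h ^^ i) ?P" by (auto simp: S_def)
    then have "x = (h ^^ (i mod q)) ?P" by (simp add: funpow_mod_eq[OF per])
    then show "x \<in> (\<lambda>i. (h ^^ i) ?P) ` {..<q}" using q by auto
  qed
  then have fin: "finite S" by (rule finite_subset) simp
  have P: "?P \<in> fix_set f"
  proof -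
    have "(h ^^ (q * i)) ?P = ?P" for i
      using funpow_mod_eq[OF per, of "q * i"] by simp
    then have "?P \<in> omega_limit h ?P"
      unfolding omega_limit_def using q
      by (auto intro!: exI[of _ "\<lambda>i. q * i"] simp: strict_mono_def)
    moreover have "omega_limit h ?P \<subseteq> fix_set f"
      using omega_limit_fix_band[of 0 ?P "(profile t, t)"] attractor_band[OF profile_attractor] by (simp add: param_def)
    ultimately show ?thesis by blast
  qed
  have "(h ^^ i) ?P \<in> fix_set f" for i by (induction i) (use P fix_h in auto)
  then have S: "S \<subseteq> fix_set f" by (auto simp: S_def)
  then have fS: "f ` S = S" by (rule invariant_fixed)
  have hS: "h ` S = S"
  proof
    have "h ((h ^^ i) ?P) = (h ^^ Suc i) ?P" for i by simp
    then show "h ` S \<subseteq> S" unfolding S_def by blast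
    show "S \<subseteq> h ` S"
    proof
      fix x assume "x \<in> S"
      then obtain i where i: "x = (h ^^ i) ?P" by (auto simp: S_def)
      have "x = (h ^^ (i + q)) ?P" by (simp add: i funpow_add per)
      also have "\<dots> = h ((h ^^ (i + q - 1)) ?P)" using q by (cases "i + q") auto
      finally show "x \<in> h ` S" unfolding S_def by blast
    qed
  qed
  have "orbit (action_group f h) (\<lambda>g. g) ?P \<subseteq> S"
  proof (rule orbit_subset_invariant)
    show "invariant_set (action_group f h) (\<lambda>g. g) S"
      using fS hS invariant_action_group[OF bij_f bij_h] by blast
    show "?P \<in> S" unfolding S_def by (rule image_eqI[of _ _ 0]) auto
  qed
  then show ?thesis using fin S fix_subset_circle by (meson finite_subset order_trans)
qed

end

locale aperiodic_action = perturbed_action +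
  assumes aperiodic: "0 < q \<Longrightarrow> (circ_map ^^ q) t \<noteq> t + of_int p"
begin

sublocale circ: circle_lift circ_map circ_inv
  by unfold_locales (fact cont_circ_map cont_circ_inv circ_map_inv circ_map_1 aperiodic)+

definition lim_set :: "real set" where "lim_set = circ.omega 0"

definition min_set :: "torus set" where "min_set = param ` lim_set"

lemma lim_set_int: "t + of_int l \<in> lim_set \<longleftrightarrow> t \<in> lim_set"
  unfolding lim_set_def by (rule circ.invariant_int[OF circ.invariant_omega])

text \<open>The free starting point \<open>c\<close> of the fundamental interval will be put into a gap of the limit set.\<close>
lemma min_set_window: "min_set = param ` (lim_set \<inter> {c..c + 1})"
proof
  show "min_set \<subseteq> param ` (lim_set \<inter> {c..c + 1})"
  proof
    fix p assume "p \<in> min_set"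
    then obtain t where t: "p = param t" "t \<in> lim_set" by (auto simp: min_set_def)
    let ?t = "t + of_int (- \<lfloor>t - c\<rfloor>)"
    have "?t \<in> {c..c + 1}" by (simp, linarith)
    moreover have "?t \<in> lim_set" using t(2) by (simp only: lim_set_int)
    moreover have "p = param ?t" unfolding t(1) param_eq_iff by (intro exI[of _ "\<lfloor>t - c\<rfloor>"]) simp
    ultimately show "p \<in> param ` (lim_set \<inter> {c..c + 1})" by blast
  qed
qed (auto simp: min_set_def)

lemma closed_min_set: "closed min_set"
proof -
  have "compact (lim_set \<inter> {0..0 + 1})"
    unfolding lim_set_def by (intro closed_Int_compact circ.closed_omega) simp
  then show ?thesis
    unfolding min_set_window[of 0]
    by (intro compact_imp_closed compact_continuous_image continuous_on_subset[OF cont_param]) auto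
qed

lemma min_set_least:
  assumes E: "closed E" "E \<subseteq> attracting_circle" "E \<noteq> {}" "h ` E = E"
  shows "min_set \<subseteq> E"
proof -
  have hE: "h p \<in> E \<longleftrightarrow> p \<in> E" for p
    using inj_image_mem_iff[OF bij_is_inj[OF bij_h], of p E] by (simp only: E(4))
  have "closed (param -` E)" by (rule closed_vimage[OF E(1) cont_param])
  moreover have "circ.invariant (param -` E)"
  proof -
    have "param (t + 1) = param t" for t unfolding param_eq_iff by (intro exI[of _ 1]) simp
    then show ?thesis by (simp add: circ.invariant_def hE h_param[symmetric])
  qed
  moreover have "param -` E \<noteq> {}"
  proof -
    obtain p where "p \<in> E" "p \<in> range param" using E(2,3) unfolding range_param by blast
    then show ?thesis by auto
  qed
  ultimately have "lim_set \<subseteq> param -` E" unfolding lim_set_def by (rule circ.omega_least)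
  then show ?thesis by (auto simp: min_set_def)
qed

lemma image_h_fix: "h ` fix_set f = fix_set f"
proof
  show "fix_set f \<subseteq> h ` fix_set f"
  proof
    fix p assume "p \<in> fix_set f"
    then show "p \<in> h ` fix_set f" by (intro image_eqI[of _ _ "k p"]) (simp_all add: fix_k)
  qed
qed (use fix_h in blast)

lemma min_set_fix: "min_set \<subseteq> fix_set f"
  by (rule min_set_least[OF closed_fix fix_subset_circle fix_nonempty image_h_fix])

lemma image_h_min_set: "h ` min_set = min_set"
proof
  have inv: "circ_map t \<in> lim_set \<longleftrightarrow> t \<in> lim_set" for t
    using circ.invariant_omega[of 0] by (simp add: lim_set_def circ.invariant_def)
  show "h ` min_set \<subseteq> min_set" using inv by (auto simp: min_set_def h_param)
  show "min_set \<subseteq> h ` min_set"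
  proof
    fix p assume "p \<in> min_set"
    then obtain t where t: "p = param t" "t \<in> lim_set" by (auto simp: min_set_def)
    then have "circ_inv t \<in> lim_set" using inv[of "circ_inv t"] by simp
    moreover have "p = h (param (circ_inv t))" using t by (simp add: h_param)
    ultimately show "p \<in> h ` min_set" by (auto simp: min_set_def)
  qed
qed

lemma min_set_nonempty: "min_set \<noteq> {}"
  by (simp add: min_set_def lim_set_def circ.omega_nonempty)

lemmas invariant_iff = invariant_action_group[OF bij_f bij_h]

lemma minimal_min_set: "minimal_set (action_group f h) (\<lambda>g. g) min_set"
  unfolding minimal_set_def invariant_iff
proof (intro conjI allI impI)
  fix L assume L: "L \<subseteq> min_set \<and> closed L \<and> f ` L = L \<and> h ` L = L"
  have "min_set \<subseteq> attracting_circle" using min_set_fix fix_subset_circle by blast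
  then show "L = min_set \<or> L = {}" using min_set_least[of L] L by blast
qed (use min_set_nonempty closed_min_set image_h_min_set invariant_fixed[OF min_set_fix] in auto)

text \<open>A minimal set is not contained in the repelling circle, which \<open>f\<close> moves off itself. The
  \<open>\<omega>\<close>-limit set of any other of its points consists of fixed points, and by minimality the whole
  set does.\<close>
lemma minimal_unique:
  assumes M: "minimal_set (action_group f h) (\<lambda>g. g) M" shows "M = min_set"
proof -
  have M': "M \<noteq> {}" "closed M" "f ` M = M" "h ` M = M"
    "\<And>L. L \<subseteq> M \<Longrightarrow> closed L \<Longrightarrow> f ` L = L \<Longrightarrow> h ` L = L \<Longrightarrow> L = M \<or> L = {}"
    using M unfolding minimal_set_def invariant_iff by auto
  obtain p where p: "p \<in> M" "p \<notin> repelling_circle"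
  proof -
    obtain q where "q \<in> M" using M'(1) by blast
    moreover from this have "f q \<in> M" using M'(3) by blast
    ultimately show thesis using that moves_repelling_circle by blast
  qed
  have "omega_limit h p \<subseteq> M" by (rule omega_limit_closed_subset[OF M'(2) _ p(1)]) (use M'(4) in blast)
  then have ne: "M \<inter> fix_set f \<noteq> {}" using omega_limit_fix[OF p(2)] omega_limit_nonempty[of h p] by blast
  have "h ` (M \<inter> fix_set f) = M \<inter> fix_set f"
    using bij_is_inj[OF bij_h] by (simp add: image_Int M'(4) image_h_fix)
  moreover have "f ` (M \<inter> fix_set f) = M \<inter> fix_set f" by (rule invariant_fixed) simp
  ultimately have "M \<inter> fix_set f = M"
    using M'(5)[of "M \<inter> fix_set f"] M'(2) closed_fix ne by auto
  then have "min_set \<subseteq> M" using M' fix_subset_circle by (intro min_set_least) auto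
  then show ?thesis
    using M'(5)[of min_set] closed_min_set invariant_fixed[OF min_set_fix] image_h_min_set min_set_nonempty by auto
qed

text \<open>Cut open at a point outside the limit set, the circle becomes an interval, and the limit set
  a compact subset of the interior of this interval.\<close>
lemma min_set_dichotomy: "min_set = attracting_circle \<or> cantor_set min_set"
proof (cases "lim_set = UNIV")
  case True then show ?thesis using range_param by (simp add: min_set_def)
next
  case False
  then obtain c where c: "c \<notin> lim_set" by blast
  have c1: "c + 1 \<notin> lim_set" using c lim_set_int[of c 1] by simp
  define P where "P = lim_set \<inter> {c..c + 1}"
  have int: "interior P = {}"
    using circ.omega_dichotomy[of 0] False interior_mono[of P lim_set] by (auto simp: P_def lim_set_def)
  interpret nowhere_dense_perfect P
  proof
    show "compact P" unfolding P_def lim_set_def by (intro closed_Int_compact circ.closed_omega) simp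
    show "P \<noteq> {}" using min_set_nonempty min_set_window[of c] by (auto simp: P_def)
    show "interior P = {}" by (rule int)
    fix x e :: real assume x: "x \<in> P" and "e > 0"
    have "c < x" "x < c + 1" using x c c1 by (auto simp: P_def order_le_less)
    then obtain y where "y \<in> lim_set" "y \<noteq> x" "dist y x < min e (min (x - c) (c + 1 - x))"
      using circ.omega_perfect[of x 0 "min e (min (x - c) (c + 1 - x))"] x \<open>e > 0\<close>
      by (auto simp: P_def lim_set_def)
    then show "\<exists>y\<in>P. y \<noteq> x \<and> dist y x < e"
      by (intro bexI[of _ y]) (auto simp: P_def dist_real_def)
  qed
  have "inj_on param P"
  proof (rule inj_onI)
    fix s t assume s: "s \<in> P" and t: "t \<in> P" and "param s = param t"
    then obtain l where l: "s = t + of_int l" using param_eq_iff by blast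
    have "c < s" "s < c + 1" "c < t" "t < c + 1" using s t c c1 by (auto simp: P_def order_le_less)
    then have "\<bar>of_int l :: real\<bar> < 1" using l by auto
    then have "l = 0" by linarith
    then show "s = t" using l by simp
  qed
  moreover have "compact_space (top_of_set P)" using compact_P by (simp add: compact_space_subtopology)
  moreover have "continuous_map (top_of_set P) euclidean param"
    using continuous_on_subset[OF cont_param] by simp
  ultimately have "embedding_map (top_of_set P) euclidean param"
    by (intro continuous_imp_embedding_map) auto
  then have "top_of_set P homeomorphic_space subtopology euclidean (param ` topspace (top_of_set P))"
    by (rule embedding_map_imp_homeomorphic_space)
  then have "top_of_set P homeomorphic_space top_of_set min_set"
    unfolding min_set_window[of c] P_def[symmetric] by simp
  then have "top_of_set min_set homeomorphic_space top_of_set P"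
    by (subst homeomorphic_space_sym)
  then have "cantor_set min_set"
    unfolding cantor_set_def by (rule homeomorphic_space_trans[OF _ homeomorphic_Cantor_space])
  then show ?thesis ..
qed

end


section \<open>A Lyapunov function for the model\<close>

lemma cos_lipschitz: "\<bar>cos x - cos y\<bar> \<le> \<bar>x - y\<bar>" for x y :: real
proof -
  have "\<bar>cos x - cos y\<bar> \<le> dist (cis x) (cis y)"
    using abs_Re_le_cmod[of "cis x - cis y"] by (simp add: dist_norm)
  then show ?thesis using dist_cis_le[of x y] by simp
qed

text \<open>With \<open>c = cos (\<pi> u)\<close>, \<open>s = sin (\<pi> u)\<close> and \<open>N = c\<^sup>2 + n\<^sup>2 s\<^sup>2\<close> the difference is
  \<open>2 c\<^sup>2 (N - 1) / N = 2 (n\<^sup>2 - 1) c\<^sup>2 s\<^sup>2 / N\<close>, where \<open>N \<le> n\<^sup>2\<close> and \<open>(n\<^sup>2 - 1) / n\<^sup>2 \<ge> 3/4\<close>.\<close>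
lemma cos_drop:
  assumes n: "n \<ge> (2 :: real)"
  shows "cos (2 * pi * u) - cos (2 * pi * aff_lift n 0 u) \<ge> 3/8 * (sin (2 * pi * u))\<^sup>2"
proof -
  define c s N where "c = cos (pi * u)" and "s = sin (pi * u)" and "N = aff_norm n 0 u"
  have ab: "0\<^sup>2 < 4 * n" using n by simp
  have N_pos: "N > 0" unfolding N_def by (rule aff_norm_pos[OF ab])
  have cs: "c\<^sup>2 = 1 - s\<^sup>2" by (simp add: c_def s_def cos_squared_eq)
  have N: "N = c\<^sup>2 + n\<^sup>2 * s\<^sup>2" by (simp add: N_def aff_norm_def c_def s_def power_mult_distrib)
  have dbl: "cos (2 * pi * v) = 2 * (cos (pi * v))\<^sup>2 - 1" "sin (2 * pi * v) = 2 * sin (pi * v) * cos (pi * v)" for v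
    using cos_double_cos[of "pi * v"] sin_double[of "pi * v"] by (simp_all add: mult.assoc)
  have "cos (pi * aff_lift n 0 u) = c / sqrt N"
    using cos_sin_aff_lift(1)[OF ab] by (simp add: c_def N_def)
  then have "cos (2 * pi * u) - cos (2 * pi * aff_lift n 0 u) = 2 * c\<^sup>2 - 2 * (c\<^sup>2 / N)"
    using N_pos by (simp add: dbl power_divide c_def)
  also have "\<dots> = 2 * c\<^sup>2 * ((N - 1) / N)" using N_pos by (simp add: field_simps)
  also have "(N - 1) / N \<ge> 3/4 * s\<^sup>2"
  proof -
    have n2: "n\<^sup>2 \<ge> 4" using power_mono[of 2 n 2] n by simp
    have e: "N - 1 = (n\<^sup>2 - 1) * s\<^sup>2" using N cs by (simp add: algebra_simps)
    have "n\<^sup>2 - 1 \<ge> 0" using n2 by simp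
    moreover have "s\<^sup>2 \<le> 1" by (simp add: s_def power2_eq_1_iff abs_square_le_1)
    ultimately have "(n\<^sup>2 - 1) * s\<^sup>2 \<le> (n\<^sup>2 - 1) * 1" by (intro mult_left_mono)
    then have "N \<le> n\<^sup>2" using e by simp
    then have "3/4 * N \<le> n\<^sup>2 - 1" using n2 by simp
    then have "3/4 * N * s\<^sup>2 \<le> (n\<^sup>2 - 1) * s\<^sup>2" by (intro mult_right_mono) auto
    then show ?thesis using N_pos e by (simp add: field_simps)
  qed
  then have "2 * c\<^sup>2 * ((N - 1) / N) \<ge> 2 * c\<^sup>2 * (3/4 * s\<^sup>2)" by (intro mult_left_mono) auto
  then show ?thesis using calculation by (simp add: dbl c_def s_def power_mult_distrib)
qed

text \<open>The sine of \<open>2 \<pi> u\<close> vanishes exactly at the multiples of \<open>1/2\<close>, the centres of the bands; \<open>y / 2\<close> is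
  the signed distance to the nearest one.\<close>
lemma sin_lower_bound_off_bands:
  assumes r: "0 < r" "r < 1/4"
    and off: "\<And>m. z \<notin> band (1/2 + of_int m) r \<union> band (0 + of_int m) r"
  shows "(sin (2 * pi * r))\<^sup>2 \<le> (sin (2 * pi * fst z))\<^sup>2"
proof -
  define m where "m = round (2 * fst z)"
  define y where "y = 2 * fst z - of_int m"
  have y1: "\<bar>y\<bar> \<le> 1/2" using of_int_round_abs_le[of "2 * fst z"] by (simp add: y_def m_def abs_minus_commute)
  have y2: "2 * r < \<bar>y\<bar>"
  proof (rule ccontr)
    assume "\<not> 2 * r < \<bar>y\<bar>"
    then have le: "\<bar>fst z - of_int m / 2\<bar> \<le> r" unfolding y_def by linarith
    show False
    proof (cases "even m")
      case True
      then obtain i where "m = 2 * i" by blast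
      then have "z \<in> band (0 + of_int i) r" using le by (simp add: band_def)
      then show ?thesis using off by blast
    next
      case False
      then obtain i where "m = 2 * i + 1" by (elim oddE)
      then have "z \<in> band (1/2 + of_int i) r" using le by (simp add: band_def field_simps)
      then show ?thesis using off by blast
    qed
  qed
  have "sin (2 * pi * fst z) = sin (pi * y + of_int m * pi)"
    by (simp add: y_def algebra_simps)
  then have "(sin (2 * pi * fst z))\<^sup>2 = (sin (pi * y))\<^sup>2"
    by (simp add: sin_add sin_npi_int cos_npi_int mult.commute[of _ pi] power_mult_distrib)
  also have "\<dots> = (sin (pi * \<bar>y\<bar>))\<^sup>2" by (simp add: abs_if)
  finally have eq: "(sin (2 * pi * fst z))\<^sup>2 = (sin (pi * \<bar>y\<bar>))\<^sup>2" .
  have "sin (2 * pi * r) \<le> sin (pi * \<bar>y\<bar>)"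
  proof (rule sin_monotone_2pi_le)
    have "2 * pi * r = pi * (2 * r)" by simp
    also have "\<dots> \<le> pi * \<bar>y\<bar>" using y2 by (intro mult_left_mono) auto
    finally show "2 * pi * r \<le> pi * \<bar>y\<bar>" .
    have "pi * \<bar>y\<bar> \<le> pi * (1/2)" using y1 by (intro mult_left_mono) auto
    then show "pi * \<bar>y\<bar> \<le> pi / 2" by simp
    show "- (pi / 2) \<le> 2 * pi * r" using r by (simp add: order_trans[of _ 0])
  qed
  moreover have "0 \<le> sin (2 * pi * r)" using r by (intro sin_ge_zero) (simp_all add: field_simps)
  ultimately show ?thesis unfolding eq by (rule power_mono)
qed

lemma leaves_by_lyapunov:
  fixes L :: "'a \<Rightarrow> real"
  assumes drop: "\<And>z. z \<notin> S \<Longrightarrow> L (T z) \<le> L z - e" and e: "e > 0" and bound: "\<And>z. \<bar>L z\<bar> \<le> 1"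
  shows "\<exists>j. (T ^^ j) z \<in> S"
proof (rule ccontr)
  assume *: "\<not> ?thesis"
  have "L ((T ^^ j) z) \<le> L z - real j * e" for j
  proof (induction j)
    case (Suc j)
    have "L ((T ^^ Suc j) z) \<le> L ((T ^^ j) z) - e" using drop[of "(T ^^ j) z"] * by simp
    then show ?case using Suc by (simp add: algebra_simps)
  qed simp
  moreover obtain j :: nat where "real j > 2 / e" using reals_Archimedean2 by blast
  then have "real j * e > 2" using e by (simp add: field_simps)
  ultimately have "L ((T ^^ j) z) < L z - 2" by (smt (verit))
  then show False using bound[of "(T ^^ j) z"] bound[of z] by linarith
qed

section \<open>Perturbations of the standard action\<close>

lemma mean_value_ball:
  fixes g g' :: "real \<Rightarrow> real"
  assumes der: "\<And>u. \<bar>u - c\<bar> \<le> r \<Longrightarrow> (g has_real_derivative g' u) (at u)"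
    and u: "\<bar>u - c\<bar> \<le> r" and v: "\<bar>v - c\<bar> \<le> r"
  obtains \<xi> where "\<bar>\<xi> - c\<bar> \<le> r" "g u - g v = (u - v) * g' \<xi>"
proof -
  consider "u = v" | "v < u" | "u < v" by linarith
  then show thesis
  proof cases
    case 1 then show ?thesis using that[OF u] by simp
  next
    case 2
    obtain \<xi> where "v < \<xi>" "\<xi> < u" "g u - g v = (u - v) * g' \<xi>"
      using MVT2[of v u g g'] 2 der u v by force
    then show ?thesis using that[of \<xi>] u v by auto
  next
    case 3
    obtain \<xi> where "u < \<xi>" "\<xi> < v" "g v - g u = (v - u) * g' \<xi>"
      using MVT2[of u v g g'] 3 der u v by force
    then show ?thesis using that[of \<xi>] u v by (auto simp: algebra_simps)
  qed
qed

lemma isCont_radius: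
  fixes g :: "real \<Rightarrow> real"
  assumes "isCont g c" "e > 0"
  obtains R where "R > 0" "\<And>u. \<bar>u - c\<bar> \<le> R \<Longrightarrow> \<bar>g u - g c\<bar> \<le> e"
proof -
  obtain d where d: "d > 0" "\<And>u. dist u c < d \<Longrightarrow> dist (g u) (g c) < e"
    using assms unfolding continuous_at_eps_delta by blast
  show thesis
    by (rule that[of "d/2"]) (use d in \<open>auto simp: dist_real_def less_imp_le\<close>)
qed

lemma isCont_aff_deriv:
  assumes "b\<^sup>2 < 4 * a" shows "isCont (\<lambda>u. a / aff_norm a b u) u"
  using aff_norm_pos[OF assms, of u] by (auto simp: aff_norm_def intro!: continuous_intros)

text \<open>
  The error of the lift \<open>G\<close> changes coordinate differences by at most \<open>1/16\<close> of their sum. In the band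
  around \<open>1/2\<close> the model contracts horizontally by \<open>3/4\<close>, and for a difference in the cone
  \<open>3/4 + 2/16 = 7/8\<close>. In the band around \<open>0\<close> it expands by \<open>4/3\<close>, which leaves
  \<open>4/3 - 2/16 = 29/24\<close>; this is more than \<open>8/7\<close>, and more than the vertical growth \<open>1 + 2/16\<close>. So both cone
  conditions hold with the same constant \<open>7/8\<close>.
\<close>
lemma perturbed_north_south:
  fixes n :: nat
  defines "M \<equiv> model_lift (real n) 0 (ln (real n))"
  assumes n: "n \<ge> 2" and r: "0 < r" "r < 1/4"
    and \<delta>: "0 < \<delta>" "\<delta> \<le> 1/16" "\<delta> \<le> r/4" "2 * pi * \<delta> \<le> (sin (2 * pi * r))\<^sup>2 / 8"
    and contr: "\<And>u. \<bar>u - 1/2\<bar> \<le> r \<Longrightarrow> real n / aff_norm (real n) 0 u \<le> 3/4"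
    and expand: "\<And>u. \<bar>u\<bar> \<le> r \<Longrightarrow> 4/3 \<le> real n / aff_norm (real n) 0 u"
    and h: "h \<in> Diff1" "C1_close \<delta> (h0 n) h"
  obtains G K where "north_south G K h (inv_into UNIV h) (1/2) 0 r (7/8)"
    "\<And>z. norm (G z - M z) < \<delta>"
    "\<And>z w. norm ((G z - M z) - (G w - M w)) \<le> \<delta> * norm (z - w)"
proof -
  let ?N = "real n" and ?\<eta> = "aff_lift (real n) 0"
  have ab: "0\<^sup>2 < 4 * ?N" using n by simp
  obtain G where G: "continuous_on UNIV G" "\<And>z. h (torus_cover z) = torus_cover (G z)"
    and G_M: "\<And>z. norm (G z - M z) < \<delta>"
    and G_lip: "\<And>z w. norm ((G z - M z) - (G w - M w)) \<le> \<delta> * norm (z - w)"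
    using C1_close_model[OF ab h(2)[unfolded h0_model]] unfolding M_def by blast
  have G_shift: "G (z + (of_int m, of_int l)) = G z + (of_int m, of_int l)" for z m l
    using close_lift_shift[of G h "?N" 0 "ln ?N" \<delta>] G G_M \<delta>(2) unfolding M_def by auto
  have bij: "bij h" using h(1) by (simp add: Diff1_def)
  have ih: "inv_into UNIV h (h p) = p" "h (inv_into UNIV h p) = p" for p
    using bij by (simp_all add: bij_is_inj bij_is_surj surj_f_inv_f)
  \<comment> \<open>A lift of the inverse is inverse to \<open>G\<close> up to a deck transformation, which is then taken off.\<close>
  obtain K0 K0' where K0: "C1_lift (inv_into UNIV h) K0 K0'" using h(1) by (auto simp: Diff1_def C1_map_def)
  have cont_K0: "continuous_on UNIV K0" by (rule C1_lift_continuous[OF K0])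
  have KG_cont: "continuous_on UNIV (\<lambda>z. K0 (G z))" by (rule continuous_on_compose2[OF cont_K0 G(1)]) simp
  have KG_cover: "torus_cover (K0 (G z)) = torus_cover z" for z
    by (simp add: C1_lift_eq[OF K0, symmetric] G(2)[symmetric] ih)
  obtain k l where kl: "\<And>z. K0 (G z) = z + (of_int k, of_int l)"
    using lift_unique[OF KG_cont continuous_on_id KG_cover] by blast
  define K where "K z = K0 z + (of_int (- k), of_int (- l))" for z
  have KG: "K (G z) = z" for z by (simp add: K_def kl prod_eq_iff)
  have cont_K: "continuous_on UNIV K" unfolding K_def by (intro continuous_intros cont_K0)
  have K_cover: "inv_into UNIV h (torus_cover z) = torus_cover (K z)" for z
    unfolding K_def torus_cover_shift by (rule C1_lift_eq[OF K0])
  have GK_cont: "continuous_on UNIV (\<lambda>z. G (K z))" by (rule continuous_on_compose2[OF G(1) cont_K]) simp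
  have GK_cover: "torus_cover (G (K z)) = torus_cover z" for z
    by (simp add: G(2)[symmetric] K_cover[symmetric] ih)
  obtain k' l' where kl': "\<And>z. G (K z) = z + (of_int k', of_int l')"
    using lift_unique[OF GK_cont continuous_on_id GK_cover] by blast
  have GK: "G (K z) = z" for z using kl'[of z] kl'[of "G 0"] KG[of 0] by (simp add: prod_eq_iff)
  have fstM: "fst (M z) = ?\<eta> (fst z)" and sndM: "snd (M z) = snd z + ln ?N" for z
    by (simp_all add: M_def model_lift_def)
  have near: "\<bar>fst (G z) - ?\<eta> (fst z)\<bar> < \<delta>" for z
    using abs_fst_le_norm[of "G z - M z"] G_M[of z] by (simp add: fstM)
  have lip: "\<bar>(fst (G z) - fst (G w)) - (?\<eta> (fst z) - ?\<eta> (fst w))\<bar> \<le> (\<bar>fst z - fst w\<bar> + \<bar>snd z - snd w\<bar>) / 16"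
    "\<bar>(snd (G z) - snd (G w)) - (snd z - snd w)\<bar> \<le> (\<bar>fst z - fst w\<bar> + \<bar>snd z - snd w\<bar>) / 16" for z w
  proof -
    have "\<delta> * norm (z - w) \<le> 1/16 * (\<bar>fst z - fst w\<bar> + \<bar>snd z - snd w\<bar>)"
      using norm_le_abs_sum[of "z - w"] \<delta>(1,2) by (intro mult_mono) auto
    then have "norm ((G z - M z) - (G w - M w)) \<le> (\<bar>fst z - fst w\<bar> + \<bar>snd z - snd w\<bar>) / 16"
      using G_lip[of z w] by simp
    then show "\<bar>(fst (G z) - fst (G w)) - (?\<eta> (fst z) - ?\<eta> (fst w))\<bar> \<le> (\<bar>fst z - fst w\<bar> + \<bar>snd z - snd w\<bar>) / 16"
      "\<bar>(snd (G z) - snd (G w)) - (snd z - snd w)\<bar> \<le> (\<bar>fst z - fst w\<bar> + \<bar>snd z - snd w\<bar>) / 16"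
      using abs_fst_le_norm[of "(G z - M z) - (G w - M w)"] abs_snd_le_norm[of "(G z - M z) - (G w - M w)"]
      by (simp_all add: fstM sndM algebra_simps)
  qed
  have der: "(?\<eta> has_real_derivative ?N / aff_norm ?N 0 u) (at u)" for u by (rule aff_lift_deriv[OF ab])
  have der_pos: "?N / aff_norm ?N 0 u > 0" for u using aff_norm_pos[OF ab] n by simp
  have mono: "?\<eta> u \<le> ?\<eta> v" if "u \<le> v" for u v
    using DERIV_nonneg_imp_nondecreasing[OF that] der der_pos by (meson less_imp_le)
  have contr': "\<bar>?\<eta> u - ?\<eta> v\<bar> \<le> 3/4 * \<bar>u - v\<bar>" if uv: "\<bar>u - 1/2\<bar> \<le> r" "\<bar>v - 1/2\<bar> \<le> r" for u v
  proof -
    obtain \<xi> where \<xi>: "\<bar>\<xi> - 1/2\<bar> \<le> r" "?\<eta> u - ?\<eta> v = (u - v) * (?N / aff_norm ?N 0 \<xi>)"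
      using mean_value_ball[OF der uv] by blast
    have "\<bar>?\<eta> u - ?\<eta> v\<bar> = \<bar>u - v\<bar> * (?N / aff_norm ?N 0 \<xi>)"
      by (simp only: \<xi>(2) abs_mult abs_of_pos[OF der_pos])
    also have "\<dots> \<le> \<bar>u - v\<bar> * (3/4)" using contr[OF \<xi>(1)] by (intro mult_left_mono) auto
    finally show ?thesis by simp
  qed
  have expand': "4/3 * \<bar>u - v\<bar> \<le> \<bar>?\<eta> u - ?\<eta> v\<bar>" if uv: "\<bar>u\<bar> \<le> r" "\<bar>v\<bar> \<le> r" for u v
  proof -
    obtain \<xi> where \<xi>: "\<bar>\<xi> - 0\<bar> \<le> r" "?\<eta> u - ?\<eta> v = (u - v) * (?N / aff_norm ?N 0 \<xi>)"
      using mean_value_ball[OF der, of u 0 r v] uv by auto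
    have "\<bar>u - v\<bar> * (4/3) \<le> \<bar>u - v\<bar> * (?N / aff_norm ?N 0 \<xi>)" using expand[of \<xi>] \<xi>(1) by (intro mult_left_mono) auto
    also have "\<dots> = \<bar>?\<eta> u - ?\<eta> v\<bar>"
      by (simp only: \<xi>(2) abs_mult abs_of_pos[OF der_pos])
    finally show ?thesis by simp
  qed
  have \<eta>0: "?\<eta> 0 = 0" by (simp add: aff_lift_def aff_num_def)
  have \<eta>half: "?\<eta> (1/2) = 1/2" by (simp add: aff_lift_def aff_num_def cos_pi_half)
  have \<eta>r: "4/3 * r \<le> ?\<eta> r" "?\<eta> (- r) \<le> - (4/3 * r)"
    using expand'[of r 0] expand'[of "- r" 0] mono[of 0 r] mono[of "- r" 0] r by (simp_all add: \<eta>0)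
  have G_band: "G z \<in> band (1/2) r" if z: "z \<in> band (1/2) r" for z
  proof -
    have u: "\<bar>fst z - 1/2\<bar> \<le> r" using z by (simp add: band_def)
    then have "\<bar>?\<eta> (fst z) - 1/2\<bar> \<le> 3/4 * \<bar>fst z - 1/2\<bar>"
      using contr'[OF u, of "1/2"] r unfolding \<eta>half by simp
    then have "\<bar>fst (G z) - 1/2\<bar> \<le> r" using near[of z] u \<delta>(3) by argo
    then show ?thesis by (simp add: band_def)
  qed
  have K_band: "K z \<in> band 0 r" if z: "z \<in> band 0 r" for z
  proof -
    let ?u = "fst (K z)"
    have "\<bar>fst z\<bar> \<le> r" using z by (simp add: band_def)
    then have u: "\<bar>?\<eta> ?u\<bar> < r + \<delta>" using near[of "K z"] unfolding GK by linarith
    have "\<not> ?u > r" using mono[of r ?u] \<eta>r u \<delta>(3) r by linarith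
    moreover have "\<not> ?u < - r" using mono[of ?u "- r"] \<eta>r u \<delta>(3) r by linarith
    ultimately show ?thesis by (simp add: band_def abs_le_iff)
  qed
  have cone_G: "\<bar>snd z - snd w\<bar> \<le> \<bar>fst z - fst w\<bar> \<and> \<bar>fst (G z) - fst (G w)\<bar> \<le> 7/8 * \<bar>fst z - fst w\<bar>"
    if "z \<in> band (1/2) r" "w \<in> band (1/2) r" "\<bar>snd (G z) - snd (G w)\<bar> \<le> \<bar>fst (G z) - fst (G w)\<bar>" for z w
  proof -
    have "\<bar>?\<eta> (fst z) - ?\<eta> (fst w)\<bar> \<le> 3/4 * \<bar>fst z - fst w\<bar>"
      using contr' that(1,2) by (simp add: band_def)
    then show ?thesis using lip[of z w] that(3) by argo
  qed
  have cone_K: "\<bar>snd z - snd w\<bar> \<le> \<bar>fst z - fst w\<bar> \<and> \<bar>fst (K z) - fst (K w)\<bar> \<le> 7/8 * \<bar>fst z - fst w\<bar>"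
    if "z \<in> band 0 r" "w \<in> band 0 r" "\<bar>snd (K z) - snd (K w)\<bar> \<le> \<bar>fst (K z) - fst (K w)\<bar>" for z w
  proof -
    have "4/3 * \<bar>fst (K z) - fst (K w)\<bar> \<le> \<bar>?\<eta> (fst (K z)) - ?\<eta> (fst (K w))\<bar>"
      using expand' K_band[OF that(1)] K_band[OF that(2)] by (simp add: band_def)
    then show ?thesis using lip[of "K z" "K w"] that(3) unfolding GK by argo
  qed
  let ?S = "{z. \<exists>m. z \<in> band (1/2 + of_int m) r \<union> band (0 + of_int m) r}"
  let ?L = "\<lambda>z :: real \<times> real. cos (2 * pi * fst z)"
  define e where "e = (sin (2 * pi * r))\<^sup>2 / 4"
  have "sin (2 * pi * r) > 0" using r by (intro sin_gt_zero) (simp_all add: field_simps)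
  then have e: "e > 0" by (simp add: e_def)
  have drop: "?L (G z) \<le> ?L z - e" if "z \<notin> ?S" for z
  proof -
    have "(sin (2 * pi * r))\<^sup>2 \<le> (sin (2 * pi * fst z))\<^sup>2"
      using that by (intro sin_lower_bound_off_bands[OF r]) blast
    moreover have "3/8 * (sin (2 * pi * fst z))\<^sup>2 \<le> ?L z - cos (2 * pi * ?\<eta> (fst z))"
      by (rule cos_drop) (use n in simp)
    moreover have "\<bar>?L (G z) - cos (2 * pi * ?\<eta> (fst z))\<bar> \<le> 2 * pi * \<delta>"
    proof -
      have "\<bar>?L (G z) - cos (2 * pi * ?\<eta> (fst z))\<bar> \<le> \<bar>2 * pi * (fst (G z) - ?\<eta> (fst z))\<bar>"
        using cos_lipschitz[of "2 * pi * fst (G z)" "2 * pi * ?\<eta> (fst z)"] by (simp add: right_diff_distrib)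
      also have "\<dots> \<le> 2 * pi * \<delta>" using near[of z] by (simp add: abs_mult)
      finally show ?thesis .
    qed
    ultimately show ?thesis using \<delta>(4) unfolding e_def by linarith
  qed
  have transit_G: "\<exists>j m. (G ^^ j) z \<in> band (1/2 + of_int m) r \<union> band (0 + of_int m) r" for z
    using leaves_by_lyapunov[of ?S ?L G e z] drop e by simp
  have transit_K: "\<exists>j m. (K ^^ j) z \<in> band (1/2 + of_int m) r \<union> band (0 + of_int m) r" for z
  proof -
    \<comment> \<open>The function drops along \<open>G\<close> at points off the bands, so the hypothesis is needed at \<open>K w\<close>.\<close>
    have "\<exists>j. (K ^^ j) z \<in> {z. K z \<in> ?S}"
    proof (rule leaves_by_lyapunov[of _ "\<lambda>z. - ?L z" K e])
      fix w assume "w \<notin> {z. K z \<in> ?S}"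
      then show "- ?L (K w) \<le> - ?L w - e" using drop[of "K w"] GK[of w] by simp
    qed (use e in auto)
    then obtain j where "(K ^^ Suc j) z \<in> ?S" by auto
    then show ?thesis by blast
  qed
  have "north_south G K h (inv_into UNIV h) (1/2) 0 r (7/8)"
  proof
    show "0 < r" "r < 1/4" by fact+
  qed (fact GK KG G(1) cont_K G_shift G(2) K_cover G_band K_band cone_G cone_K transit_G transit_K | simp)+
  then show thesis using that G_M G_lip by blast
qed


text \<open>
  Two bands are used: in the wide one, of radius \<open>R\<close>, the displacement of \<open>F\<close> has Lipschitz constant
  \<open>\<sigma> = 1 / (8 n\<^sup>2)\<close>; the narrow one, of radius \<open>r \<le> R/2\<close>, is the attracting band. On the narrow band
  the displacement is at most \<open>R / (8 n)\<close>, so that orbit segments of length \<open>n\<close> starting there do not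
  leave the wide band. The relation between \<open>h\<close> and \<open>f\<close> lifts without a deck transformation because
  both sides are close to \<open>G z\<close>. The translation moves \<open>u = 0\<close> to \<open>u = 1/4\<close>, far from all bands around integers.
\<close>
lemma perturbed_action_near_model:
  fixes n :: nat
  defines "M \<equiv> model_lift (real n) 0 (ln (real n))" and "P \<equiv> model_lift 1 1 0"
    and "\<sigma> \<equiv> 1 / (8 * (real n)\<^sup>2)"
  assumes n: "n \<ge> 2" and R: "0 < R" "R \<le> 1" and r: "0 < r" "r \<le> R/2" "r < 1/16"
    and \<delta>: "0 < \<delta>" "\<delta> \<le> 1/16" "\<delta> \<le> \<sigma>/2" "\<delta> \<le> R / (16 * real n)" "\<delta> \<le> r/4"
    and contr: "\<And>u. \<bar>u - 1/2\<bar> \<le> R \<Longrightarrow> real n / aff_norm (real n) 0 u \<le> 3/4"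
    and flat: "\<And>u. \<bar>u - 1/2\<bar> \<le> R \<Longrightarrow> \<bar>1 / aff_norm 1 1 u - 1\<bar> \<le> \<sigma>/2"
    and disp: "\<And>u. \<bar>u - 1/2\<bar> \<le> r \<Longrightarrow> \<bar>aff_lift 1 1 u - u\<bar> \<le> R / (16 * real n)"
    and shift: "\<And>u. \<bar>u\<bar> \<le> r \<Longrightarrow> \<bar>aff_lift 1 1 u - 1/4\<bar> \<le> 1/8"
    and ns: "north_south G K h k (1/2) 0 r (7/8)"
    and G_lip: "\<And>z w. norm ((G z - M z) - (G w - M w)) \<le> \<delta> * norm (z - w)"
    and bij_f: "bij f" and cont_F: "continuous_on UNIV F"
    and f_cover: "\<And>z. f (torus_cover z) = torus_cover (F z)"
    and F_near: "\<And>z. norm (F z - P z) < \<delta>"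
    and F_lip: "\<And>z w. norm ((F z - P z) - (F w - P w)) \<le> \<delta> * norm (z - w)"
    and relation: "\<And>p. h (f p) = (f ^^ n) (h p)"
  shows "perturbed_action G K h k (1/2) 0 r (7/8) F f n"
proof -
  interpret north_south G K h k "1/2" 0 r "7/8" by (rule ns)
  let ?N = "real n" and ?\<eta> = "aff_lift (real n) 0" and ?\<psi> = "\<lambda>u. aff_lift 1 1 u - u"
  have N: "?N \<ge> 2" using n by simp
  have \<sigma>: "0 \<le> \<sigma>" "8 * ?N\<^sup>2 * \<sigma> \<le> 1" using n by (simp_all add: \<sigma>_def)
  have X_eq: "F z - z = (F z - P z) + (?\<psi> (fst z), 0)" for z
    by (simp add: P_def model_lift_def prod_eq_iff)
  have X_lip: "norm ((F z - z) - (F w - w)) \<le> \<sigma> * norm (z - w)"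
    if zw: "\<bar>fst z - 1/2\<bar> \<le> R" "\<bar>fst w - 1/2\<bar> \<le> R" for z w
  proof -
    have der: "(?\<psi> has_real_derivative 1 / aff_norm 1 1 u - 1) (at u)" for u
      by (intro DERIV_diff DERIV_ident aff_lift_deriv) simp
    obtain \<xi> where \<xi>: "\<bar>\<xi> - 1/2\<bar> \<le> R"
      "?\<psi> (fst z) - ?\<psi> (fst w) = (fst z - fst w) * (1 / aff_norm 1 1 \<xi> - 1)"
      by (rule mean_value_ball[where g = ?\<psi>, OF der zw]) (rule that)
    have "\<bar>?\<psi> (fst z) - ?\<psi> (fst w)\<bar> = \<bar>fst z - fst w\<bar> * \<bar>1 / aff_norm 1 1 \<xi> - 1\<bar>"
      by (simp only: \<xi>(2) abs_mult)
    also have "\<dots> \<le> norm (z - w) * (\<sigma>/2)"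
      using flat[OF \<xi>(1)] abs_fst_le_norm[of "z - w"] by (intro mult_mono) auto
    finally have \<psi>: "norm (?\<psi> (fst z) - ?\<psi> (fst w), 0 :: real) \<le> norm (z - w) * (\<sigma>/2)" by simp
    have "(F z - z) - (F w - w) = ((F z - P z) - (F w - P w)) + (?\<psi> (fst z) - ?\<psi> (fst w), 0)"
      unfolding X_eq by (simp add: prod_eq_iff)
    also have "norm \<dots> \<le> \<delta> * norm (z - w) + norm (z - w) * (\<sigma>/2)"
      by (intro norm_triangle_le add_mono F_lip \<psi>)
    also have "\<dots> \<le> \<sigma>/2 * norm (z - w) + norm (z - w) * (\<sigma>/2)"
      using \<delta>(3) by (intro add_right_mono mult_right_mono) auto
    finally show ?thesis by (simp add: algebra_simps)
  qed
  have X_small: "norm (F z - z) \<le> R / (8 * ?N)" if "z \<in> band (1/2) r" for z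
  proof -
    have "norm (?\<psi> (fst z), 0 :: real) \<le> R / (16 * ?N)" using disp[of "fst z"] that by (simp add: band_def)
    then have "norm (F z - z) \<le> \<delta> + R / (16 * ?N)"
      unfolding X_eq using F_near[of z] by (intro norm_triangle_le add_mono) auto
    also have "\<dots> \<le> R / (16 * ?N) + R / (16 * ?N)" using \<delta>(4) by simp
    finally show ?thesis by (simp add: field_simps)
  qed
  have RN: "R / (8 * ?N) \<le> R / 16" using N R by (intro divide_left_mono) auto
  have G_lip': "norm (G z - G w) \<le> 5/4 * norm (z - w)"
    if zw: "\<bar>fst z - 1/2\<bar> \<le> R" "\<bar>fst w - 1/2\<bar> \<le> R" for z w
  proof -
    have ab: "0\<^sup>2 < 4 * ?N" using N by simp
    obtain \<xi> where \<xi>: "\<bar>\<xi> - 1/2\<bar> \<le> R" "?\<eta> (fst z) - ?\<eta> (fst w) = (fst z - fst w) * (?N / aff_norm ?N 0 \<xi>)"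
      by (rule mean_value_ball[where g = ?\<eta>, OF aff_lift_deriv[OF ab] zw]) (rule that)
    have "?N / aff_norm ?N 0 \<xi> > 0" using aff_norm_pos[OF ab, of \<xi>] N by simp
    then have "\<bar>?\<eta> (fst z) - ?\<eta> (fst w)\<bar> = \<bar>fst z - fst w\<bar> * (?N / aff_norm ?N 0 \<xi>)"
      by (simp only: \<xi>(2) abs_mult abs_of_pos)
    also have "\<dots> \<le> \<bar>fst z - fst w\<bar> * 1"
      by (rule mult_left_mono[OF order_trans[OF contr[OF \<xi>(1)]]]) simp_all
    finally have "(?\<eta> (fst z) - ?\<eta> (fst w))\<^sup>2 \<le> (fst z - fst w)\<^sup>2" by (simp add: abs_le_square_iff)
    then have M_lip: "norm (M z - M w) \<le> norm (z - w)"
      by (simp add: M_def model_lift_def norm_prod_def)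
    have "G z - G w = ((G z - M z) - (G w - M w)) + (M z - M w)" by simp
    also have "norm \<dots> \<le> \<delta> * norm (z - w) + norm (z - w)"
      by (intro norm_triangle_le add_mono G_lip M_lip)
    also have "\<dots> \<le> 1/4 * norm (z - w) + norm (z - w)"
      using \<delta>(2) by (intro add_right_mono mult_right_mono) auto
    finally show ?thesis by simp
  qed
  have contraction: "norm (F (G z) - G z) \<le> 3/4 * norm (F z - z)" if z: "z \<in> band (1/2) r" for z
  proof -
    have Gz: "G z \<in> band (1/2) r" by (rule G_band[OF z])
    have XG: "2 * ?N * norm (F (G z) - G z) \<le> R / 4"
      using X_small[OF Gz] N by (simp add: field_simps)
    have near_lip: "norm ((F w - w) - (F (G z) - G z)) \<le> \<sigma> * norm (w - G z)"
      if w: "norm (w - G z) \<le> 2 * ?N * norm (F (G z) - G z)" for w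
    proof (rule X_lip)
      have "\<bar>fst w - fst (G z)\<bar> \<le> R / 4" using abs_fst_le_norm[of "w - G z"] w XG by simp
      moreover have "\<bar>fst (G z) - 1/2\<bar> \<le> r" using Gz by (simp add: band_def)
      ultimately show "\<bar>fst w - 1/2\<bar> \<le> R" "\<bar>fst (G z) - 1/2\<bar> \<le> R" using r R by argo+
    qed
    have "\<bar>fst (F z) - fst z\<bar> \<le> R / 16" using abs_fst_le_norm[of "F z - z"] X_small[OF z] RN by simp
    moreover have z_r: "\<bar>fst z - 1/2\<bar> \<le> r" using z by (simp add: band_def)
    ultimately have "\<bar>fst (F z) - 1/2\<bar> \<le> R" "\<bar>fst z - 1/2\<bar> \<le> R" using r R by argo+
    then have lipG: "norm (G (F z) - G z) \<le> 5/4 * norm (F z - z)" by (rule G_lip')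
    have rel: "G (F z) = (F ^^ n) (G z)"
    proof (rule torus_cover_eq_near)
      have "torus_cover ((F ^^ n) (G z)) = (f ^^ n) (torus_cover (G z))"
        by (rule funpow_semiconj[symmetric]) (rule f_cover)
      then show "torus_cover (G (F z)) = torus_cover ((F ^^ n) (G z))"
        using relation[of "torus_cover z"] by (simp add: h_cover f_cover)
      have "?N \<le> ?N\<^sup>2" using N by (simp add: power2_eq_square)
      then have "2 * ?N \<le> 8 * ?N\<^sup>2" using N by linarith
      then have "2 * ?N * \<sigma> \<le> 8 * ?N\<^sup>2 * \<sigma>" using \<sigma>(1) by (rule mult_right_mono)
      then have "2 * ?N * \<sigma> \<le> 1" using \<sigma>(2) by (rule order_trans)
      then have "norm ((F ^^ n) (G z) - G z) \<le> 2 * ?N * norm (F (G z) - G z)"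
        using displacement_funpow(1)[of \<sigma> n "G z" F n] \<sigma>(1) near_lip by blast
      moreover have "norm (G (F z) - G z) \<le> 5/4 * (R/16)" using lipG X_small[OF z] RN by simp
      moreover have "norm (G (F z) - (F ^^ n) (G z)) \<le> norm (G (F z) - G z) + norm ((F ^^ n) (G z) - G z)"
        using norm_triangle_ineq4[of "G (F z) - G z" "(F ^^ n) (G z) - G z"] by simp
      ultimately show "norm (G (F z) - (F ^^ n) (G z)) < 1" using XG R by linarith
    qed
    show ?thesis
      by (rule displacement_contracts[OF n \<sigma> near_lip rel lipG])
  qed
  have small: "norm (F z - z) < 1/2" if "z \<in> band (1/2) r" for z
    using X_small[OF that] RN R by linarith
  have moves: "f (torus_cover z) \<notin> torus_cover ` band 0 r" if z: "z \<in> band 0 r" for z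
  proof
    assume "f (torus_cover z) \<in> torus_cover ` band 0 r"
    then obtain w where w: "torus_cover (F z) = torus_cover w" "w \<in> band 0 r" by (auto simp: f_cover)
    then obtain m l where ml: "F z = w + (of_int m, of_int l)" using torus_cover_eq_iff by blast
    have "\<bar>fst (F z) - aff_lift 1 1 (fst z)\<bar> < \<delta>"
      using abs_fst_le_norm[of "F z - P z"] F_near[of z] by (simp add: P_def model_lift_def)
    moreover have "\<bar>aff_lift 1 1 (fst z) - 1/4\<bar> \<le> 1/8" using shift[of "fst z"] z by (simp add: band_def)
    moreover have "\<bar>fst w\<bar> \<le> r" using w(2) by (simp add: band_def)
    moreover have "fst (F z) = fst w + of_int m" using ml by simp
    ultimately have "0 < (of_int m :: real)" "(of_int m :: real) < 1" using r(3) \<delta>(5) by argo+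
    then show False by simp
  qed
  show ?thesis
    by (intro perturbed_action.intro ns perturbed_action_axioms.intro)
      (fact bij_f cont_F f_cover relation contraction small moves)+
qed

text \<open>The radius \<open>R\<close> comes first, then \<open>r\<close> depending on \<open>R\<close> and \<open>\<epsilon>\<close>, then \<open>\<delta>\<close> depending on all of
  them. Only values at \<open>u = 1/2\<close> and \<open>u = 0\<close> and continuity are involved.\<close>
lemma choice_of_constants:
  fixes n :: nat and \<epsilon> :: real
  defines "\<sigma> \<equiv> 1 / (8 * (real n)\<^sup>2)"
  assumes n: "n \<ge> 2" and \<epsilon>: "\<epsilon> > 0"
  obtains R r \<delta> where "0 < R" "R \<le> 1" "0 < r" "r \<le> R/2" "r < 1/16" "2 * pi * r < \<epsilon>"
    "0 < \<delta>" "\<delta> \<le> 1/16" "\<delta> \<le> \<sigma>/2" "\<delta> \<le> R / (16 * real n)" "\<delta> \<le> r/4"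
    "2 * pi * \<delta> \<le> (sin (2 * pi * r))\<^sup>2 / 8"
    "\<And>u. \<bar>u - 1/2\<bar> \<le> R \<Longrightarrow> real n / aff_norm (real n) 0 u \<le> 3/4"
    "\<And>u. \<bar>u\<bar> \<le> r \<Longrightarrow> 4/3 \<le> real n / aff_norm (real n) 0 u"
    "\<And>u. \<bar>u - 1/2\<bar> \<le> R \<Longrightarrow> \<bar>1 / aff_norm 1 1 u - 1\<bar> \<le> \<sigma>/2"
    "\<And>u. \<bar>u - 1/2\<bar> \<le> r \<Longrightarrow> \<bar>aff_lift 1 1 u - u\<bar> \<le> R / (16 * real n)"
    "\<And>u. \<bar>u\<bar> \<le> r \<Longrightarrow> \<bar>aff_lift 1 1 u - 1/4\<bar> \<le> 1/8"
proof -
  let ?N = "real n" and ?\<eta>' = "\<lambda>u. real n / aff_norm (real n) 0 u"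
  have N: "?N \<ge> 2" using n by simp
  then have ab: "0\<^sup>2 < 4 * ?N" and ab1: "1\<^sup>2 < 4 * (1 :: real)" by simp_all
  have \<sigma>: "\<sigma> > 0" using N by (simp add: \<sigma>_def)
  have half: "aff_norm a b (1/2) = a\<^sup>2" "aff_norm a b 0 = 1 + b\<^sup>2" for a b
    by (simp_all add: aff_norm_def cos_pi_half)
  have \<eta>'half: "?\<eta>' (1/2) = 1 / ?N" and \<eta>'0: "?\<eta>' 0 = ?N"
    using N by (simp_all add: half power2_eq_square)
  have N_half: "1 / ?N \<le> 1/2" using N by (intro divide_left_mono) auto
  obtain R1 where R1: "R1 > 0" "\<And>u. \<bar>u - 1/2\<bar> \<le> R1 \<Longrightarrow> \<bar>?\<eta>' u - ?\<eta>' (1/2)\<bar> \<le> 1/4"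
    by (rule isCont_radius[where e = "1/4" and c = "1/2", OF isCont_aff_deriv[OF ab]]) (simp, rule that)
  obtain R2 where R2: "R2 > 0" "\<And>u. \<bar>u - 0\<bar> \<le> R2 \<Longrightarrow> \<bar>?\<eta>' u - ?\<eta>' 0\<bar> \<le> 2/3"
    by (rule isCont_radius[where e = "2/3" and c = 0, OF isCont_aff_deriv[OF ab]]) (simp, rule that)
  obtain R3 where R3: "R3 > 0" "\<And>u. \<bar>u - 1/2\<bar> \<le> R3 \<Longrightarrow> \<bar>1 / aff_norm 1 1 u - 1 / aff_norm 1 1 (1/2)\<bar> \<le> \<sigma>/2"
    by (rule isCont_radius[where e = "\<sigma>/2" and c = "1/2", OF isCont_aff_deriv[OF ab1]]) (use \<sigma> in simp, rule that)
  define R where "R = Min {R1, R3, 1}"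
  have R: "0 < R" "R \<le> R1" "R \<le> R3" "R \<le> 1" using R1(1) R3(1) by (auto simp: R_def)
  have cont: "isCont (aff_lift 1 1) u" for u by (rule DERIV_isCont[OF aff_lift_deriv[OF ab1]])
  have lift_half: "aff_lift 1 1 (1/2) = 1/2" by (simp add: aff_lift_def aff_num_def cos_pi_half)
  have lift_0: "aff_lift 1 1 0 = 1/4" by (simp add: aff_lift_def aff_num_def aff_den_def arctan_one)
  obtain r1 where r1: "r1 > 0" "\<And>u. \<bar>u - 1/2\<bar> \<le> r1 \<Longrightarrow> \<bar>(aff_lift 1 1 u - u) - (aff_lift 1 1 (1/2) - 1/2)\<bar> \<le> R / (16 * ?N)"
    by (rule isCont_radius[where g = "\<lambda>u. aff_lift 1 1 u - u" and c = "1/2" and e = "R / (16 * ?N)"])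
      (use cont R(1) N in simp, use R(1) N in simp, rule that)
  obtain r2 where r2: "r2 > 0" "\<And>u. \<bar>u - 0\<bar> \<le> r2 \<Longrightarrow> \<bar>aff_lift 1 1 u - aff_lift 1 1 0\<bar> \<le> 1/8"
    by (rule isCont_radius[where e = "1/8" and c = 0, OF cont]) (simp, rule that)
  define r where "r = Min {r1, r2, R2, R/2, 1/32, \<epsilon> / (4 * pi)}"
  have r: "0 < r" "r \<le> r1" "r \<le> r2" "r \<le> R2" "r \<le> R/2" "r \<le> 1/32" "r \<le> \<epsilon> / (4 * pi)"
    using r1(1) r2(1) R2(1) R(1) \<epsilon> by (auto simp: r_def)
  have "2 * pi * r \<le> 2 * pi * (\<epsilon> / (4 * pi))" using r(7) by (intro mult_left_mono) auto
  then have r\<epsilon>: "2 * pi * r < \<epsilon>" using \<epsilon> by simp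
  have s: "sin (2 * pi * r) > 0" using r(1,6) by (intro sin_gt_zero) (simp_all add: field_simps)
  define \<delta> where "\<delta> = Min {1/16, \<sigma>/2, R / (16 * ?N), r/4, (sin (2 * pi * r))\<^sup>2 / (16 * pi)}"
  have \<delta>: "0 < \<delta>" "\<delta> \<le> 1/16" "\<delta> \<le> \<sigma>/2" "\<delta> \<le> R / (16 * ?N)" "\<delta> \<le> r/4" "\<delta> \<le> (sin (2 * pi * r))\<^sup>2 / (16 * pi)"
    using \<sigma> R(1) N r(1) s by (auto simp: \<delta>_def)
  have "2 * pi * \<delta> \<le> 2 * pi * ((sin (2 * pi * r))\<^sup>2 / (16 * pi))" using \<delta>(6) by (intro mult_left_mono) auto
  then have \<delta>s: "2 * pi * \<delta> \<le> (sin (2 * pi * r))\<^sup>2 / 8" by simp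
  show thesis
  proof (rule that[of R r \<delta>])
    fix u
    show "?\<eta>' u \<le> 3/4" if "\<bar>u - 1/2\<bar> \<le> R"
      using R1(2)[of u] that R(2) N_half unfolding \<eta>'half by linarith
    show "4/3 \<le> ?\<eta>' u" if "\<bar>u\<bar> \<le> r"
    proof -
      have "\<bar>u - 0\<bar> \<le> R2" using that r(4) by simp
      from R2(2)[OF this] show ?thesis using N unfolding \<eta>'0 by linarith
    qed
    show "\<bar>1 / aff_norm 1 1 u - 1\<bar> \<le> \<sigma>/2" if "\<bar>u - 1/2\<bar> \<le> R"
      using R3(2)[of u] that R(3) unfolding half by simp
    show "\<bar>aff_lift 1 1 u - u\<bar> \<le> R / (16 * ?N)" if "\<bar>u - 1/2\<bar> \<le> r"
      using r1(2)[of u] that r(2) unfolding lift_half by simp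
    show "\<bar>aff_lift 1 1 u - 1/4\<bar> \<le> 1/8" if "\<bar>u\<bar> \<le> r"
      using r2(2)[of u] that r(3) unfolding lift_0 by simp
  qed (use R r r\<epsilon> \<delta> \<delta>s in auto)
qed

theorem theorem2:
  fixes n :: nat and \<epsilon> :: real
  assumes "n \<ge> 2" and "\<epsilon> > 0"
  shows "\<exists>U V. openin C1_topology U \<and> f0 \<in> U \<and> openin C1_topology V \<and> h0 n \<in> V \<and>
    (\<forall>f\<in>U. \<forall>h\<in>V. h \<circ> f \<circ> inv_into UNIV h = f ^^ n \<longrightarrow>
      (\<exists>C1 C2.
        (close_circle \<epsilon> Infty C1 \<and> close_circle \<epsilon> (Fin 0) C2 \<and>
         h ` C1 = C1 \<and> h ` C2 = C2 \<and>
         (\<forall>p. p \<notin> C2 \<longrightarrow> omega_limit h p \<subseteq> C1) \<and>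
         (\<forall>p. p \<notin> C1 \<longrightarrow> alpha_limit h p \<subseteq> C2)) \<and>
        (fix_set f \<noteq> {} \<and> fix_set f \<subseteq> C1) \<and>
        ((\<exists>p. finite (orbit (action_group f h) (\<lambda>g. g) p) \<and>
              orbit (action_group f h) (\<lambda>g. g) p \<subseteq> C1) \<or>
         (\<exists>M. minimal_set (action_group f h) (\<lambda>g. g) M \<and>
              (\<forall>M'. minimal_set (action_group f h) (\<lambda>g. g) M' \<longrightarrow> M' = M) \<and>
              M \<subseteq> C1 \<and> M \<subseteq> fix_set f \<and>
              (M = C1 \<or> cantor_set M)))))"
proof -
  obtain R r \<delta> where c: "0 < R" "R \<le> 1" "0 < r" "r \<le> R/2" "r < 1/16" "2 * pi * r < \<epsilon>"
    "0 < \<delta>" "\<delta> \<le> 1/16" "\<delta> \<le> 1 / (8 * (real n)\<^sup>2) / 2" "\<delta> \<le> R / (16 * real n)" "\<delta> \<le> r/4"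
    "2 * pi * \<delta> \<le> (sin (2 * pi * r))\<^sup>2 / 8"
    "\<And>u. \<bar>u - 1/2\<bar> \<le> R \<Longrightarrow> real n / aff_norm (real n) 0 u \<le> 3/4"
    "\<And>u. \<bar>u\<bar> \<le> r \<Longrightarrow> 4/3 \<le> real n / aff_norm (real n) 0 u"
    "\<And>u. \<bar>u - 1/2\<bar> \<le> R \<Longrightarrow> \<bar>1 / aff_norm 1 1 u - 1\<bar> \<le> 1 / (8 * (real n)\<^sup>2) / 2"
    "\<And>u. \<bar>u - 1/2\<bar> \<le> r \<Longrightarrow> \<bar>aff_lift 1 1 u - u\<bar> \<le> R / (16 * real n)"
    "\<And>u. \<bar>u\<bar> \<le> r \<Longrightarrow> \<bar>aff_lift 1 1 u - 1/4\<bar> \<le> 1/8"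
    by (rule choice_of_constants[OF assms]) (rule that)
  have "f0 \<in> Diff1" "h0 n \<in> Diff1"
    using assms(1) unfolding f0_model h0_model by (auto intro!: model_Diff1)
  then obtain U V where U: "openin C1_topology U" "f0 \<in> U" "\<And>g. g \<in> U \<Longrightarrow> g \<in> Diff1 \<and> C1_close \<delta> f0 g"
    and V: "openin C1_topology V" "h0 n \<in> V" "\<And>g. g \<in> V \<Longrightarrow> g \<in> Diff1 \<and> C1_close \<delta> (h0 n) g"
    using C1_neighbourhood[OF _ c(7)] by metis
  have main: "\<exists>C1 C2.
        (close_circle \<epsilon> Infty C1 \<and> close_circle \<epsilon> (Fin 0) C2 \<and>
         h ` C1 = C1 \<and> h ` C2 = C2 \<and>
         (\<forall>p. p \<notin> C2 \<longrightarrow> omega_limit h p \<subseteq> C1) \<and>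
         (\<forall>p. p \<notin> C1 \<longrightarrow> alpha_limit h p \<subseteq> C2)) \<and>
        (fix_set f \<noteq> {} \<and> fix_set f \<subseteq> C1) \<and>
        ((\<exists>p. finite (orbit (action_group f h) (\<lambda>g. g) p) \<and>
              orbit (action_group f h) (\<lambda>g. g) p \<subseteq> C1) \<or>
         (\<exists>M. minimal_set (action_group f h) (\<lambda>g. g) M \<and>
              (\<forall>M'. minimal_set (action_group f h) (\<lambda>g. g) M' \<longrightarrow> M' = M) \<and>
              M \<subseteq> C1 \<and> M \<subseteq> fix_set f \<and>
              (M = C1 \<or> cantor_set M)))"
    if f: "f \<in> Diff1" "C1_close \<delta> f0 f" and h: "h \<in> Diff1" "C1_close \<delta> (h0 n) h"
      and rel: "h \<circ> f \<circ> inv_into UNIV h = f ^^ n" for f h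
  proof -
    have r: "r < 1/4" and contr: "\<And>u. \<bar>u - 1/2\<bar> \<le> r \<Longrightarrow> real n / aff_norm (real n) 0 u \<le> 3/4"
      using c(1,4,5,13) by auto
    obtain G K where ns: "north_south G K h (inv_into UNIV h) (1/2) 0 r (7/8)"
      and "\<And>z. norm (G z - model_lift (real n) 0 (ln (real n)) z) < \<delta>"
      and G: "\<And>z w. norm ((G z - model_lift (real n) 0 (ln (real n)) z) - (G w - model_lift (real n) 0 (ln (real n)) w))
        \<le> \<delta> * norm (z - w)"
      by (rule perturbed_north_south[OF assms(1) c(3) r c(7,8,11,12) contr c(14) h])
        (assumption, assumption, rule that)
    obtain F where F: "continuous_on UNIV F" "\<And>z. f (torus_cover z) = torus_cover (F z)"
      "\<And>z. norm (F z - model_lift 1 1 0 z) < \<delta>"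
      "\<And>z w. norm ((F z - model_lift 1 1 0 z) - (F w - model_lift 1 1 0 w)) \<le> \<delta> * norm (z - w)"
      by (rule C1_close_model[of 1 1 \<delta> 0 f]) (simp, use f(2) in \<open>simp add: f0_model\<close>, rule that)
    have bij: "bij f" "bij h" using f h by (auto simp: Diff1_def)
    have rel': "h (f p) = (f ^^ n) (h p)" for p
      using fun_cong[OF rel, of "h p"] by (simp add: bij_is_inj[OF bij(2)])
    interpret perturbed_action G K h "inv_into UNIV h" "1/2" 0 r "7/8" F f n
      by (rule perturbed_action_near_model[OF assms(1) c(1-5,7-11,13,15-17) ns G bij(1) F rel'])
    have centre: "rp_cover (1/2) = Infty" "rp_cover 0 = Fin 0"
      by (simp_all add: rp_cover_def cos_pi_half)
    show ?thesis
    proof (intro exI conjI allI impI)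
      show "close_circle \<epsilon> Infty attracting_circle"
        using close_circle_attracting_circle[OF c(6)] by (simp only: centre)
      show "close_circle \<epsilon> (Fin 0) repelling_circle"
        using rev.close_circle_attracting_circle[OF c(6)] by (simp only: centre repelling_circle_eq)
      show "h ` attracting_circle = attracting_circle" by (rule image_attracting_circle)
      have "inv_into UNIV h ` repelling_circle = repelling_circle"
        unfolding repelling_circle_eq by (rule rev.image_attracting_circle)
      then have "h ` inv_into UNIV h ` repelling_circle = h ` repelling_circle" by simp
      then show "h ` repelling_circle = repelling_circle" by (simp add: image_comp o_def)
      show "omega_limit h p \<subseteq> attracting_circle" if "p \<notin> repelling_circle" for p
        using that by (rule omega_limit_subset)
      show "alpha_limit h p \<subseteq> repelling_circle" if "p \<notin> attracting_circle" for p
        using rev.omega_limit_subset[of p] that unfolding alpha_limit_def repelling_circle_eq rev_repelling_circle_eq by blast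
      show "fix_set f \<noteq> {}" by (rule fix_nonempty)
      show "fix_set f \<subseteq> attracting_circle" by (rule fix_subset_circle)
      show "(\<exists>p. finite (orbit (action_group f h) (\<lambda>g. g) p) \<and>
              orbit (action_group f h) (\<lambda>g. g) p \<subseteq> attracting_circle) \<or>
         (\<exists>M. minimal_set (action_group f h) (\<lambda>g. g) M \<and>
              (\<forall>M'. minimal_set (action_group f h) (\<lambda>g. g) M' \<longrightarrow> M' = M) \<and>
              M \<subseteq> attracting_circle \<and> M \<subseteq> fix_set f \<and>
              (M = attracting_circle \<or> cantor_set M))"
      proof (cases "\<exists>q t p. 0 < q \<and> (circ_map ^^ q) t = t + of_int p")
        case True
        then show ?thesis using finite_orbit by blast
      next
        case False
        then interpret aperiodic_action G K h "inv_into UNIV h" "1/2" 0 r "7/8" F f n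
          by unfold_locales blast
        show ?thesis
          using minimal_min_set minimal_unique min_set_fix fix_subset_circle min_set_dichotomy by blast
      qed
    qed
  qed
  show ?thesis
    by (intro exI[of _ U] exI[of _ V] conjI ballI impI U(1,2) V(1,2) main) (use U(3) V(3) in auto)
qed

end
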